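(* Let $N\geq 2$ and let $s_0,s_1,\dots,s_N$ be generic nonzero complex numbers. On $\mathcal{O}\big(U^N_{|t^{-1}|}\big)$ one has $$\big[\,D_x(s_1,\dots,s_N;q,q/t),\ I(s_1/s_0,\dots,s_N/s_0)\,\big]=0 .$$
   Context: $q,t$ are generic complex numbers with $|q|<1$ and $|t^{-1}|<|q|$. $(a;q)_\infty=\prod_{n\ge0}(1-q^na)$ and $\theta_q(a)=(a;q)_\infty(q/a;q)_\infty$. $U^N_r=\{(z_1,\dots,z_{N-1})\in\mathbb{C}^{N-1}: |z_i|<r\ \text{for all } i\}$. $\mathcal{O}(U^N_r)\subset\mathbb{C}[[x_2/x_1,\dots,x_N/x_{N-1}]]$ is the set of power series in $z_i=x_{i+1}/x_i$ which converge absolutely on $\{|z_i|\le r'\ \forall i\}$ for every $r'<r$, i.e. define holomorphic functions on $U^N_r$. Macdonald $q$-difference operator: for $\boldsymbol{s}=(s_1,\dots,s_N)$, $$D_x(\boldsymbol{s};q,t)=\sum_{k=1}^Ns_k\prod_{1\le\ell<k}\frac{1-tx_k/x_\ell}{1-x_k/x_\ell}\prod_{k<\ell\le N}\frac{1-x_\ell/(tx_k)}{1-x_\ell/x_k}\,T_{q,x_k},$$ where $T_{q,x_k}$ replaces $x_k$ by $qx_k$. In the claim it is used with $t$ replaced by $q/t$. Integral operator: $$I(s_1/s_0,\dots,s_N/s_0)(f)(x_1,\dots,x_N)=\mathcal{K}(s)\prod_{1\le i<j\le N}\frac{(qx_j/(tx_i);q)_\infty}{(tx_j/x_i;q)_\infty}\oint_{C'}\prod_{i=1}^N\frac{dy_i}{2\pi\sqrt{-1}\,y_i}\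 \Pi^{(q,t)}(x|y)\prod_{i=1}^N\frac{\theta_q(qs_0y_i/(s_ix_i))}{\theta_q(qy_i/x_i)}\prod_{1\le i<j\le N}\frac{\theta_q(tx_j/y_i)}{\theta_q(x_j/y_i)}\prod_{1\le i<j\le N}(1-y_j/y_i)\ f(y_1,\dots,y_N),$$ $$\mathcal{K}(s)=\prod_{i=1}^N\frac{(q;q)_\infty(q/t;q)_\infty}{(qs_0/s_i;q)_\infty(qs_i/(ts_0);q)_\infty},\qquad \Pi^{(q,t)}(x|y)=\prod_{i,j=1}^N\frac{(qy_j/x_i;q)_\infty}{(qy_j/(tx_i);q)_\infty}.$$ The contour $C'$ is chosen so that $|y_{k+1}/(qy_k)|<|t^{-1}|$ $(1\le k\le N-1)$ and $|t^{-1}|<|x_i/y_i|<|q|$ $(1\le i\le N)$, the $x_i$ being regarded as complex variables with $|x_{k+1}/x_k|<|t^{-1}|$ $(1\le k\le N-1)$; the result is regarded as a power series in the $x_{k+1}/x_k$. *)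

theory Defs
  imports "HOL-Complex_Analysis.Complex_Analysis"
begin

section \<open>q-Pochhammer symbols and theta functions\<close>

definition qpoch :: "complex \<Rightarrow> complex \<Rightarrow> complex" where
  "qpoch q a = (\<Prod>n. 1 - q ^ n * a)"

definition qtheta :: "complex \<Rightarrow> complex \<Rightarrow> complex" where
  "qtheta q a = qpoch q a * qpoch q (q / a)"


section \<open>Power series in the ratios of the variables\<close>

text \<open>
  Variables \<open>x\<^sub>1, \<dots>, x\<^sub>N\<close> are a function \<open>x :: nat \<Rightarrow> complex\<close> of which only the values on \<open>{1..N}\<close>
  matter; likewise \<open>z\<^sub>1, \<dots>, z\<^bsub>N-1\<^esub>\<close> live on \<open>{1..<N}\<close>. A formal power series in
  \<open>z\<^sub>1, \<dots>, z\<^bsub>N-1\<^esub>\<close> is its family of coefficients, indexed by exponent vectors; it is normalised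
  to vanish at all \<open>m\<close> that are not exponent vectors, so that equality of families is equality of
  power series.
\<close>

definition exponents :: "nat \<Rightarrow> (nat \<Rightarrow> nat) set" where
  "exponents N = {m. \<forall>i. i \<notin> {1..<N} \<longrightarrow> m i = 0}"

definition power_series :: "nat \<Rightarrow> ((nat \<Rightarrow> nat) \<Rightarrow> complex) set" where
  "power_series N = {a. \<forall>m. m \<notin> exponents N \<longrightarrow> a m = 0}"

definition zmonom :: "nat \<Rightarrow> (nat \<Rightarrow> complex) \<Rightarrow> (nat \<Rightarrow> nat) \<Rightarrow> complex" where
  "zmonom N z m = (\<Prod>i = 1..<N. z i ^ m i)"

definition ratios :: "(nat \<Rightarrow> complex) \<Rightarrow> nat \<Rightarrow> complex" where
  "ratios x = (\<lambda>i. x (Suc i) / x i)"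

text \<open>The space \<open>\<O>(U\<^sup>N\<^sub>r)\<close>.\<close>

definition hol_series :: "nat \<Rightarrow> real \<Rightarrow> ((nat \<Rightarrow> nat) \<Rightarrow> complex) set" where
  "hol_series N r =
    {a \<in> power_series N. \<forall>r'<r. \<forall>z. (\<forall>i\<in>{1..<N}. cmod (z i) \<le> r') \<longrightarrow>
        (\<lambda>m. norm (a m * zmonom N z m)) summable_on exponents N}"

text \<open>A power series, regarded as a function of the \<open>x\<^sub>i\<close>.\<close>

definition series_fun :: "nat \<Rightarrow> ((nat \<Rightarrow> nat) \<Rightarrow> complex) \<Rightarrow> (nat \<Rightarrow> complex) \<Rightarrow> complex" where
  "series_fun N a x = (\<Sum>\<^sub>\<infinity>m\<in>exponents N. a m * zmonom N (ratios x) m)"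

definition ratio_domain :: "nat \<Rightarrow> real \<Rightarrow> (nat \<Rightarrow> complex) set" where
  "ratio_domain N r =
    {x. (\<forall>i\<in>{1..N}. x i \<noteq> 0) \<and> (\<forall>k\<in>{1..<N}. cmod (x (k + 1) / x k) < r)}"


section \<open>The Macdonald operator\<close>

definition macdonald_fun ::
  "nat \<Rightarrow> complex \<Rightarrow> complex \<Rightarrow> (nat \<Rightarrow> complex) \<Rightarrow>
   ((nat \<Rightarrow> complex) \<Rightarrow> complex) \<Rightarrow> (nat \<Rightarrow> complex) \<Rightarrow> complex" where
  "macdonald_fun N q t s F x =
    (\<Sum>k = 1..N. s k
       * (\<Prod>l = 1..<k. (1 - t * x k / x l) / (1 - x k / x l))
       * (\<Prod>l = k+1..N. (1 - x l / (t * x k)) / (1 - x l / x k))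
       * F (x(k := q * x k)))"

text \<open>
  Action on power series: the coefficients are expanded in the region
  \<open>\<bar>x\<^sub>N\<bar> \<lless> \<dots> \<lless> \<bar>x\<^sub>1\<bar>\<close>, i.e. the result is the power series in the ratios that represents
  \<open>macdonald_fun\<close> when all ratios are small.
\<close>

definition macdonald_graph ::
  "nat \<Rightarrow> complex \<Rightarrow> complex \<Rightarrow> (nat \<Rightarrow> complex) \<Rightarrow>
   ((nat \<Rightarrow> nat) \<Rightarrow> complex) \<Rightarrow> ((nat \<Rightarrow> nat) \<Rightarrow> complex) \<Rightarrow> bool" where
  "macdonald_graph N q t s f g \<longleftrightarrow> g \<in> power_series N \<and>
    (\<exists>r>0. \<forall>x\<in>ratio_domain N r.
       ((\<lambda>m. g m * zmonom N (ratios x) m) has_sum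
          macdonald_fun N q t s (series_fun N f) x) (exponents N))"

definition macdonald_defined ::
  "nat \<Rightarrow> complex \<Rightarrow> complex \<Rightarrow> (nat \<Rightarrow> complex) \<Rightarrow> ((nat \<Rightarrow> nat) \<Rightarrow> complex) \<Rightarrow> bool" where
  "macdonald_defined N q t s f \<longleftrightarrow> (\<exists>!g. macdonald_graph N q t s f g)"

definition macdonald_op ::
  "nat \<Rightarrow> complex \<Rightarrow> complex \<Rightarrow> (nat \<Rightarrow> complex) \<Rightarrow>
   ((nat \<Rightarrow> nat) \<Rightarrow> complex) \<Rightarrow> ((nat \<Rightarrow> nat) \<Rightarrow> complex)" where
  "macdonald_op N q t s f = (THE g. macdonald_graph N q t s f g)"


section \<open>The integral operator\<close>

text \<open>
  \<open>torus_integral N \<rho> F\<close> is the integral of \<open>F y\<close> against \<open>\<Prod>\<^sub>i dy\<^sub>i / (2\<pi>\<i> y\<^sub>i)\<close> over the product of the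
  positively oriented circles \<open>\<bar>y\<^sub>i\<bar> = \<rho> i\<close>, \<open>1 \<le> i \<le> N\<close>, as an iterated contour integral.
\<close>

primrec torus_integral ::
  "nat \<Rightarrow> (nat \<Rightarrow> real) \<Rightarrow> ((nat \<Rightarrow> complex) \<Rightarrow> complex) \<Rightarrow> complex" where
  "torus_integral 0 \<rho> F = F (\<lambda>_. 0)"
| "torus_integral (Suc n) \<rho> F =
     contour_integral (circlepath 0 (\<rho> (Suc n)))
       (\<lambda>w. torus_integral n \<rho> (\<lambda>y. F (y(Suc n := w))) / (2 * of_real pi * \<i> * w))"

definition admissible_contour ::
  "nat \<Rightarrow> complex \<Rightarrow> complex \<Rightarrow> (nat \<Rightarrow> complex) \<Rightarrow> (nat \<Rightarrow> real) \<Rightarrow> bool" where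
  "admissible_contour N q t x \<rho> \<longleftrightarrow>
    (\<forall>i\<in>{1..N}. \<rho> i > 0) \<and>
    (\<forall>k\<in>{1..<N}. \<rho> (k + 1) / (cmod q * \<rho> k) < cmod (inverse t)) \<and>
    (\<forall>i\<in>{1..N}. cmod (inverse t) < cmod (x i) / \<rho> i \<and> cmod (x i) / \<rho> i < cmod q)"

definition kernel_const ::
  "nat \<Rightarrow> complex \<Rightarrow> complex \<Rightarrow> complex \<Rightarrow> (nat \<Rightarrow> complex) \<Rightarrow> complex" where
  "kernel_const N q t s0 s =
    (\<Prod>i = 1..N. (qpoch q q * qpoch q (q / t)) /
       (qpoch q (q * s0 / s i) * qpoch q (q * s i / (t * s0))))"

definition kernel_Pi ::
  "nat \<Rightarrow> complex \<Rightarrow> complex \<Rightarrow> (nat \<Rightarrow> complex) \<Rightarrow> (nat \<Rightarrow> complex) \<Rightarrow> complex" where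
  "kernel_Pi N q t x y =
    (\<Prod>i = 1..N. \<Prod>j = 1..N. qpoch q (q * y j / x i) / qpoch q (q * y j / (t * x i)))"

text \<open>
  Zeros of the denominators of the integrand that lie on an admissible torus are removable
  singularities: the zeros of \<open>qpoch q (q * y j / (t * x i))\<close> for \<open>j < i\<close> and those of
  \<open>qtheta q (x j / y i)\<close> and \<open>qtheta q (q * y i / x i)\<close> cancel against numerators. They occupy
  finitely many values of each \<open>y\<^sub>i\<close>, so the value \<open>0\<close> that division by zero assigns there does not
  affect the integral.
\<close>

definition integral_fun ::
  "nat \<Rightarrow> complex \<Rightarrow> complex \<Rightarrow> complex \<Rightarrow> (nat \<Rightarrow> complex) \<Rightarrow>
   ((nat \<Rightarrow> complex) \<Rightarrow> complex) \<Rightarrow> (nat \<Rightarrow> real) \<Rightarrow> (nat \<Rightarrow> complex) \<Rightarrow> complex" where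
  "integral_fun N q t s0 s F \<rho> x =
    kernel_const N q t s0 s
    * (\<Prod>i = 1..N. \<Prod>j = i+1..N. qpoch q (q * x j / (t * x i)) / qpoch q (t * x j / x i))
    * torus_integral N \<rho> (\<lambda>y.
        kernel_Pi N q t x y
        * (\<Prod>i = 1..N. qtheta q (q * s0 * y i / (s i * x i)) / qtheta q (q * y i / x i))
        * (\<Prod>i = 1..N. \<Prod>j = i+1..N. qtheta q (t * x j / y i) / qtheta q (x j / y i))
        * (\<Prod>i = 1..N. \<Prod>j = i+1..N. 1 - y j / y i)
        * F y)"

text \<open>
  For some \<open>x\<close> in the domain there is no admissible contour, but there is one as soon as all ratios
  are smaller than \<open>\<bar>q / t\<bar>\<close>; so the power series \<open>g\<close> below is determined by \<open>f\<close>.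
\<close>

definition integral_graph ::
  "nat \<Rightarrow> complex \<Rightarrow> complex \<Rightarrow> complex \<Rightarrow> (nat \<Rightarrow> complex) \<Rightarrow>
   ((nat \<Rightarrow> nat) \<Rightarrow> complex) \<Rightarrow> ((nat \<Rightarrow> nat) \<Rightarrow> complex) \<Rightarrow> bool" where
  "integral_graph N q t s0 s f g \<longleftrightarrow> g \<in> power_series N \<and>
    (\<forall>x\<in>ratio_domain N (cmod (inverse t)). \<forall>\<rho>. admissible_contour N q t x \<rho> \<longrightarrow>
       ((\<lambda>m. g m * zmonom N (ratios x) m) has_sum
          integral_fun N q t s0 s (series_fun N f) \<rho> x) (exponents N))"

definition integral_defined ::
  "nat \<Rightarrow> complex \<Rightarrow> complex \<Rightarrow> complex \<Rightarrow> (nat \<Rightarrow> complex) \<Rightarrow>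
   ((nat \<Rightarrow> nat) \<Rightarrow> complex) \<Rightarrow> bool" where
  "integral_defined N q t s0 s f \<longleftrightarrow> (\<exists>!g. integral_graph N q t s0 s f g)"

text \<open>The operator \<open>I(s\<^sub>1/s\<^sub>0, \<dots>, s\<^sub>N/s\<^sub>0)\<close> on power series.\<close>

definition integral_op ::
  "nat \<Rightarrow> complex \<Rightarrow> complex \<Rightarrow> complex \<Rightarrow> (nat \<Rightarrow> complex) \<Rightarrow>
   ((nat \<Rightarrow> nat) \<Rightarrow> complex) \<Rightarrow> ((nat \<Rightarrow> nat) \<Rightarrow> complex)" where
  "integral_op N q t s0 s f = (THE g. integral_graph N q t s0 s f g)"

end

theory Submission
  imports Defs
begin

text \<open>
  Write the integral operator as \<open>(I f)(x) = \<oint> K(x, y) f(y) dy/y\<close> and let \<open>A k\<close> and \<open>T k\<close> denote the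
  coefficients and the shifts of the Macdonald operator. Applied to \<open>I f\<close>, the operator acts on the
  first argument of \<open>K\<close>. In \<open>I (D f)\<close> the substitution \<open>y k \<mapsto> y k / q\<close> moves it to the second
  argument. So the theorem follows from the pointwise identity
  \<open>\<Sum>k. s k * A k (x) * K (T k x, y) = \<Sum>k. s k * A k (T k\<inverse> y) * K (x, T k\<inverse> y)\<close> (\<open>kernel_intertwines\<close>),
  provided that each contour can be moved back to the original one without meeting a pole.

  In the identity, the quasi-periodicity of the theta functions turns every \<open>s k\<close> into \<open>s0\<close>. The
  other factors of \<open>K\<close> change by rational functions (\<open>kernel_shift_x\<close>, \<open>kernel_shift_y\<close>), and what
  remains is the statement that the residues of one rational function of a single variable add up
  to zero (\<open>residue_identity\<close>).

  As to the contours: after the zeros of the theta functions have been cancelled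
  (\<open>integrand_eq_reduced_kernel\<close>), the kernel is a function of the ratios \<open>z k = x (k + 1) / x k\<close> and
  of \<open>w i = y i / x i\<close> that is holomorphic for \<open>|z k| < |1 / t|\<close> and \<open>1 < |w i| < |t / q|\<close>. The
  annulus \<open>1 / |q| < |w i| < |t|\<close> of the admissible contours is smaller by the factor \<open>|q|\<close> on either
  side, so multiplying one \<open>y k\<close> by \<open>q\<close> or \<open>1 / q\<close> stays within the domain of holomorphy when the
  ratios of the \<open>x i\<close> are small (\<open>torus_integral_annuli\<close>). Since a power series is determined by its
  values at small ratios, nothing more is needed for the equality
  (\<open>macdonald_integral_commute\<close>, \<open>integral_macdonald_commute\<close>).

  That the operators are defined on power series requires some function theory in several variables:
  integrals over tori depend holomorphically on parameters, so that they have power series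
  expansions (\<open>torus_integral_power_series\<close>), and the expansions found with different contours agree
  because they agree near the origin (\<open>power_series_glue\<close>).
\<close>

section \<open>The infinite q-shifted factorial\<close>

lemma qpoch_abs_convergent:
  assumes "cmod q < 1"
  shows "abs_convergent_prod (\<lambda>n. 1 - q ^ n * a)"
proof (rule summable_imp_abs_convergent_prod)
  have "summable (\<lambda>n. cmod q ^ n * cmod a)"
    using assms by (intro summable_mult2 summable_geometric) auto
  thus "summable (\<lambda>n. norm (1 - q ^ n * a - 1))"
    by (simp add: norm_mult norm_power)
qed

lemma qpoch_convergent:
  "cmod q < 1 \<Longrightarrow> convergent_prod (\<lambda>n. 1 - q ^ n * a)"
  using abs_convergent_prod_imp_convergent_prod qpoch_abs_convergent by blast

lemma qpoch_step:
  assumes "cmod q < 1"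
  shows "qpoch q a = (1 - a) * qpoch q (q * a)"
proof -
  have "(\<lambda>n. 1 - q ^ n * a) has_prod ((\<Prod>k<1. 1 - q ^ k * a) * (\<Prod>k. 1 - q ^ (k + 1) * a))"
    by (rule has_prod_ignore_initial_segment'[OF qpoch_convergent[OF assms]])
  thus ?thesis
    unfolding qpoch_def by (simp add: has_prod_iff mult_ac)
qed

lemma qpoch_eq_0_imp:
  assumes "cmod q < 1" "qpoch q a = 0"
  shows "\<exists>n. q ^ n * a = 1"
  using prodinf_nonzero[OF qpoch_convergent[OF assms(1)], of a] assms(2)
  unfolding qpoch_def by (metis eq_iff_diff_eq_0)

lemma qpoch_nonzero:
  assumes "cmod q < 1" "cmod a < 1"
  shows "qpoch q a \<noteq> 0"
proof
  assume "qpoch q a = 0"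
  then obtain n where "q ^ n * a = 1" using qpoch_eq_0_imp assms by blast
  hence "cmod q ^ n * cmod a = 1" by (metis norm_mult norm_one norm_power)
  moreover have "cmod q ^ n * cmod a \<le> 1 * cmod a"
    using assms by (intro mult_right_mono power_le_one) auto
  ultimately show False using assms by simp
qed

lemma qpoch_holomorphic:
  assumes q: "cmod q < 1"
  shows "qpoch q holomorphic_on UNIV"
proof (rule holomorphic_uniform_sequence[where f = "\<lambda>N a. \<Prod>n<N. 1 - q ^ n * a"])
  fix z :: complex
  define C where "C = cball z 1"
  have "uniformly_convergent_on C (\<lambda>N a. \<Prod>n<N. 1 - q ^ n * a)"
  proof (rule uniformly_convergent_on_prod')
    show "compact C" by (simp add: C_def)
    show "uniformly_convergent_on C (\<lambda>N a. \<Sum>n<N. norm (1 - q ^ n * a - 1))"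
    proof (rule Weierstrass_m_test'[where M = "\<lambda>n. cmod q ^ n * (cmod z + 1)"])
      fix n a assume "a \<in> C"
      hence "cmod a \<le> cmod z + 1"
        using norm_triangle_ineq4[of z "z - a"] by (simp add: C_def dist_norm)
      thus "norm (norm (1 - q ^ n * a - 1)) \<le> cmod q ^ n * (cmod z + 1)"
        by (simp add: norm_mult norm_power mult_left_mono)
    next
      show "summable (\<lambda>n. cmod q ^ n * (cmod z + 1))"
        using q by (intro summable_mult2 summable_geometric) auto
    qed
  qed (auto intro!: continuous_intros)
  then obtain l where l: "uniform_limit C (\<lambda>N a. \<Prod>n<N. 1 - q ^ n * a) l sequentially"
    unfolding uniformly_convergent_on_def by blast
  have "l a = qpoch q a" if "a \<in> C" for a
  proof -
    have 1: "(\<lambda>N. \<Prod>n<N. 1 - q ^ n * a) \<longlonglongrightarrow> l a"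
      using l that by (rule tendsto_uniform_limitI)
    have "(\<lambda>N. \<Prod>n\<le>N. 1 - q ^ n * a) \<longlonglongrightarrow> qpoch q a"
      unfolding qpoch_def by (rule convergent_prod_LIMSEQ[OF qpoch_convergent[OF q]])
    hence "(\<lambda>N. \<Prod>n<Suc N. 1 - q ^ n * a) \<longlonglongrightarrow> qpoch q a"
      by (simp add: lessThan_Suc_atMost)
    hence "(\<lambda>N. \<Prod>n<N. 1 - q ^ n * a) \<longlonglongrightarrow> qpoch q a"
      by (rule filterlim_sequentially_Suc[THEN iffD1])
    with 1 show ?thesis by (rule LIMSEQ_unique)
  qed
  hence "uniform_limit C (\<lambda>N a. \<Prod>n<N. 1 - q ^ n * a) (qpoch q) sequentially"
    using l by (simp cong: uniform_limit_cong')
  thus "\<exists>d>0. cball z d \<subseteq> UNIV \<and>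
      uniform_limit (cball z d) (\<lambda>N a. \<Prod>n<N. 1 - q ^ n * a) (qpoch q) sequentially"
    unfolding C_def by (intro exI[of _ 1]) auto
qed (auto intro!: holomorphic_intros)

lemma qpoch_field_differentiable:
  "cmod q < 1 \<Longrightarrow> qpoch q field_differentiable (at a)"
  using qpoch_holomorphic holomorphic_on_imp_differentiable_at by blast

text \<open>
  The zeros of \<open>qpoch q\<close> are the powers \<open>q\<close> to the \<open>-n\<close>; they have pairwise different moduli, so a circle
  contains at most one of them.
\<close>

lemma finite_qpoch_zeros_on_circle:
  assumes q: "cmod q < 1" "q \<noteq> 0" and c: "c \<noteq> 0"
  shows "finite {y. cmod y = \<rho> \<and> qpoch q (c * y) = 0}"
proof (cases "\<rho> > 0")
  case True
  have "{y. cmod y = \<rho> \<and> qpoch q (c * y) = 0}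
      \<subseteq> (\<lambda>n. 1 / (q ^ n * c)) ` {n. cmod q ^ n * (cmod c * \<rho>) = 1}"
  proof
    fix y assume "y \<in> {y. cmod y = \<rho> \<and> qpoch q (c * y) = 0}"
    then obtain n where n: "cmod y = \<rho>" "q ^ n * (c * y) = 1"
      using qpoch_eq_0_imp q by blast
    hence "y = 1 / (q ^ n * c)" using q c by (simp add: field_simps)
    moreover have "cmod q ^ n * (cmod c * \<rho>) = 1"
      using n by (metis norm_mult norm_one norm_power)
    ultimately show "y \<in> (\<lambda>n. 1 / (q ^ n * c)) ` {n. cmod q ^ n * (cmod c * \<rho>) = 1}" by blast
  qed
  moreover have "finite {n. cmod q ^ n * (cmod c * \<rho>) = 1}"
  proof (rule finite_subset)
    show "{n. cmod q ^ n * (cmod c * \<rho>) = 1} \<subseteq> {THE n. cmod q ^ n * (cmod c * \<rho>) = 1}"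
    proof
      fix m assume "m \<in> {n. cmod q ^ n * (cmod c * \<rho>) = 1}"
      hence m: "cmod q ^ m * (cmod c * \<rho>) = 1" by simp
      have "(THE n. cmod q ^ n * (cmod c * \<rho>) = 1) = m"
      proof (rule the_equality)
        fix n assume "cmod q ^ n * (cmod c * \<rho>) = 1"
        hence "cmod q ^ n = cmod q ^ m"
          using m c True by (metis mult_right_cancel mult_zero_right zero_neq_one)
        thus "n = m" using q by (simp add: power_inject_exp')
      qed fact
      thus "m \<in> {THE n. cmod q ^ n * (cmod c * \<rho>) = 1}" by simp
    qed
  qed simp
  ultimately show ?thesis using finite_surj by blast
next
  case False
  hence "{y. cmod y = \<rho> \<and> qpoch q (c * y) = 0} \<subseteq> {0}"
    by (smt (verit) mem_Collect_eq norm_le_zero_iff singleton_iff subsetI)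
  thus ?thesis using finite_subset by blast
qed

text \<open>
  The quasi-periodicity of the theta function. The two sides differ in one factor of each infinite
  product, and \<open>1 - a = - a * (1 - 1 / a)\<close>; nothing is divided by, so the zero \<open>a = 1\<close> is included.
\<close>

lemma qtheta_step:
  assumes "cmod q < 1" "a \<noteq> 0" "q \<noteq> 0"
  shows "qtheta q a = - a * qtheta q (q * a)"
proof -
  have "qtheta q a = (1 - a) * qpoch q (q * a) * qpoch q (q * (1 / a))"
    unfolding qtheta_def by (subst qpoch_step[OF assms(1)]) simp
  moreover have "qtheta q (q * a) = qpoch q (q * a) * ((1 - 1 / a) * qpoch q (q * (1 / a)))"
    unfolding qtheta_def using assms(3)
    by (subst (2) qpoch_step[OF assms(1)]) simp
  ultimately have "qtheta q a = (1 - a) * (qpoch q (q * a) * qpoch q (q * (1 / a)))"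
    "- a * qtheta q (q * a) = - a * (1 - 1 / a) * (qpoch q (q * a) * qpoch q (q * (1 / a)))"
    by simp_all
  moreover have "- a * (1 - 1 / a) = 1 - a" using assms(2) by (simp add: field_simps)
  ultimately show ?thesis by (simp only:)
qed


section \<open>Integration over a torus\<close>

text \<open>
  The coordinates that are not integrated over are fixed to \<open>0\<close>, the value at which the innermost
  step of \<open>torus_integral\<close> evaluates its integrand.
\<close>

definition torus :: "nat \<Rightarrow> (nat \<Rightarrow> real) \<Rightarrow> (nat \<Rightarrow> complex) set" where
  "torus n \<rho> = {y. (\<forall>i\<in>{1..n}. cmod (y i) = \<rho> i) \<and> (\<forall>i. i \<notin> {1..n} \<longrightarrow> y i = 0)}"

text \<open>
  The form \<open>dw / (2 \<pi> \<i> w)\<close> is the normalised arc length of a circle around \<open>0\<close>. Averages over the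
  parameter \<open>s\<close> are easier to bound, to iterate and to interchange than contour integrals.
\<close>

lemma circle_average:
  assumes "r > 0"
  shows "contour_integral (circlepath 0 r) (\<lambda>w. G w / (2 * of_real pi * \<i> * w))
    = integral {0..1} (\<lambda>s. G (circlepath 0 r s))"
proof -
  have "G (circlepath 0 r s) / (2 * of_real pi * \<i> * circlepath 0 r s) *
      vector_derivative (circlepath 0 r) (at s) = G (circlepath 0 r s)" for s
    using assms by (subst vector_derivative_circlepath) (simp add: circlepath)
  thus ?thesis unfolding contour_integral_integral by simp
qed

lemma torus_integral_Suc_average:
  assumes "\<rho> (Suc n) > 0"
  shows "torus_integral (Suc n) \<rho> F
    = integral {0..1} (\<lambda>s. torus_integral n \<rho> (\<lambda>y. F (y(Suc n := circlepath 0 (\<rho> (Suc n)) s))))"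
  unfolding torus_integral.simps by (rule circle_average[OF assms])

lemma norm_circlepath_0 [simp]: "r > 0 \<Longrightarrow> cmod (circlepath 0 r s) = r"
  by (simp add: circlepath norm_mult)

lemma torus_Suc_upd:
  assumes "\<forall>i\<in>{1..Suc n}. \<rho> i > 0" "y \<in> torus n \<rho>"
  shows "y(Suc n := circlepath 0 (\<rho> (Suc n)) s) \<in> torus (Suc n) \<rho>"
  using assms unfolding torus_def by auto

lemma torus_integral_cong:
  assumes "\<forall>i\<in>{1..n}. \<rho> i > 0" "\<And>y. y \<in> torus n \<rho> \<Longrightarrow> F y = G y"
  shows "torus_integral n \<rho> F = torus_integral n \<rho> G"
  using assms
proof (induction n arbitrary: F G)
  case 0
  show ?case using 0(2)[of "\<lambda>_. 0"] by (simp add: torus_def)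
next
  case (Suc n)
  have "torus_integral n \<rho> (\<lambda>y. F (y(Suc n := circlepath 0 (\<rho> (Suc n)) s)))
      = torus_integral n \<rho> (\<lambda>y. G (y(Suc n := circlepath 0 (\<rho> (Suc n)) s)))" for s
    using Suc.prems by (intro Suc.IH Suc.prems(2) torus_Suc_upd) auto
  thus ?case
    using Suc.prems(1) by (subst (1 2) torus_integral_Suc_average) auto
qed

text \<open>
  Each circle meets its exceptional set at finitely many parameters, and a finite set of parameters
  is negligible in each of the iterated integrals.
\<close>

lemma torus_integral_cong_except_finite:
  assumes "\<forall>i\<in>{1..n}. \<rho> i > 0" "\<And>i. i \<in> {1..n} \<Longrightarrow> finite (B i)"
    and "\<And>y. y \<in> torus n \<rho> \<Longrightarrow> (\<forall>i\<in>{1..n}. y i \<notin> B i) \<Longrightarrow> F y = G y"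
  shows "torus_integral n \<rho> F = torus_integral n \<rho> G"
  using assms
proof (induction n arbitrary: F G)
  case 0
  show ?case using 0(3)[of "\<lambda>_. 0"] by (simp add: torus_def)
next
  case (Suc n)
  define r where "r = \<rho> (Suc n)"
  have r: "r > 0" using Suc.prems by (simp add: r_def)
  \<comment> \<open>the circle is traversed once on \<open>{0..<1}\<close>; the second visit of the starting point is added\<close>
  define S where "S = insert 1 {s\<in>{0..<1}. circlepath 0 r s \<in> B (Suc n)}"
  have "inj_on (circlepath 0 r) {0..<1}"
    using simple_path_circlepath[of 0 r] r unfolding simple_path_def loop_free_def inj_on_def
    by fastforce
  hence "finite ({0..<1} \<inter> circlepath 0 r -` B (Suc n))"
    using Suc.prems(2)[of "Suc n"] finite_vimage_IntI[of "B (Suc n)" "circlepath 0 r" "{0..<1}"]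
    by (simp add: Int_commute)
  hence "finite S" unfolding S_def by (auto simp: vimage_def Int_def)
  hence neg: "negligible S" by (rule negligible_finite)
  have "torus_integral n \<rho> (\<lambda>y. F (y(Suc n := circlepath 0 r s)))
      = torus_integral n \<rho> (\<lambda>y. G (y(Suc n := circlepath 0 r s)))" if "s \<in> {0..1} - S" for s
  proof (rule Suc.IH)
    fix y assume y: "y \<in> torus n \<rho>" "\<forall>i\<in>{1..n}. y i \<notin> B i"
    have "circlepath 0 r s \<notin> B (Suc n)" using that by (auto simp: S_def)
    thus "F (y(Suc n := circlepath 0 r s)) = G (y(Suc n := circlepath 0 r s))"
      using y Suc.prems(1) unfolding r_def
      by (intro Suc.prems(3) torus_Suc_upd) (auto simp: le_Suc_eq)
  qed (use Suc.prems in auto)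
  thus ?case
    using Suc.prems(1) neg
    by (subst (1 2) torus_integral_Suc_average) (auto intro!: integral_spike simp: r_def)
qed

lemma torus_integral_cmult: 
  assumes "\<forall>i\<in>{1..n}. \<rho> i > 0"
  shows "torus_integral n \<rho> (\<lambda>y. c * F y) = c * torus_integral n \<rho> F"
  using assms by (induction n arbitrary: F) (auto simp: torus_integral_Suc_average simp del: torus_integral.simps(2))

lemma torus_integral_const: 
  assumes "\<forall>i\<in>{1..n}. \<rho> i > 0"
  shows "torus_integral n \<rho> (\<lambda>y. c) = c"
  using assms by (induction n) (auto simp: torus_integral_Suc_average simp del: torus_integral.simps(2))

lemma continuous_on_fun_upd:
  fixes f :: "'a::topological_space \<Rightarrow> 'b \<Rightarrow> 'c::topological_space"
  assumes "continuous_on A f" "continuous_on A g"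
  shows "continuous_on A (\<lambda>v. (f v)(i := g v))"
proof (rule continuous_on_coordinatewise_then_product)
  fix j
  show "continuous_on A (\<lambda>v. ((f v)(i := g v)) j)"
    by (cases "j = i") (auto intro!: assms continuous_on_product_then_coordinatewise)
qed

text \<open>
  The inner \<open>n\<close> integrations are regarded as a function of the parameter and of the coordinates that are
  still to be integrated. In this form the induction passes from \<open>n\<close> to \<open>n + 1\<close> without changing the
  type of the parameter.
\<close>

lemma partial_torus_integral_continuous:
  fixes F :: "'a::topological_space \<Rightarrow> (nat \<Rightarrow> complex) \<Rightarrow> complex"
  assumes "\<forall>i\<in>{1..m}. \<rho> i > 0" "n \<le> m"
    and "continuous_on (U \<times> torus m \<rho>) (\<lambda>(u, y). F u y)"
  shows "continuous_on (U \<times> torus m \<rho>)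
    (\<lambda>(u, v). torus_integral n \<rho> (\<lambda>y. F u (\<lambda>i. if i \<in> {1..n} then y i else v i)))"
  using assms(2)
proof (induction n)
  case 0
  thus ?case using assms(3) by simp
next
  case (Suc n)
  let ?Q = "\<lambda>(u, v). torus_integral n \<rho> (\<lambda>y. F u (\<lambda>i. if i \<in> {1..n} then y i else v i))"
  let ?e = "circlepath 0 (\<rho> (Suc n))"
  have IH: "continuous_on (U \<times> torus m \<rho>) ?Q" using Suc by simp
  have r: "\<rho> (Suc n) > 0" using Suc.prems assms(1) by simp
  have ce: "continuous_on A (\<lambda>v. ?e (snd v))" for A :: "(('a \<times> (nat \<Rightarrow> complex)) \<times> real) set"
    unfolding circlepath by (intro continuous_intros)
  have "continuous_on ((U \<times> torus m \<rho>) \<times> cbox 0 1)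
      (\<lambda>p. ?Q (fst (fst p), (snd (fst p))(Suc n := ?e (snd p))))"
  proof (rule continuous_on_compose2[OF IH])
    have "v(Suc n := ?e s) \<in> torus m \<rho>" if "v \<in> torus m \<rho>" for v s
      using that Suc.prems r by (auto simp: torus_def)
    thus "(\<lambda>p. (fst (fst p), (snd (fst p))(Suc n := ?e (snd p)))) ` ((U \<times> torus m \<rho>) \<times> cbox 0 1)
        \<subseteq> U \<times> torus m \<rho>" by auto
  qed (intro continuous_on_Pair continuous_on_fst continuous_on_snd continuous_on_id continuous_on_fun_upd continuous_on_const ce)
  hence "continuous_on (U \<times> torus m \<rho>)
      (\<lambda>p. integral (cbox 0 1) (\<lambda>s. ?Q (fst p, (snd p)(Suc n := ?e s))))"
    by (intro integral_continuous_on_param) (simp add: case_prod_unfold)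
  moreover have "(\<lambda>i. if i \<in> {1..n} then y i else (v(Suc n := a)) i)
      = (\<lambda>i. if i \<in> {1..Suc n} then (y(Suc n := a)) i else v i)" for y v :: "nat \<Rightarrow> complex" and a
    by (auto simp: fun_eq_iff)
  ultimately show ?case
    unfolding case_prod_unfold torus_integral_Suc_average[of \<rho> n, OF r] cbox_interval
    by (simp only: fst_conv snd_conv)
qed

lemma torus_nonempty: "\<forall>i\<in>{1..n}. \<rho> i > 0 \<Longrightarrow> torus n \<rho> \<noteq> {}"
  by (auto simp: torus_def intro!: exI[of _ "\<lambda>i. if i \<in> {1..n} then of_real (\<rho> i) else 0"] split: if_splits)

lemma torus_integral_continuous:
  fixes F :: "'a::topological_space \<Rightarrow> (nat \<Rightarrow> complex) \<Rightarrow> complex"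
  assumes pos: "\<forall>i\<in>{1..n}. \<rho> i > 0"
    and cont: "continuous_on (U \<times> torus n \<rho>) (\<lambda>(u, y). F u y)"
  shows "continuous_on U (\<lambda>u. torus_integral n \<rho> (F u))"
proof -
  obtain v where v: "v \<in> torus n \<rho>" using torus_nonempty[OF pos] by blast
  let ?Q = "\<lambda>(u, v). torus_integral n \<rho> (\<lambda>y. F u (\<lambda>i. if i \<in> {1..n} then y i else v i))"
  have "continuous_on U (\<lambda>u. ?Q (u, v))"
    by (rule continuous_on_compose2[OF partial_torus_integral_continuous[OF pos le_refl cont]])
       (use v in \<open>auto intro!: continuous_intros\<close>)
  moreover have "?Q (u, v) = torus_integral n \<rho> (F u)" for u
    unfolding prod.case
  proof (rule torus_integral_cong[OF pos])
    fix y assume "y \<in> torus n \<rho>"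
    hence "(\<lambda>i. if i \<in> {1..n} then y i else v i) = y" using v by (auto simp: torus_def)
    thus "F u (\<lambda>i. if i \<in> {1..n} then y i else v i) = F u y" by simp
  qed
  ultimately show ?thesis by simp
qed

lemma continuous_on_circle_slice:
  fixes F :: "(nat \<Rightarrow> complex) \<Rightarrow> complex"
  assumes pos: "\<forall>i\<in>{1..Suc n}. \<rho> i > 0"
    and cont: "continuous_on (torus (Suc n) \<rho>) F"
  shows "continuous_on (S \<times> torus n \<rho>) (\<lambda>(s, y). F (y(Suc n := circlepath 0 (\<rho> (Suc n)) s)))"
    and "continuous_on (torus n \<rho>) (\<lambda>y. F (y(Suc n := circlepath 0 (\<rho> (Suc n)) s)))"
    and "continuous_on S (\<lambda>s. torus_integral n \<rho> (\<lambda>y. F (y(Suc n := circlepath 0 (\<rho> (Suc n)) s))))"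
proof -
  have ce: "continuous_on A (\<lambda>v. circlepath 0 r (fst v))" for A :: "(real \<times> (nat \<Rightarrow> complex)) set" and r
    unfolding circlepath by (intro continuous_intros)
  show 1: "continuous_on (S \<times> torus n \<rho>) (\<lambda>(s, y). F (y(Suc n := circlepath 0 (\<rho> (Suc n)) s)))" for S
    unfolding case_prod_unfold
    by (rule continuous_on_compose2[OF cont],
        intro continuous_on_Pair continuous_on_fst continuous_on_snd continuous_on_id continuous_on_fun_upd continuous_on_const ce)
       (use pos in \<open>auto simp: torus_Suc_upd simp del: fun_upd_apply\<close>)
  show "continuous_on (torus n \<rho>) (\<lambda>y. F (y(Suc n := circlepath 0 (\<rho> (Suc n)) s)))"
    by (rule continuous_on_compose2[OF cont],
        intro continuous_on_Pair continuous_on_fst continuous_on_snd continuous_on_id continuous_on_fun_upd continuous_on_const)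
       (use pos in \<open>auto simp: torus_Suc_upd simp del: fun_upd_apply\<close>)
  show "continuous_on S (\<lambda>s. torus_integral n \<rho> (\<lambda>y. F (y(Suc n := circlepath 0 (\<rho> (Suc n)) s))))"
    using pos by (intro torus_integral_continuous 1) auto
qed

lemma torus_integral_integrable_slice:
  assumes pos: "\<forall>i\<in>{1..Suc n}. \<rho> i > 0"
    and cont: "continuous_on (torus (Suc n) \<rho>) F"
  shows "(\<lambda>s. torus_integral n \<rho> (\<lambda>y. F (y(Suc n := circlepath 0 (\<rho> (Suc n)) s)))) integrable_on {0..1}"
  by (intro integrable_continuous_real continuous_on_circle_slice(3)[OF assms])

lemma torus_integral_add:
  assumes "\<forall>i\<in>{1..n}. \<rho> i > 0" "continuous_on (torus n \<rho>) F" "continuous_on (torus n \<rho>) G"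
  shows "torus_integral n \<rho> (\<lambda>y. F y + G y) = torus_integral n \<rho> F + torus_integral n \<rho> G"
  using assms
proof (induction n arbitrary: F G)
  case (Suc n)
  have "torus_integral n \<rho> (\<lambda>y. F (y(Suc n := circlepath 0 (\<rho> (Suc n)) s)) + G (y(Suc n := circlepath 0 (\<rho> (Suc n)) s)))
    = torus_integral n \<rho> (\<lambda>y. F (y(Suc n := circlepath 0 (\<rho> (Suc n)) s)))
    + torus_integral n \<rho> (\<lambda>y. G (y(Suc n := circlepath 0 (\<rho> (Suc n)) s)))" for s
    using Suc.prems(1) by (intro Suc.IH continuous_on_circle_slice(2)[OF Suc.prems(1)] Suc.prems) auto
  thus ?case using Suc.prems
    by (simp add: torus_integral_Suc_average integral_add torus_integral_integrable_slice del: torus_integral.simps)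
qed auto

lemma torus_integral_sum:
  assumes "\<forall>i\<in>{1..n}. \<rho> i > 0" "\<And>k. k \<in> K \<Longrightarrow> continuous_on (torus n \<rho>) (F k)"
  shows "torus_integral n \<rho> (\<lambda>y. \<Sum>k\<in>K. F k y) = (\<Sum>k\<in>K. torus_integral n \<rho> (F k))"
  using assms(2)
proof (induction K rule: infinite_finite_induct)
  case (insert k K)
  have "torus_integral n \<rho> (\<lambda>y. F k y + (\<Sum>k\<in>K. F k y))
      = torus_integral n \<rho> (F k) + torus_integral n \<rho> (\<lambda>y. \<Sum>k\<in>K. F k y)"
    by (intro torus_integral_add assms(1) continuous_intros insert.prems) auto
  thus ?case using insert by simp
qed (auto simp: torus_integral_const assms(1))

lemma torus_integral_norm_le:
  assumes "\<forall>i\<in>{1..n}. \<rho> i > 0" "continuous_on (torus n \<rho>) F"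
    and "\<And>y. y \<in> torus n \<rho> \<Longrightarrow> norm (F y) \<le> B"
  shows "norm (torus_integral n \<rho> F) \<le> B"
  using assms
proof (induction n arbitrary: F)
  case 0
  show ?case using 0(3)[of "\<lambda>_. 0"] by (simp add: torus_def)
next
  case (Suc n)
  let ?G = "\<lambda>s. torus_integral n \<rho> (\<lambda>y. F (y(Suc n := circlepath 0 (\<rho> (Suc n)) s)))"
  have "norm (?G s) \<le> B" for s
    using Suc.prems(1)
    by (intro Suc.IH continuous_on_circle_slice(2)[OF Suc.prems(1)] Suc.prems torus_Suc_upd) auto
  hence "norm (integral {0..1} ?G) \<le> B * (1 - 0)"
    by (intro integral_bound continuous_on_circle_slice(3) Suc.prems) auto
  thus ?case using Suc.prems by (simp add: torus_integral_Suc_average del: torus_integral.simps)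
qed

lemma compact_torus: "compact (torus n \<rho>)"
proof -
  have "compactin (product_topology (\<lambda>_. euclidean) UNIV)
     (PiE UNIV (\<lambda>i. if i \<in> {1..n} then sphere (0::complex) (\<rho> i) else {0}))"
    by (subst compactin_PiE) auto
  moreover have "PiE UNIV (\<lambda>i. if i \<in> {1..n} then sphere (0::complex) (\<rho> i) else {0}) = torus n \<rho>"
    by (auto simp: torus_def PiE_iff split: if_splits)
  ultimately show ?thesis by (simp add: euclidean_product_topology)
qed

text \<open>Dominated convergence: uniform convergence suffices, since the torus has total mass one.\<close>

lemma torus_integral_has_sum:
  assumes pos: "\<forall>i\<in>{1..n}. \<rho> i > 0" 
    and cont: "\<And>k. k \<in> K \<Longrightarrow> continuous_on (torus n \<rho>) (G k)"
    and bound: "\<And>k y. k \<in> K \<Longrightarrow> y \<in> torus n \<rho> \<Longrightarrow> norm (G k y) \<le> M k"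
    and M: "M summable_on K"
    and sum: "\<And>y. y \<in> torus n \<rho> \<Longrightarrow> ((\<lambda>k. G k y) has_sum F y) K"
  shows "((\<lambda>k. torus_integral n \<rho> (G k)) has_sum torus_integral n \<rho> F) K"
    and "continuous_on (torus n \<rho>) F"
proof -
  have ul: "uniform_limit (torus n \<rho>) (\<lambda>X y. \<Sum>k\<in>X. G k y) F (finite_subsets_at_top K)"
    by (rule Weierstrass_m_test_general'[OF bound sum M])
  have ev: "\<forall>\<^sub>F X in finite_subsets_at_top K. continuous_on (torus n \<rho>) (\<lambda>y. \<Sum>k\<in>X. G k y)"
    by (rule eventually_finite_subsets_at_top_weakI) (intro continuous_intros cont, auto)
  show F: "continuous_on (torus n \<rho>) F"
    by (rule uniform_limit_theorem[OF ev ul]) auto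
  show "((\<lambda>k. torus_integral n \<rho> (G k)) has_sum torus_integral n \<rho> F) K"
    unfolding has_sum_def
  proof (rule tendstoI)
    fix e :: real assume e: "e > 0"
    have "\<forall>\<^sub>F X in finite_subsets_at_top K. \<forall>y\<in>torus n \<rho>. dist (\<Sum>k\<in>X. G k y) (F y) < e / 2"
      using ul e unfolding uniform_limit_iff by (meson half_gt_zero)
    moreover have "\<forall>\<^sub>F X in finite_subsets_at_top K. finite X \<and> X \<subseteq> K"
      by (rule eventually_finite_subsets_at_top_weakI) auto
    ultimately show "\<forall>\<^sub>F X in finite_subsets_at_top K.
        dist (\<Sum>k\<in>X. torus_integral n \<rho> (G k)) (torus_integral n \<rho> F) < e"
    proof eventually_elim
      case (elim X)
      have c: "continuous_on (torus n \<rho>) (\<lambda>y. \<Sum>k\<in>X. G k y)"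
        using elim by (intro continuous_intros cont) auto
      have "torus_integral n \<rho> (\<lambda>y. ((\<Sum>k\<in>X. G k y) - F y) + F y)
          = torus_integral n \<rho> (\<lambda>y. (\<Sum>k\<in>X. G k y) - F y) + torus_integral n \<rho> F"
        by (intro torus_integral_add pos continuous_intros c F)
      moreover have "torus_integral n \<rho> (\<lambda>y. \<Sum>k\<in>X. G k y) = (\<Sum>k\<in>X. torus_integral n \<rho> (G k))"
        using elim by (intro torus_integral_sum pos cont) auto
      moreover have "norm (torus_integral n \<rho> (\<lambda>y. (\<Sum>k\<in>X. G k y) - F y)) \<le> e / 2"
        using elim by (intro torus_integral_norm_le pos continuous_intros c F) (auto simp: dist_norm intro: less_imp_le)
      ultimately show ?case using e by (simp add: dist_norm)
    qed
  qed
qed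

text \<open>
  Fubini's theorem for one more variable, by moving that integration inwards past one circle at a
  time.
\<close>

lemma torus_integral_swap:
  assumes pos: "\<forall>i\<in>{1..n}. \<rho> i > 0" 
    and cont: "continuous_on ({0..1} \<times> torus n \<rho>) (\<lambda>(s::real, y). G s y)"
  shows "integral {0..1} (\<lambda>s. torus_integral n \<rho> (G s)) = torus_integral n \<rho> (\<lambda>y. integral {0..1} (\<lambda>s. G s y))"
  using assms
proof (induction n arbitrary: G)
  case (Suc n)
  let ?e = "circlepath 0 (\<rho> (Suc n))"
  have pos': "\<forall>i\<in>{1..n}. \<rho> i > 0" using Suc.prems(1) by simp
  have ce: "continuous_on A (\<lambda>v. ?e (snd (fst v)))" for A :: "((real \<times> real) \<times> (nat \<Rightarrow> complex)) set"
    unfolding circlepath by (intro continuous_intros)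
  have "continuous_on (({0..1} \<times> {0..1}) \<times> torus n \<rho>)
     (\<lambda>v. (\<lambda>(s, y). G s y) (fst (fst v), (snd v)(Suc n := ?e (snd (fst v)))))"
    by (rule continuous_on_compose2[OF Suc.prems(2)],
        intro continuous_on_Pair continuous_on_fst continuous_on_snd continuous_on_id continuous_on_fun_upd continuous_on_const ce)
       (use Suc.prems(1) in \<open>auto simp: torus_Suc_upd simp del: fun_upd_apply\<close>)
  hence "continuous_on ({0..1} \<times> {0..1})
      (\<lambda>p. torus_integral n \<rho> (\<lambda>y. G (fst p) (y(Suc n := ?e (snd p)))))"
    by (intro torus_integral_continuous pos') (simp add: case_prod_unfold)
  hence "integral (cbox 0 1) (\<lambda>s. integral (cbox 0 1) (\<lambda>u. torus_integral n \<rho> (\<lambda>y. G s (y(Suc n := ?e u)))))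
      = integral (cbox 0 1) (\<lambda>u. integral (cbox 0 1) (\<lambda>s. torus_integral n \<rho> (\<lambda>y. G s (y(Suc n := ?e u)))))"
    by (intro integral_swap_continuous) (simp add: case_prod_unfold cbox_Pair_eq)
  moreover have "integral {0..1} (\<lambda>s. torus_integral n \<rho> (\<lambda>y. G s (y(Suc n := ?e u))))
     = torus_integral n \<rho> (\<lambda>y. integral {0..1} (\<lambda>s. G s (y(Suc n := ?e u))))" for u
  proof (rule Suc.IH[OF pos'])
    have "continuous_on ({0..1} \<times> torus n \<rho>)
       (\<lambda>v. (\<lambda>(s, y). G s y) (fst v, (snd v)(Suc n := ?e u)))"
      by (rule continuous_on_compose2[OF Suc.prems(2)],
          intro continuous_on_Pair continuous_on_fst continuous_on_snd continuous_on_id continuous_on_fun_upd continuous_on_const)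
         (use Suc.prems(1) in \<open>auto simp: torus_Suc_upd simp del: fun_upd_apply\<close>)
    thus "continuous_on ({0..1} \<times> torus n \<rho>) (\<lambda>(s, y). G s (y(Suc n := ?e u)))"
      by (simp add: case_prod_unfold)
  qed
  ultimately show ?case using Suc.prems(1)
    by (simp add: torus_integral_Suc_average del: torus_integral.simps)
qed auto


subsection \<open>Moving the radii\<close>

lemma torus_integral_radii_cong:
  "(\<And>i. i \<in> {1..n} \<Longrightarrow> \<rho> i = \<rho>' i) \<Longrightarrow> torus_integral n \<rho> F = torus_integral n \<rho>' F"
  by (induction n arbitrary: F) auto

text \<open>
  Cauchy's theorem for the annulus: the radial homotopy between the two circles stays in it.
\<close>

lemma circle_average_radius:
  assumes diff: "\<And>w. a < cmod w \<Longrightarrow> cmod w < b \<Longrightarrow> g field_differentiable (at w)"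
    and r: "0 < r" "a < r" "r < b" and s: "0 < s" "a < s" "s < b"
  shows "integral {0..1} (\<lambda>t. g (circlepath 0 r t)) = integral {0..1} (\<lambda>t. g (circlepath 0 s t))"
proof -
  define S where "S = {w. max a 0 < cmod w \<and> cmod w < b}"
  have "contour_integral (circlepath 0 r) (\<lambda>w. g w / (2 * of_real pi * \<i> * w))
      = contour_integral (circlepath 0 s) (\<lambda>w. g w / (2 * of_real pi * \<i> * w))"
  proof (rule Cauchy_theorem_homotopic_loops)
    show "open S" unfolding S_def by (intro open_Collect_conj open_Collect_less continuous_intros)
    show "(\<lambda>w. g w / (2 * of_real pi * \<i> * w)) holomorphic_on S"
      by (intro holomorphic_intros)
         (auto simp: S_def holomorphic_on_def field_differentiable_at_within diff)
    show "homotopic_loops S (circlepath 0 r) (circlepath 0 s)"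
    proof (rule homotopic_loops_linear)
      fix t :: real
      show "closed_segment (circlepath 0 r t) (circlepath 0 s t) \<subseteq> S"
      proof
        fix w assume "w \<in> closed_segment (circlepath 0 r t) (circlepath 0 s t)"
        then obtain u where u: "0 \<le> u" "u \<le> 1"
          "w = (1 - u) *\<^sub>R circlepath 0 r t + u *\<^sub>R circlepath 0 s t"
          by (auto simp: closed_segment_def)
        have "w = of_real ((1 - u) * r + u * s) * exp (2 * of_real pi * \<i> * of_real t)"
          unfolding u(3) circlepath by (simp add: scaleR_conv_of_real algebra_simps)
        hence "cmod w = \<bar>(1 - u) * r + u * s\<bar>"
          by (simp add: norm_mult del: of_real_add of_real_mult of_real_diff)
        moreover have "(1 - u) * r + u * s \<in> {max a 0<..<b}"
          using convexD_alt[OF convex_real_interval(8)[of "max a 0" b], of r s u] r s u by simp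
        ultimately show "w \<in> S" by (auto simp: S_def)
      qed
    qed auto
  qed auto
  thus ?thesis using r s by (simp add: circle_average)
qed

definition tube :: "nat \<Rightarrow> (nat \<Rightarrow> real) \<Rightarrow> nat \<Rightarrow> real \<Rightarrow> real \<Rightarrow> (nat \<Rightarrow> complex) set" where
  "tube n \<rho> i a b = {y. (\<forall>j\<in>{1..n} - {i}. cmod (y j) = \<rho> j) \<and> (\<forall>j. j \<notin> {1..n} \<longrightarrow> y j = 0)
     \<and> a < cmod (y i) \<and> cmod (y i) < b}"

text \<open>
  Only the radius of \<open>y i\<close> changes. By Fubini this integration may be carried out first, and then the
  other variables stay on their circles; Cauchy's theorem in the single variable \<open>y i\<close> applies.
\<close>

lemma torus_integral_change_radius:
  assumes "\<forall>j\<in>{1..n}. \<rho> j > 0" "i \<in> {1..n}" "a < \<rho> i" "\<rho> i < b" "a < r" "r < b" "0 < r"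
    and "continuous_on (tube n \<rho> i a b) F"
    and "\<And>y. y \<in> tube n \<rho> i a b \<Longrightarrow> (\<lambda>w. F (y(i := w))) field_differentiable (at (y i))"
  shows "torus_integral n \<rho> F = torus_integral n (\<rho>(i := r)) F"
  using assms
proof (induction n arbitrary: F)
  case (Suc n)
  note pos = Suc.prems(1)
  let ?\<rho>' = "\<rho>(i := r)"
  have pos': "\<forall>j\<in>{1..Suc n}. ?\<rho>' j > 0" using Suc.prems by simp
  have cont: "continuous_on (S \<times> A) (\<lambda>(s, y). F (y(Suc n := circlepath 0 R s)))"
    if "\<And>s y. s \<in> S \<Longrightarrow> y \<in> A \<Longrightarrow> y(Suc n := circlepath 0 R s) \<in> tube (Suc n) \<rho> i a b" for S A R
  proof -
    have ce: "continuous_on B (\<lambda>v. circlepath 0 R (fst v))" for B :: "(real \<times> (nat \<Rightarrow> complex)) set"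
      unfolding circlepath by (intro continuous_intros)
    show ?thesis unfolding case_prod_unfold
      by (rule continuous_on_compose2[OF Suc.prems(8)],
          intro continuous_on_snd continuous_on_id continuous_on_fun_upd ce)
         (use that in \<open>auto simp del: fun_upd_apply\<close>)
  qed
  show ?case
  proof (cases "i = Suc n")
    case True
    have mem: "y(Suc n := w) \<in> tube (Suc n) \<rho> i a b"
      if "y \<in> torus n \<rho>" "a < cmod w" "cmod w < b" for y w
      using that True by (auto simp: tube_def torus_def)
    have average: "torus_integral (Suc n) \<sigma> F
        = torus_integral n \<rho> (\<lambda>y. integral {0..1} (\<lambda>s. F (y(Suc n := circlepath 0 (\<sigma> (Suc n)) s))))"
      if "\<sigma> (Suc n) > 0" "a < \<sigma> (Suc n)" "\<sigma> (Suc n) < b" "\<And>j. j \<in> {1..n} \<Longrightarrow> \<sigma> j = \<rho> j" for \<sigma>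
    proof -
      have "torus_integral (Suc n) \<sigma> F
          = integral {0..1} (\<lambda>s. torus_integral n \<rho> (\<lambda>y. F (y(Suc n := circlepath 0 (\<sigma> (Suc n)) s))))"
        using that torus_integral_radii_cong[of n \<sigma> \<rho>]
        by (simp add: torus_integral_Suc_average del: torus_integral.simps)
      also have "\<dots> = torus_integral n \<rho> (\<lambda>y. integral {0..1} (\<lambda>s. F (y(Suc n := circlepath 0 (\<sigma> (Suc n)) s))))"
        using that pos by (intro torus_integral_swap cont mem) auto
      finally show ?thesis .
    qed
    have "torus_integral (Suc n) \<rho> F
       = torus_integral n \<rho> (\<lambda>y. integral {0..1} (\<lambda>s. F (y(Suc n := circlepath 0 (\<rho> (Suc n)) s))))"
      using Suc.prems True by (intro average) auto
    also have "\<dots> = torus_integral n \<rho> (\<lambda>y. integral {0..1} (\<lambda>s. F (y(Suc n := circlepath 0 r s))))"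
    proof (rule torus_integral_cong)
      fix y assume y: "y \<in> torus n \<rho>"
      show "integral {0..1} (\<lambda>s. F (y(Suc n := circlepath 0 (\<rho> (Suc n)) s)))
          = integral {0..1} (\<lambda>s. F (y(Suc n := circlepath 0 r s)))"
      proof (rule circle_average_radius)
        fix w assume "a < cmod w" "cmod w < b"
        hence "y(Suc n := w) \<in> tube (Suc n) \<rho> i a b" using mem y by blast
        from Suc.prems(9)[OF this]
        show "(\<lambda>w. F (y(Suc n := w))) field_differentiable at w"
          by (simp only: True fun_upd_upd fun_upd_same)
      qed (use Suc.prems True in auto)
    qed (use pos in auto)
    also have "\<dots> = torus_integral (Suc n) ?\<rho>' F"
      using average[of ?\<rho>'] Suc.prems True by auto
    finally show ?thesis .
  next
    case False
    hence i: "i \<in> {1..n}" using Suc.prems by auto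
    have mem: "y(Suc n := circlepath 0 (\<rho> (Suc n)) s) \<in> tube (Suc n) \<rho> i a b"
      if "y \<in> tube n \<rho> i a b" for y s
      using that False pos by (auto simp: tube_def)
    have "torus_integral n \<rho> (\<lambda>y. F (y(Suc n := circlepath 0 (\<rho> (Suc n)) s)))
        = torus_integral n ?\<rho>' (\<lambda>y. F (y(Suc n := circlepath 0 (\<rho> (Suc n)) s)))" for s
    proof (rule Suc.IH)
      show "continuous_on (tube n \<rho> i a b) (\<lambda>y. F (y(Suc n := circlepath 0 (\<rho> (Suc n)) s)))"
        by (rule continuous_on_compose2[OF Suc.prems(8)],
            intro continuous_on_id continuous_on_fun_upd continuous_on_const)
           (use mem in \<open>auto simp del: fun_upd_apply\<close>)
      fix y assume "y \<in> tube n \<rho> i a b"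
      from Suc.prems(9)[OF mem[OF this, of s]]
      show "(\<lambda>w. F ((y(i := w))(Suc n := circlepath 0 (\<rho> (Suc n)) s))) field_differentiable at (y i)"
        by (simp only: fun_upd_twist[OF False[symmetric]] fun_upd_other[OF False])
    qed (use Suc.prems i in auto)
    moreover have "?\<rho>' (Suc n) = \<rho> (Suc n)" using False by simp
    moreover have "\<rho> (Suc n) > 0" using pos by simp
    ultimately show ?thesis
      using torus_integral_Suc_average[of \<rho> n F] torus_integral_Suc_average[of ?\<rho>' n F]
      by (simp only:)
  qed
qed auto


subsection \<open>Scaling the variables\<close>

text \<open>
  Multiplication by \<open>c\<close> turns the circle by the angle of \<open>c\<close>. That is a shift of the parameter, and
  the integrand has period one in the parameter.
\<close>

lemma circle_average_rotate:
  fixes H :: "complex \<Rightarrow> complex"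
  assumes c: "c \<noteq> 0" and cont: "continuous_on {0..1} (\<lambda>s. H (circlepath 0 (cmod c * r) s))"
  shows "integral {0..1} (\<lambda>s. H (c * circlepath 0 r s)) = integral {0..1} (\<lambda>s. H (circlepath 0 (cmod c * r) s))"
proof -
  define a where "a = Arg2pi c / (2 * pi)"
  define h where "h = (\<lambda>s. H (circlepath 0 (cmod c * r) s))"
  have a: "0 \<le> a" "a < 1" using Arg2pi_ge_0[of c] Arg2pi_lt_2pi[of c] by (auto simp: a_def)
  have c_eq: "c = of_real (cmod c) * exp (2 * of_real pi * \<i> * of_real a)"
    by (subst Arg2pi_eq[of c]) (simp add: a_def mult_ac)
  have "c * circlepath 0 r s = circlepath 0 (cmod c * r) (a + s)" for s
    by (subst c_eq) (simp add: circlepath exp_add distrib_left mult_ac)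
  hence "integral {0..1} (\<lambda>s. H (c * circlepath 0 r s)) = integral {0..1} (h \<circ> (+) a)"
    by (simp add: h_def o_def)
  also have "\<dots> = integral {a..1 + a} h" by (simp add: integral_shift_Icc_real)
  also have periodic: "h \<circ> (+) 1 = h"
    by (auto simp: h_def circlepath exp_add distrib_left fun_eq_iff mult_ac)
  have c01: "continuous_on {0..1} h" using cont by (simp add: h_def)
  have i01: "h integrable_on {0..1}" by (rule integrable_continuous_real[OF c01])
  have i12: "h integrable_on {1..2}"
    using i01 integrable_on_shift_Icc_real[of h 1 0 1] periodic by simp
  have "h integrable_on {0..2}"
    using Henstock_Kurzweil_Integration.integrable_combine[OF _ _ i01 i12] by simp
  hence int: "h integrable_on {a..1 + a}"
    by (rule integrable_subinterval_real) (use a in auto)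
  have "integral {a..1 + a} h = integral {a..1} h + integral {1..1 + a} h"
    using a by (intro Henstock_Kurzweil_Integration.integral_combine[symmetric] int) auto
  also have "integral {1..1 + a} h = integral {0..a} h"
    using integral_shift_Icc_real[of 0 a h 1] periodic by (simp add: add.commute)
  also have "integral {a..1} h + integral {0..a} h = integral {0..1} h"
    using Henstock_Kurzweil_Integration.integral_combine[of 0 a 1 h] a i01 by (simp add: add.commute)
  finally show ?thesis by (simp add: h_def)
qed

lemma torus_integral_scale:
  assumes "\<forall>i\<in>{1..n}. \<rho> i > 0" "\<forall>i\<in>{1..n}. c i \<noteq> 0"
    and "continuous_on (torus n (\<lambda>i. cmod (c i) * \<rho> i)) F"
  shows "torus_integral n (\<lambda>i. cmod (c i) * \<rho> i) F = torus_integral n \<rho> (\<lambda>w. F (\<lambda>i. c i * w i))"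
  using assms
proof (induction n arbitrary: F)
  case (Suc n)
  define \<rho>' where "\<rho>' = (\<lambda>i. cmod (c i) * \<rho> i)"
  have pos': "\<forall>i\<in>{1..Suc n}. \<rho>' i > 0" using Suc.prems by (simp add: \<rho>'_def)
  define H where "H u = torus_integral n \<rho> (\<lambda>w. F ((\<lambda>i. c i * w i)(Suc n := u)))" for u
  have H: "torus_integral n \<rho>' (\<lambda>y. F (y(Suc n := circlepath 0 (\<rho>' (Suc n)) s)))
      = H (circlepath 0 (\<rho>' (Suc n)) s)" for s
    unfolding H_def \<rho>'_def
    using Suc.prems pos'
    by (intro Suc.IH continuous_on_circle_slice(2)[OF pos'[unfolded \<rho>'_def]]) auto
  have "torus_integral (Suc n) \<rho>' F = integral {0..1} (\<lambda>s. H (circlepath 0 (\<rho>' (Suc n)) s))"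
    using pos' by (simp add: torus_integral_Suc_average H del: torus_integral.simps)
  also have "\<dots> = integral {0..1} (\<lambda>s. H (c (Suc n) * circlepath 0 (\<rho> (Suc n)) s))"
    unfolding \<rho>'_def
  proof (rule circle_average_rotate[symmetric])
    show "continuous_on {0..1} (\<lambda>s. H (circlepath 0 (cmod (c (Suc n)) * \<rho> (Suc n)) s))"
      using continuous_on_circle_slice(3)[OF pos', of F] Suc.prems(3) H
      by (simp add: \<rho>'_def del: fun_upd_apply)
  qed (use Suc.prems in auto)
  also have "H (c (Suc n) * u) = torus_integral n \<rho> (\<lambda>w. F (\<lambda>i. c i * (w(Suc n := u)) i))" for u
    unfolding H_def by (intro arg_cong[where f = "torus_integral n \<rho>"] ext arg_cong[where f = F]) auto
  hence "integral {0..1} (\<lambda>s. H (c (Suc n) * circlepath 0 (\<rho> (Suc n)) s))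
      = torus_integral (Suc n) \<rho> (\<lambda>w. F (\<lambda>i. c i * w i))"
    by (simp only: torus_integral_Suc_average[of \<rho> n, OF Suc.prems(1)[rule_format, of "Suc n", simplified]])
  finally show ?case by (simp only: \<rho>'_def)
qed auto


subsection \<open>Products and the Cauchy formula\<close>

lemma torus_integral_prod:
  assumes "\<forall>i\<in>{1..n}. \<rho> i > 0"
  shows "torus_integral n \<rho> (\<lambda>y. \<Prod>i = 1..n. g i (y i))
    = (\<Prod>i = 1..n. integral {0..1} (\<lambda>s. g i (circlepath 0 (\<rho> i) s)))"
  using assms
proof (induction n)
  case (Suc n)
  have "torus_integral n \<rho> (\<lambda>y. \<Prod>i = 1..Suc n. g i ((y(Suc n := u)) i))
      = g (Suc n) u * torus_integral n \<rho> (\<lambda>y. \<Prod>i = 1..n. g i (y i))" for u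
    using Suc.prems by (subst torus_integral_cmult[symmetric]) (auto simp: mult.commute)
  thus ?case using Suc
    by (simp add: torus_integral_Suc_average mult.commute del: torus_integral.simps prod.cl_ivl_Suc fun_upd_apply)
       simp
qed auto

lemma circle_average_Cauchy:
  assumes "\<And>w. cmod w \<le> r \<Longrightarrow> g field_differentiable (at w)" "cmod z < r"
  shows "integral {0..1} (\<lambda>s. g (circlepath 0 r s) / (1 - z / circlepath 0 r s)) = g z"
proof -
  have r: "r > 0" using assms(2) by (meson norm_ge_zero order_le_less_trans)
  have "g holomorphic_on cball 0 r"
    unfolding holomorphic_on_def using assms(1) field_differentiable_at_within by (simp add: field_differentiable_at_within)
  hence "((\<lambda>u. g u / (u - z)) has_contour_integral (2 * of_real pi * \<i> * g z)) (circlepath 0 r)"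
    using assms(2) by (intro Cauchy_integral_circlepath_simple) auto
  hence "((\<lambda>u. g u / (u - z) / (2 * of_real pi * \<i>)) has_contour_integral (2 * of_real pi * \<i> * g z / (2 * of_real pi * \<i>)))
     (circlepath 0 r)" by (rule has_contour_integral_div)
  hence "contour_integral (circlepath 0 r) (\<lambda>u. g u / (u - z) / (2 * of_real pi * \<i>)) = g z"
    by (simp add: contour_integral_unique)
  moreover have "contour_integral (circlepath 0 r) (\<lambda>u. g u / (u - z) / (2 * of_real pi * \<i>))
     = contour_integral (circlepath 0 r) (\<lambda>w. g w / (1 - z / w) / (2 * of_real pi * \<i> * w))"
  proof (rule contour_integral_cong)
    fix w assume "w \<in> path_image (circlepath 0 r)"
    hence "cmod w = r" using r by simp
    hence "w \<noteq> 0" "w \<noteq> z" using r assms(2) by auto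
    thus "g w / (w - z) / (2 * of_real pi * \<i>) = g w / (1 - z / w) / (2 * of_real pi * \<i> * w)"
      by (simp add: field_simps)
  qed simp
  ultimately show ?thesis using circle_average[OF r, of "\<lambda>w. g w / (1 - z / w)"] by simp
qed

text \<open>
  Cauchy's formula in each variable in turn. A point \<open>z\<close> must vanish outside the variables integrated
  over, in accordance with the convention for \<open>torus\<close>.
\<close>

lemma torus_integral_Cauchy:
  assumes "\<And>z i. (\<forall>j\<in>{1..n}. cmod (z j) \<le> r j) \<Longrightarrow> (\<forall>j. j \<notin> {1..n} \<longrightarrow> z j = 0) \<Longrightarrow> i \<in> {1..n} \<Longrightarrow>
      (\<lambda>w. F (z(i := w))) field_differentiable (at (z i))"
    and "\<forall>j\<in>{1..n}. cmod (z j) < r j" "\<forall>j. j \<notin> {1..n} \<longrightarrow> z j = 0"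
  shows "torus_integral n r (\<lambda>y. F y * (\<Prod>i = 1..n. 1 / (1 - z i / y i))) = F z"
  using assms
proof (induction n arbitrary: F z)
  case 0
  hence "z = (\<lambda>_. 0)" by auto
  thus ?case by simp
next
  case (Suc n)
  have r: "\<forall>j\<in>{1..Suc n}. r j > 0" using Suc.prems(2) by (meson norm_ge_zero order_le_less_trans)
  let ?e = "circlepath 0 (r (Suc n))"
  have "torus_integral n r (\<lambda>y. F (y(Suc n := ?e s)) * (\<Prod>i = 1..Suc n. 1 / (1 - z i / (y(Suc n := ?e s)) i)))
      = F (z(Suc n := ?e s)) / (1 - z (Suc n) / ?e s)" for s
  proof -
    have "torus_integral n r (\<lambda>y. F (y(Suc n := ?e s)) * (\<Prod>i = 1..Suc n. 1 / (1 - z i / (y(Suc n := ?e s)) i)))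
      = torus_integral n r (\<lambda>y. (1 / (1 - z (Suc n) / ?e s)) * 
           (F (y(Suc n := ?e s)) * (\<Prod>i = 1..n. 1 / (1 - (z(Suc n := 0)) i / y i))))"
      by (intro arg_cong[where f = "torus_integral n r"] ext) simp
    also have "\<dots> = (1 / (1 - z (Suc n) / ?e s)) * torus_integral n r 
        (\<lambda>y. F (y(Suc n := ?e s)) * (\<Prod>i = 1..n. 1 / (1 - (z(Suc n := 0)) i / y i)))"
      using r by (intro torus_integral_cmult) auto
    also have "torus_integral n r (\<lambda>y. F (y(Suc n := ?e s)) * (\<Prod>i = 1..n. 1 / (1 - (z(Suc n := 0)) i / y i)))
        = F ((z(Suc n := 0))(Suc n := ?e s))"
    proof (rule Suc.IH)
      fix y i assume y: "\<forall>j\<in>{1..n}. cmod (y j) \<le> r j" "\<forall>j. j \<notin> {1..n} \<longrightarrow> y j = 0" "i \<in> {1..n}"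
      have "(\<lambda>w. F ((y(Suc n := ?e s))(i := w))) field_differentiable at ((y(Suc n := ?e s)) i)"
        by (rule Suc.prems(1)) (use y r in auto)
      thus "(\<lambda>w. F ((y(i := w))(Suc n := ?e s))) field_differentiable at (y i)"
        using y(3) by (simp add: fun_upd_twist)
    qed (use Suc.prems in auto)
    finally show ?thesis by (simp only: fun_upd_upd times_divide_eq_left mult_1_left)
  qed
  moreover have "integral {0..1} (\<lambda>s. F (z(Suc n := ?e s)) / (1 - z (Suc n) / ?e s)) = F (z(Suc n := z (Suc n)))"
  proof (rule circle_average_Cauchy)
    fix w assume w: "cmod w \<le> r (Suc n)"
    have "(\<lambda>u. F ((z(Suc n := w))(Suc n := u))) field_differentiable at ((z(Suc n := w)) (Suc n))"
      by (rule Suc.prems(1)) (use w Suc.prems in \<open>auto intro: less_imp_le\<close>)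
    thus "(\<lambda>u. F (z(Suc n := u))) field_differentiable at w" by simp
  qed (use Suc.prems in auto)
  ultimately show ?case
    using r by (simp add: torus_integral_Suc_average del: torus_integral.simps prod.cl_ivl_Suc fun_upd_apply)
qed


section \<open>Holomorphic functions of several variables\<close>

text \<open>
  Continuity and complex differentiability in each variable. Required at all points of an open set,
  this is holomorphy in finitely many variables (Osgood), and a condition at a single point is
  preserved by the algebraic operations without reference to a domain. The index type is a
  parameter so that two groups of variables can be combined by a sum type.
\<close>

definition mhol_at :: "(('i::countable \<Rightarrow> complex) \<Rightarrow> complex) \<Rightarrow> ('i \<Rightarrow> complex) \<Rightarrow> bool" where
  "mhol_at F v \<longleftrightarrow> isCont F v \<and> (\<forall>i. (\<lambda>w. F (v(i := w))) field_differentiable (at (v i)))"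

lemma mhol_at_const: "mhol_at (\<lambda>v. c) v"
  by (simp add: mhol_at_def)

lemma mhol_at_coordinate: "mhol_at (\<lambda>v. v j) v"
  unfolding mhol_at_def
proof (intro conjI allI)
  show "isCont (\<lambda>v. v j) v"
    using continuous_on_product_coordinates continuous_on_eq_continuous_at[OF open_UNIV]
    by (metis UNIV_I)
  fix i
  show "(\<lambda>w. (v(i := w)) j) field_differentiable (at (v i))"
  proof (cases "i = j")
    case True
    thus ?thesis by (simp add: field_differentiable_ident)
  next
    case False
    thus ?thesis by (simp add: field_differentiable_const)
  qed
qed

lemma mhol_at_add: "mhol_at F v \<Longrightarrow> mhol_at G v \<Longrightarrow> mhol_at (\<lambda>v. F v + G v) v"
  unfolding mhol_at_def by (intro conjI allI continuous_add field_differentiable_add; blast)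

lemma mhol_at_diff: "mhol_at F v \<Longrightarrow> mhol_at G v \<Longrightarrow> mhol_at (\<lambda>v. F v - G v) v"
  unfolding mhol_at_def by (intro conjI allI continuous_diff field_differentiable_diff; blast)

lemma mhol_at_mult: "mhol_at F v \<Longrightarrow> mhol_at G v \<Longrightarrow> mhol_at (\<lambda>v. F v * G v) v"
  unfolding mhol_at_def by (intro conjI allI continuous_mult field_differentiable_mult; blast)

lemma mhol_at_divide:
  assumes "mhol_at F v" "mhol_at G v" "G v \<noteq> 0"
  shows "mhol_at (\<lambda>v. F v / G v) v"
  unfolding mhol_at_def
proof (intro conjI allI)
  show "isCont (\<lambda>v. F v / G v) v"
    using assms by (intro isCont_divide) (simp_all add: mhol_at_def)
  show "(\<lambda>w. F (v(i := w)) / G (v(i := w))) field_differentiable at (v i)" for i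
    using assms by (intro field_differentiable_divide) (simp_all add: mhol_at_def)
qed

lemma mhol_at_power: "mhol_at F v \<Longrightarrow> mhol_at (\<lambda>v. F v ^ k) v"
  by (induction k) (simp_all add: mhol_at_const mhol_at_mult)

lemma mhol_at_sum:
  assumes "\<And>k. k \<in> K \<Longrightarrow> mhol_at (F k) v"
  shows "mhol_at (\<lambda>v. \<Sum>k\<in>K. F k v) v"
  using assms
  by (induction K rule: infinite_finite_induct) (simp_all add: mhol_at_const mhol_at_add)

lemma mhol_at_prod:
  assumes "\<And>k. k \<in> K \<Longrightarrow> mhol_at (F k) v"
  shows "mhol_at (\<lambda>v. \<Prod>k\<in>K. F k v) v"
  using assms
  by (induction K rule: infinite_finite_induct) (simp_all add: mhol_at_const mhol_at_mult)

lemma mhol_at_compose: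
  assumes "mhol_at F v" "g field_differentiable (at (F v))"
  shows "mhol_at (\<lambda>v. g (F v)) v"
  unfolding mhol_at_def
proof (intro conjI allI)
  have "isCont F v" using assms(1) by (simp add: mhol_at_def)
  moreover have "isCont g (F v)" using assms(2) by (rule field_differentiable_imp_continuous_at)
  ultimately show "isCont (\<lambda>v. g (F v)) v"
    by (rule isCont_o2[of v F g])
  fix i
  have "g \<circ> (\<lambda>w. F (v(i := w))) field_differentiable (at (v i))"
    using assms by (intro field_differentiable_compose) (auto simp: mhol_at_def)
  thus "(\<lambda>w. g (F (v(i := w)))) field_differentiable (at (v i))" by (simp add: o_def)
qed

lemma mhol_at_imp_continuous_on: "(\<And>v. v \<in> D \<Longrightarrow> mhol_at F v) \<Longrightarrow> continuous_on D F"
  by (rule continuous_at_imp_continuous_on) (simp add: mhol_at_def)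

lemma mhol_at_slice: "mhol_at F v \<Longrightarrow> (\<lambda>w. F (v(i := w))) field_differentiable (at (v i))"
  by (simp add: mhol_at_def)

lemma mhol_at_qpoch: "cmod q < 1 \<Longrightarrow> mhol_at F v \<Longrightarrow> mhol_at (\<lambda>v. qpoch q (F v)) v"
  by (rule mhol_at_compose[of F v "qpoch q"]) (simp_all add: qpoch_field_differentiable)

lemma isCont_upd: "isCont (\<lambda>w. v(i := w)) (u :: complex)"
proof -
  have "continuous_on UNIV (\<lambda>w. v(i := w))"
    by (intro continuous_on_fun_upd continuous_on_id continuous_on_const)
  thus ?thesis using continuous_on_eq_continuous_at[OF open_UNIV] by (metis UNIV_I)
qed

text \<open>
  A uniform limit is holomorphic: continuity passes to the limit, and so does holomorphy of each
  one-variable slice.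
\<close>

lemma mhol_at_uniform_limit:
  assumes D: "open D" "v \<in> D"
    and F: "\<forall>\<^sub>F n in L. \<forall>u\<in>D. mhol_at (F n) u"
    and lim: "uniform_limit D F G L" and L: "\<not> trivial_limit L"
  shows "mhol_at G v"
  unfolding mhol_at_def
proof (intro conjI allI)
  have "continuous_on D G"
    by (rule uniform_limit_theorem[OF _ lim L])
       (use F in \<open>auto elim!: eventually_mono intro!: mhol_at_imp_continuous_on\<close>)
  thus "isCont G v" using D by (metis continuous_on_eq_continuous_at)
  fix i
  define S where "S = (\<lambda>w. v(i := w)) -` D"
  have "open S" unfolding S_def
    using D by (intro continuous_open_vimage isCont_upd) auto
  moreover have "v i \<in> S" using D by (simp add: S_def)
  ultimately obtain e where e: "e > 0" "cball (v i) e \<subseteq> S"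
    using open_contains_cball by blast
  have slice: "(\<lambda>w. F n (v(i := w))) field_differentiable (at w)"
    if "\<forall>u\<in>D. mhol_at (F n) u" "w \<in> S" for n w
    using that mhol_at_slice[of "F n" "v(i := w)" i] by (simp add: S_def)
  have h1: "\<forall>\<^sub>F n in L. continuous_on (cball (v i) e) (\<lambda>w. F n (v(i := w))) \<and>
      (\<lambda>w. F n (v(i := w))) holomorphic_on ball (v i) e"
    using F
  proof eventually_elim
    case (elim n)
    have "(\<lambda>w. F n (v(i := w))) holomorphic_on cball (v i) e"
      unfolding holomorphic_on_def using slice[OF elim] e(2)
      by (meson field_differentiable_at_within subsetD)
    thus ?case
      using holomorphic_on_imp_continuous_on holomorphic_on_subset ball_subset_cball by blast
  qed
  have h2: "uniform_limit (cball (v i) e) (\<lambda>n w. F n (v(i := w))) (\<lambda>w. G (v(i := w))) L"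
    unfolding uniform_limit_iff
  proof (intro allI impI)
    fix d :: real assume "d > 0"
    hence "\<forall>\<^sub>F n in L. \<forall>u\<in>D. dist (F n u) (G u) < d"
      using lim unfolding uniform_limit_iff by blast
    thus "\<forall>\<^sub>F n in L. \<forall>w\<in>cball (v i) e. dist (F n (v(i := w))) (G (v(i := w))) < d"
      by eventually_elim (use e(2) in \<open>auto simp: S_def simp del: fun_upd_apply\<close>)
  qed
  have "(\<lambda>w. G (v(i := w))) holomorphic_on ball (v i) e"
    by (rule holomorphic_uniform_limit[OF h1 h2 L])
  thus "(\<lambda>w. G (v(i := w))) field_differentiable (at (v i))"
    using e(1) holomorphic_on_imp_differentiable_at[OF _ open_ball] by auto
qed


text \<open>
  The radii are exchanged one after the other; all intermediate tori lie in the same product of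
  annuli.
\<close>

lemma torus_integral_radii_eq:
  assumes \<rho>: "\<And>i. i \<in> {1..n} \<Longrightarrow> 0 \<le> a i \<and> a i < \<rho> i \<and> \<rho> i < b i"
    and \<rho>': "\<And>i. i \<in> {1..n} \<Longrightarrow> a i < \<rho>' i \<and> \<rho>' i < b i"
    and F: "\<And>y. (\<And>i. i \<in> {1..n} \<Longrightarrow> a i < cmod (y i) \<and> cmod (y i) < b i) \<Longrightarrow> mhol_at F y"
  shows "torus_integral n \<rho> F = torus_integral n \<rho>' F"
proof -
  \<comment> \<open>the torus after the first \<open>m\<close> radii have been exchanged\<close>
  define R where "R m = (\<lambda>i. if i \<le> m then \<rho>' i else \<rho> i)" for m :: nat
  have R: "a i < R m i \<and> R m i < b i" if "i \<in> {1..n}" for i m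
    using \<rho>[OF that] \<rho>'[OF that] by (auto simp: R_def)
  have "torus_integral n \<rho> F = torus_integral n (R m) F" if "m \<le> n" for m
    using that
  proof (induction m)
    case 0
    show ?case by (rule torus_integral_radii_cong) (auto simp: R_def)
  next
    case (Suc m)
    let ?i = "Suc m"
    have i: "?i \<in> {1..n}" using Suc.prems by simp
    have hol: "mhol_at F y" if "y \<in> tube n (R m) ?i (a ?i) (b ?i)" for y
    proof (rule F)
      fix j assume j: "j \<in> {1..n}"
      show "a j < cmod (y j) \<and> cmod (y j) < b j"
        using that j R[OF j, of m] by (cases "j = ?i") (auto simp: tube_def)
    qed
    have pos: "\<forall>j\<in>{1..n}. R m j > 0" 
    proof
      fix j assume j: "j \<in> {1..n}"
      show "R m j > 0" using \<rho>[OF j] R[OF j, of m] by linarith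
    qed
    have "torus_integral n (R m) F = torus_integral n ((R m)(?i := \<rho>' ?i)) F"
    proof (rule torus_integral_change_radius[OF pos i])
      show "continuous_on (tube n (R m) ?i (a ?i) (b ?i)) F"
        by (rule mhol_at_imp_continuous_on[OF hol])
      show "(\<lambda>w. F (y(?i := w))) field_differentiable at (y ?i)"
        if "y \<in> tube n (R m) ?i (a ?i) (b ?i)" for y
        by (rule mhol_at_slice[OF hol[OF that]])
    qed (use R[OF i, of m] \<rho>[OF i] \<rho>'[OF i] in auto)
    also have "(R m)(?i := \<rho>' ?i) = R ?i" by (auto simp: R_def fun_eq_iff)
    finally show ?case using Suc by simp
  qed
  from this[OF le_refl] show ?thesis
    using torus_integral_radii_cong[of n "R n" \<rho>' F] by (simp add: R_def)
qed


section \<open>Power series in several variables\<close>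

lemma zmonom_cong: "(\<And>i. i \<in> {1..<N} \<Longrightarrow> z i = z' i) \<Longrightarrow> zmonom N z m = zmonom N z' m"
  by (simp add: zmonom_def)

lemma zmonom_mult: "zmonom N (\<lambda>i. z i * z' i) m = zmonom N z m * zmonom N z' m"
  by (simp add: zmonom_def power_mult_distrib prod.distrib)

lemma norm_zmonom: "norm (zmonom N z m) = (\<Prod>i = 1..<N. norm (z i) ^ m i)"
  by (simp add: zmonom_def prod_norm[symmetric] norm_power)

lemma norm_zmonom_mono:
  assumes "\<And>i. i \<in> {1..<N} \<Longrightarrow> norm (z i) \<le> norm (z' i)"
  shows "norm (zmonom N z m) \<le> norm (zmonom N z' m)"
  unfolding norm_zmonom using assms by (intro prod_mono) (auto intro: power_mono)

definition series :: "nat \<Rightarrow> ((nat \<Rightarrow> nat) \<Rightarrow> complex) \<Rightarrow> (nat \<Rightarrow> complex) \<Rightarrow> complex" where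
  "series N a z = (\<Sum>\<^sub>\<infinity>m\<in>exponents N. a m * zmonom N z m)"

lemma series_fun_eq: "series_fun N a x = series N a (ratios x)"
  by (simp add: series_fun_def series_def)

lemma series_cong: "(\<And>i. i \<in> {1..<N} \<Longrightarrow> z i = z' i) \<Longrightarrow> series N a z = series N a z'"
  unfolding series_def using zmonom_cong[of N z z'] by simp

lemma hol_series_mono: "r \<le> r' \<Longrightarrow> hol_series N r' \<subseteq> hol_series N r"
  unfolding hol_series_def using order_less_le_trans by blast

lemma Max_cmod_less:
  assumes "finite A" "\<And>i. i \<in> A \<Longrightarrow> cmod (z i) < r" "0 < r"
  obtains r' where "0 < r'" "r' < r" "\<And>i. i \<in> A \<Longrightarrow> cmod (z i) < r'"
proof -
  define s where "s = Max (insert 0 ((\<lambda>i. cmod (z i)) ` A))"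
  have "s < r" "s \<ge> 0" using assms by (auto simp: s_def)
  moreover have "\<And>i. i \<in> A \<Longrightarrow> cmod (z i) \<le> s" using assms(1) by (auto simp: s_def)
  ultimately show ?thesis using that[of "(s + r) / 2"] by fastforce
qed

text \<open>
  Substituting holomorphic functions into a power series gives a holomorphic function. The uniform
  convergence needed for this holds near \<open>v\<close>, where the substituted functions stay in a smaller
  polydisc.
\<close>

lemma mhol_at_series:
  assumes a: "a \<in> hol_series N r" and r: "0 < r" and D: "open D" "v \<in> D"
    and Z: "\<And>k u. k \<in> {1..<N} \<Longrightarrow> u \<in> D \<Longrightarrow> mhol_at (Z k) u" 
      "\<And>k. k \<in> {1..<N} \<Longrightarrow> cmod (Z k v) < r"
  shows "mhol_at (\<lambda>u. series N a (\<lambda>k. Z k u)) v"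
proof -
  obtain r' where r': "0 < r'" "r' < r" "\<And>k. k \<in> {1..<N} \<Longrightarrow> cmod (Z k v) < r'"
    by (rule Max_cmod_less[of "{1..<N}" "\<lambda>k. Z k v" r]) (use Z r in auto)
  define D' where "D' = D \<inter> {u\<in>D. \<forall>k\<in>{1..<N}. Z k u \<in> ball 0 r'}"
  have "open (\<Inter>k\<in>{1..<N}. D \<inter> Z k -` ball 0 r')"
    using D(1) Z(1) by (intro open_INT continuous_open_preimage ballI mhol_at_imp_continuous_on) auto
  hence "open (D \<inter> (\<Inter>k\<in>{1..<N}. D \<inter> Z k -` ball 0 r'))" using D(1) by blast
  also have "D \<inter> (\<Inter>k\<in>{1..<N}. D \<inter> Z k -` ball 0 r') = D'" by (auto simp: D'_def)
  finally have "open D'" .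
  moreover have "v \<in> D'" using D r' by (auto simp: D'_def)
  ultimately show ?thesis
  proof (rule mhol_at_uniform_limit)
    have sum: "(\<lambda>m. norm (a m * zmonom N (\<lambda>_. of_real r') m)) summable_on exponents N"
      using a r' unfolding hol_series_def by auto
    show "uniform_limit D' (\<lambda>X u. \<Sum>m\<in>X. a m * zmonom N (\<lambda>k. Z k u) m)
        (\<lambda>u. series N a (\<lambda>k. Z k u)) (finite_subsets_at_top (exponents N))"
      unfolding series_def
    proof (rule Weierstrass_m_test_general[OF _ sum])
      fix m u assume "u \<in> D'"
      thus "norm (a m * zmonom N (\<lambda>k. Z k u) m) \<le> norm (a m * zmonom N (\<lambda>_. of_real r') m)"
        unfolding norm_mult using r'
        by (intro mult_left_mono norm_zmonom_mono) (auto simp: D'_def intro: less_imp_le)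
    qed
    show "\<forall>\<^sub>F X in finite_subsets_at_top (exponents N).
        \<forall>u\<in>D'. mhol_at (\<lambda>u. \<Sum>m\<in>X. a m * zmonom N (\<lambda>k. Z k u) m) u"
      unfolding zmonom_def
      by (intro always_eventually allI ballI mhol_at_sum mhol_at_mult mhol_at_const mhol_at_prod
            mhol_at_power Z) (auto simp: D'_def)
  qed auto
qed


lemma geometric_has_sum:
  assumes "norm (u :: complex) < 1"
  shows "((\<lambda>k. u ^ k) has_sum (1 / (1 - u))) UNIV"
  using assms
  by (intro norm_summable_imp_has_sum geometric_sums) (auto simp: norm_power intro: summable_geometric)

lemma exponents_0: "exponents (Suc 0) = {\<lambda>_. 0}"
  by (auto simp: exponents_def)

lemma zmonom_Suc: "zmonom (Suc (Suc n)) u (m(Suc n := k)) = zmonom (Suc n) u m * u (Suc n) ^ k"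
  by (simp add: zmonom_def)

lemma exponents_Suc_bij:
  "bij_betw (\<lambda>(m, k). m(Suc n := k)) (exponents (Suc n) \<times> UNIV) (exponents (Suc (Suc n)))"
  unfolding bij_betw_def
proof
  show "inj_on (\<lambda>(m, k). m(Suc n := k)) (exponents (Suc n) \<times> UNIV)"
  proof (rule inj_onI, clarify)
    fix m k m' k' assume a: "m \<in> exponents (Suc n)" "m' \<in> exponents (Suc n)" "m(Suc n := k) = m'(Suc n := k')"
    have "k = k'" using fun_cong[OF a(3), of "Suc n"] by simp
    moreover have "m i = m' i" for i
      using fun_cong[OF a(3), of i] a(1,2) by (cases "i = Suc n") (auto simp: exponents_def)
    ultimately show "m = m' \<and> k = k'" by auto
  qed
  show "(\<lambda>(m, k). m(Suc n := k)) ` (exponents (Suc n) \<times> UNIV) = exponents (Suc (Suc n))"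
  proof (intro equalityI subsetI)
    fix m assume "m \<in> exponents (Suc (Suc n))"
    hence "m(Suc n := 0) \<in> exponents (Suc n)" "m = (m(Suc n := 0))(Suc n := m (Suc n))"
      by (auto simp: exponents_def)
    thus "m \<in> (\<lambda>(m, k). m(Suc n := k)) ` (exponents (Suc n) \<times> UNIV)"
      by (metis (mono_tags, lifting) UNIV_I case_prod_conv image_eqI mem_Sigma_iff)
  qed (auto simp: exponents_def)
qed

text \<open>
  Induction on the number of variables: an exponent vector in \<open>n + 1\<close> variables is one in \<open>n\<close>
  variables together with the last exponent, so the sum is a product of two absolutely convergent
  sums.
\<close>

lemma multi_geometric_has_sum:
  assumes "\<forall>i\<in>{1..n}. norm (u i) < 1"
  shows "((\<lambda>m. zmonom (Suc n) u m) has_sum (\<Prod>i = 1..n. 1 / (1 - u i))) (exponents (Suc n))"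
  using assms
proof (induction n)
  case 0
  show ?case by (simp add: exponents_0 zmonom_def has_sum_finiteI)
next
  case (Suc n)
  let ?f = "\<lambda>(m, k). zmonom (Suc n) u m * u (Suc n) ^ k"
  let ?P = "\<Prod>i = 1..n. 1 / (1 - u i)"
  have IH: "((\<lambda>m. zmonom (Suc n) u m) has_sum ?P) (exponents (Suc n))" using Suc by simp
  have u: "norm (u (Suc n)) < 1" using Suc.prems by simp
  have inner: "((\<lambda>k. zmonom (Suc n) u m * u (Suc n) ^ k) has_sum (zmonom (Suc n) u m * (1 / (1 - u (Suc n))))) UNIV" for m
    by (intro has_sum_cmult_right geometric_has_sum u)
  have norm_inner: "((\<lambda>k. norm (zmonom (Suc n) u m * u (Suc n) ^ k)) has_sum
      (norm (zmonom (Suc n) u m) * (1 / (1 - norm (u (Suc n)))))) UNIV" for m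
    unfolding norm_mult norm_power
    using geometric_sums[of "norm (u (Suc n))"] u
    by (intro has_sum_cmult_right sums_nonneg_imp_has_sum) auto
  have "(\<lambda>m. norm (zmonom (Suc n) u m)) summable_on exponents (Suc n)"
    using IH by (metis has_sum_imp_summable summable_on_iff_abs_summable_on_complex)
  hence "(\<lambda>m. norm (zmonom (Suc n) u m) * (1 / (1 - norm (u (Suc n))))) summable_on exponents (Suc n)"
    by (rule summable_on_cmult_left)
  moreover have "norm (\<Sum>\<^sub>\<infinity>k. norm (?f (m, k))) = norm (zmonom (Suc n) u m) * (1 / (1 - norm (u (Suc n))))" for m
    using infsumI[OF norm_inner[of m]] u by (simp add: abs_mult)
  moreover have "(\<lambda>k. norm (?f (m, k))) summable_on UNIV" for m
    using norm_inner[of m] by (simp add: has_sum_imp_summable)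
  ultimately have "(\<lambda>p. norm (?f p)) summable_on exponents (Suc n) \<times> UNIV"
    unfolding Infinite_Sum.abs_summable_on_Sigma_iff by (simp only:) simp
  hence summable: "?f summable_on exponents (Suc n) \<times> UNIV" by (rule abs_summable_summable)
  have "(?f has_sum (?P * (1 / (1 - u (Suc n))))) (exponents (Suc n) \<times> UNIV)"
  proof (rule has_sum_SigmaI[OF _ _ summable])
    show "((\<lambda>k. ?f (m, k)) has_sum (zmonom (Suc n) u m * (1 / (1 - u (Suc n))))) UNIV" for m
      unfolding prod.case by (rule inner)
    show "((\<lambda>m. zmonom (Suc n) u m * (1 / (1 - u (Suc n)))) has_sum (?P * (1 / (1 - u (Suc n))))) (exponents (Suc n))"
      by (rule has_sum_cmult_left[OF IH])
  qed
  hence "((\<lambda>p. zmonom (Suc (Suc n)) u ((\<lambda>(m, k). m(Suc n := k)) p)) has_sum (?P * (1 / (1 - u (Suc n)))))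
     (exponents (Suc n) \<times> UNIV)"
    by (simp only: case_prod_unfold zmonom_Suc)
  hence "((\<lambda>m. zmonom (Suc (Suc n)) u m) has_sum (?P * (1 / (1 - u (Suc n))))) (exponents (Suc (Suc n)))"
    by (subst (asm) has_sum_reindex_bij_betw[OF exponents_Suc_bij])
  thus ?case by (simp add: mult.commute)
qed

lemma multi_geometric_summable:
  assumes "\<forall>i\<in>{1..n}. norm (u i) < 1"
  shows "(\<lambda>m. norm (zmonom (Suc n) u m)) summable_on exponents (Suc n)"
  using multi_geometric_has_sum[OF assms] 
  by (metis has_sum_imp_summable summable_on_iff_abs_summable_on_complex)

lemma zmonom_continuous: "continuous_on A (\<lambda>y. zmonom N y m)"
  unfolding zmonom_def
  by (intro continuous_on_prod continuous_on_power
        continuous_on_subset[OF continuous_on_product_coordinates] subset_UNIV)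

lemma zmonom_nonzero: "(\<And>i. i \<in> {1..<N} \<Longrightarrow> z i \<noteq> 0) \<Longrightarrow> zmonom N z m \<noteq> 0"
  by (simp add: zmonom_def)

lemma torus_nonzero: "\<forall>i\<in>{1..n}. r i > 0 \<Longrightarrow> y \<in> torus n r \<Longrightarrow> i \<in> {1..n} \<Longrightarrow> y i \<noteq> 0"
  by (force simp: torus_def)

lemma continuous_on_torus_bounded:
  assumes "continuous_on (torus n r \<times> torus k \<rho>) (\<lambda>(z, w). F z w :: complex)"
  obtains M where "M > 0" "\<And>z w. z \<in> torus n r \<Longrightarrow> w \<in> torus k \<rho> \<Longrightarrow> norm (F z w) \<le> M"
proof -
  have "compact ((\<lambda>(z, w). F z w) ` (torus n r \<times> torus k \<rho>))"
    by (intro compact_continuous_image assms compact_Times compact_torus)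
  from compact_imp_bounded[OF this] obtain M where M: "M > 0"
      "\<forall>x \<in> (\<lambda>(z, w). F z w) ` (torus n r \<times> torus k \<rho>). norm x \<le> M"
    unfolding bounded_pos by metis
  show ?thesis by (rule that[of M]) (use M in auto)
qed

text \<open>
  The coefficients are given by Cauchy's formula in \<open>z\<close>, hence are continuous in \<open>w\<close> and decay
  like \<open>r\<close> to the power \<open>-m\<close>, uniformly in \<open>w\<close>. This justifies integration term by term.
\<close>

lemma torus_integral_power_series:
  fixes F :: "(nat \<Rightarrow> complex) \<Rightarrow> (nat \<Rightarrow> complex) \<Rightarrow> complex"
  assumes r: "\<forall>i\<in>{1..n}. r i > 0" and \<rho>: "\<forall>i\<in>{1..k}. \<rho> i > 0"
    and cont: "continuous_on (torus n r \<times> torus k \<rho>) (\<lambda>(z, w). F z w)"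
    and diff: "\<And>z i w. w \<in> torus k \<rho> \<Longrightarrow> (\<forall>j\<in>{1..n}. cmod (z j) \<le> r j) \<Longrightarrow>
        (\<forall>j. j \<notin> {1..n} \<longrightarrow> z j = 0) \<Longrightarrow> i \<in> {1..n} \<Longrightarrow>
        (\<lambda>u. F (z(i := u)) w) field_differentiable (at (z i))"
    and cong: "\<And>z z' w. (\<And>i. i \<in> {1..n} \<Longrightarrow> z i = z' i) \<Longrightarrow> F z w = F z' w"
  shows "\<exists>a\<in>power_series (Suc n). \<forall>z. (\<forall>i\<in>{1..n}. cmod (z i) < r i) \<longrightarrow>
     ((\<lambda>m. a m * zmonom (Suc n) z m) has_sum torus_integral k \<rho> (F z)) (exponents (Suc n))"
proof -
  obtain M where M: "M > 0" "\<And>z w. z \<in> torus n r \<Longrightarrow> w \<in> torus k \<rho> \<Longrightarrow> norm (F z w) \<le> M"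
    using continuous_on_torus_bounded[OF cont] by metis
  let ?mon = "zmonom (Suc n)"
  define b where "b m w = torus_integral n r (\<lambda>y. F y w / ?mon y m)" for m w
  define a where "a m = (if m \<in> exponents (Suc n) then torus_integral k \<rho> (b m) else 0)" for m
  have mon0: "?mon y m \<noteq> 0" if "y \<in> torus n r" for y m
    using that torus_nonzero[OF r that] by (intro zmonom_nonzero) auto
  have cont_z: "continuous_on (torus n r) (\<lambda>y. F y w)" if "w \<in> torus k \<rho>" for w
  proof -
    have "continuous_on (torus n r) (\<lambda>y. (\<lambda>(z, w). F z w) (y, w))"
      by (rule continuous_on_compose2[OF cont], intro continuous_on_Pair continuous_on_id continuous_on_const)
         (use that in auto)
    thus ?thesis by simp
  qed
  have b_cont: "continuous_on (torus k \<rho>) (b m)" for m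
  proof -
    have "continuous_on (torus k \<rho> \<times> torus n r) (\<lambda>p. (\<lambda>(z, w). F z w) (snd p, fst p) / ?mon (snd p) m)"
      by (intro continuous_on_divide continuous_on_compose2[OF cont]
            continuous_on_compose2[OF zmonom_continuous[of UNIV]]
            continuous_on_Pair continuous_on_fst continuous_on_snd continuous_on_id subset_UNIV)
         (auto simp: mon0)
    thus ?thesis unfolding b_def
      by (intro torus_integral_continuous[OF r]) (simp add: case_prod_unfold)
  qed
  have norm_mon: "norm (?mon y m) = norm (?mon (\<lambda>i. of_real (r i)) m)" if "y \<in> torus n r" for y m
    unfolding norm_zmonom using that r by (intro prod.cong) (auto simp: torus_def less_Suc_eq_le abs_of_pos)
  show ?thesis
  proof (intro bexI allI impI)
    fix z :: "nat \<Rightarrow> complex" assume z: "\<forall>i\<in>{1..n}. cmod (z i) < r i"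
    define z' where "z' = (\<lambda>i. if i \<in> {1..n} then z i else 0)"
    have zz': "?mon z m = ?mon z' m" for m
      by (rule zmonom_cong) (auto simp: z'_def)
    define Q where "Q m = norm (?mon (\<lambda>i. z' i / of_real (r i)) m)" for m
    have "\<forall>i\<in>{1..n}. norm (z' i / of_real (r i)) < 1"
      using z r by (auto simp: z'_def norm_divide)
    hence Q: "Q summable_on exponents (Suc n)"
      unfolding Q_def by (rule multi_geometric_summable)
    have Q_eq: "norm (?mon z' m / ?mon y m) = Q m" if "y \<in> torus n r" for y m
    proof -
      have "?mon z' m = ?mon (\<lambda>i. z' i / of_real (r i)) m * ?mon (\<lambda>i. of_real (r i)) m"
        unfolding zmonom_mult[symmetric] using r by (intro zmonom_cong) force
      moreover have "norm (?mon (\<lambda>i. of_real (r i)) m) \<noteq> 0"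
        using mon0[OF that] norm_mon[OF that] by (metis norm_eq_zero)
      ultimately show ?thesis
        by (simp add: norm_divide norm_mult norm_mon[OF that] Q_def)
    qed
    have term_cont: "continuous_on (torus n r) (\<lambda>y. F y w * (?mon z' m / ?mon y m))"
      if "w \<in> torus k \<rho>" for w m
      using mon0
      by (intro continuous_on_mult continuous_on_divide continuous_on_const cont_z that zmonom_continuous) auto
    have term_bound: "norm (F y w * (?mon z' m / ?mon y m)) \<le> M * Q m"
      if "w \<in> torus k \<rho>" "y \<in> torus n r" for w y m
      unfolding norm_mult Q_eq[OF that(2)] by (intro mult_right_mono M that) (simp add: Q_def)
    have b_eq: "b m w * ?mon z' m = torus_integral n r (\<lambda>y. F y w * (?mon z' m / ?mon y m))" for m w
      unfolding b_def by (subst mult.commute, subst torus_integral_cmult[OF r, symmetric]) (simp add: mult_ac)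
    have b_bound: "norm (b m w * ?mon z' m) \<le> M * Q m" if "w \<in> torus k \<rho>" for w m
      unfolding b_eq by (intro torus_integral_norm_le r term_cont term_bound that)
    have b_sum: "((\<lambda>m. b m w * ?mon z' m) has_sum F z' w) (exponents (Suc n))"
      if w: "w \<in> torus k \<rho>" for w
    proof -
      have "((\<lambda>m. torus_integral n r (\<lambda>y. F y w * (?mon z' m / ?mon y m))) has_sum
          torus_integral n r (\<lambda>y. F y w * (\<Prod>i = 1..n. 1 / (1 - z' i / y i)))) (exponents (Suc n))"
      proof (rule torus_integral_has_sum[OF r term_cont[OF w] term_bound[OF w]])
        show "(\<lambda>m. M * Q m) summable_on exponents (Suc n)" by (intro summable_on_cmult_right Q)
        fix y assume y: "y \<in> torus n r"
        have "((\<lambda>m. ?mon (\<lambda>i. z' i / y i) m) has_sum (\<Prod>i = 1..n. 1 / (1 - z' i / y i))) (exponents (Suc n))"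
        proof (rule multi_geometric_has_sum, rule ballI)
          fix i assume "i \<in> {1..n}"
          thus "norm (z' i / y i) < 1" using z y r by (auto simp: z'_def torus_def norm_divide)
        qed
        moreover have "?mon (\<lambda>i. z' i / y i) m = ?mon z' m / ?mon y m" for m
          by (simp add: zmonom_def power_divide prod_dividef)
        ultimately show "((\<lambda>m. F y w * (?mon z' m / ?mon y m)) has_sum
            (F y w * (\<Prod>i = 1..n. 1 / (1 - z' i / y i)))) (exponents (Suc n))"
          by (intro has_sum_cmult_right) simp
      qed
      moreover have "torus_integral n r (\<lambda>y. F y w * (\<Prod>i = 1..n. 1 / (1 - z' i / y i))) = F z' w"
        by (rule torus_integral_Cauchy) (use z diff[OF w] in \<open>auto simp: z'_def\<close>)
      ultimately show ?thesis by (simp add: b_eq)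
    qed
    have "((\<lambda>m. torus_integral k \<rho> (\<lambda>w. b m w * ?mon z' m)) has_sum torus_integral k \<rho> (F z')) (exponents (Suc n))"
      by (rule torus_integral_has_sum(1)[where M = "\<lambda>m. M * Q m"])
         (use \<rho> in \<open>auto intro!: b_bound b_sum continuous_on_mult continuous_on_const b_cont summable_on_cmult_right Q\<close>)
    moreover have "torus_integral k \<rho> (\<lambda>w. b m w * ?mon z' m) = torus_integral k \<rho> (b m) * ?mon z' m" for m
      using torus_integral_cmult[OF \<rho>, of "?mon z' m" "b m"] by (simp add: mult.commute)
    ultimately have "((\<lambda>m. torus_integral k \<rho> (b m) * ?mon z' m) has_sum torus_integral k \<rho> (F z')) (exponents (Suc n))"
      by simp
    moreover have "F z' = F z" by (rule ext, rule cong) (simp add: z'_def)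
    ultimately have "((\<lambda>m. torus_integral k \<rho> (b m) * ?mon z' m) has_sum torus_integral k \<rho> (F z)) (exponents (Suc n))"
      by (simp only:)
    thus "((\<lambda>m. a m * ?mon z m) has_sum torus_integral k \<rho> (F z)) (exponents (Suc n))"
      by (rule has_sum_cong[THEN iffD1, rotated]) (simp add: a_def zz')
  qed (simp add: a_def power_series_def)
qed


text \<open>The case of a torus of dimension zero, where nothing is integrated.\<close>

corollary holomorphic_has_power_series:
  fixes F :: "(nat \<Rightarrow> complex) \<Rightarrow> complex"
  assumes r: "\<forall>i\<in>{1..n}. r i > 0"
    and F: "\<And>z. (\<forall>j\<in>{1..n}. cmod (z j) \<le> r j) \<Longrightarrow> mhol_at F z"
    and cong: "\<And>z z'. (\<And>i. i \<in> {1..n} \<Longrightarrow> z i = z' i) \<Longrightarrow> F z = F z'"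
  shows "\<exists>a\<in>power_series (Suc n). \<forall>z. (\<forall>i\<in>{1..n}. cmod (z i) < r i) \<longrightarrow>
     ((\<lambda>m. a m * zmonom (Suc n) z m) has_sum F z) (exponents (Suc n))"
proof -
  have "\<exists>a\<in>power_series (Suc n). \<forall>z. (\<forall>i\<in>{1..n}. cmod (z i) < r i) \<longrightarrow>
     ((\<lambda>m. a m * zmonom (Suc n) z m) has_sum torus_integral 0 (\<lambda>_. 1) (\<lambda>_. F z)) (exponents (Suc n))"
  proof (rule torus_integral_power_series[OF r])
    have "continuous_on (torus n r) F"
      by (rule mhol_at_imp_continuous_on) (auto simp: torus_def intro!: F)
    hence "continuous_on (torus n r \<times> torus 0 (\<lambda>_. 1)) (\<lambda>p. F (fst p))"
      by (rule continuous_on_compose2) (auto intro!: continuous_on_fst continuous_on_id)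
    thus "continuous_on (torus n r \<times> torus 0 (\<lambda>_. 1)) (\<lambda>(z, w). F z)"
      by (simp add: case_prod_unfold)
  next
    fix z :: "nat \<Rightarrow> complex" and i assume "\<forall>j\<in>{1..n}. cmod (z j) \<le> r j"
    from F[OF this] show "(\<lambda>u. F (z(i := u))) field_differentiable (at (z i))" by (rule mhol_at_slice)
  next
    fix z z' :: "nat \<Rightarrow> complex" assume "\<And>i. i \<in> {1..n} \<Longrightarrow> z i = z' i"
    thus "F z = F z'" by (rule cong)
  qed auto
  thus ?thesis by simp
qed

lemma circle_average_power:
  assumes "r > 0"
  shows "integral {0..1} (\<lambda>s. circlepath 0 r s ^ k / circlepath 0 r s ^ l) = (if k = l then 1 else 0)"
proof (cases "k = l")
  case True
  have "circlepath 0 r s \<noteq> 0" for s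
    using norm_circlepath_0[OF assms, of s] assms by (metis norm_zero less_irrefl)
  thus ?thesis using True by simp
next
  case False
  define c where "c = 2 * of_real pi * \<i> * (of_int (int k - int l) :: complex)"
  have c: "c \<noteq> 0" using False by (auto simp: c_def)
  have "circlepath 0 r s ^ k / circlepath 0 r s ^ l = (of_real r ^ k / of_real r ^ l) * exp (c * of_real s)" for s
  proof -
    have "c * of_real s = of_nat k * (2 * of_real pi * \<i> * of_real s) - of_nat l * (2 * of_real pi * \<i> * of_real s)"
      by (simp add: c_def algebra_simps)
    thus ?thesis by (simp add: circlepath power_mult_distrib exp_diff exp_of_nat_mult)
  qed
  moreover have "integral {0..1} (\<lambda>s. exp (c * of_real s)) = 0"
  proof -
    have "((\<lambda>s. exp (c * of_real s)) has_integral (exp (c * of_real 1) / c - exp (c * of_real 0) / c)) {0..1}"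
    proof (rule fundamental_theorem_of_calculus)
      fix s :: real
      have "((\<lambda>w. exp (c * w) / c) has_field_derivative exp (c * of_real s)) (at (of_real s))"
        using c by (auto intro!: derivative_eq_intros)
      hence "((\<lambda>x. exp (c * of_real x) / c) has_vector_derivative exp (c * of_real s)) (at s)"
        using has_vector_derivative_real_field by blast
      thus "((\<lambda>s. exp (c * of_real s) / c) has_vector_derivative exp (c * of_real s)) (at s within {0..1})"
        by (rule has_vector_derivative_at_within)
    qed simp
    moreover have "exp c = 1"
      unfolding exp_eq_1 c_def by (auto intro!: exI[of _ "int k - int l"])
    ultimately show ?thesis by (simp add: integral_unique)
  qed
  ultimately show ?thesis using False by simp
qed

text \<open>
  The monomials are orthonormal on the torus.
\<close>

lemma power_series_coefficient:
  assumes r: "r > 0" and a: "(\<lambda>m. norm (a m * zmonom (Suc n) (\<lambda>_. of_real r) m)) summable_on exponents (Suc n)"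
    and k: "k \<in> exponents (Suc n)"
  shows "torus_integral n (\<lambda>_. r) (\<lambda>y. series (Suc n) a y / zmonom (Suc n) y k) = a k"
proof -
  let ?mon = "zmonom (Suc n)"
  have pos: "\<forall>i\<in>{1..n}. (\<lambda>_. r) i > 0" using r by simp
  have mon0: "?mon y m \<noteq> 0" if "y \<in> torus n (\<lambda>_. r)" for y m
    using that torus_nonzero[OF pos that] by (intro zmonom_nonzero) auto
  have norm_mon: "norm (?mon y m) = norm (?mon (\<lambda>i. of_real r) m)" if "y \<in> torus n (\<lambda>_. r)" for y m
    unfolding norm_zmonom using that r by (intro prod.cong) (auto simp: torus_def less_Suc_eq_le abs_of_pos)
  have "((\<lambda>m. torus_integral n (\<lambda>_. r) (\<lambda>y. a m * ?mon y m / ?mon y k)) has_sum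
      torus_integral n (\<lambda>_. r) (\<lambda>y. series (Suc n) a y / ?mon y k)) (exponents (Suc n))"
  proof (rule torus_integral_has_sum(1)[OF pos])
    show "(\<lambda>m. norm (a m * ?mon (\<lambda>_. of_real r) m) * (1 / norm (?mon (\<lambda>i. of_real r) k))) summable_on exponents (Suc n)"
      by (intro summable_on_cmult_left a)
    fix y assume y: "y \<in> torus n (\<lambda>_. r)"
    have "(\<lambda>m. a m * ?mon y m) summable_on exponents (Suc n)"
      by (rule abs_summable_summable) (use a in \<open>simp add: norm_mult norm_mon[OF y]\<close>)
    thus "((\<lambda>m. a m * ?mon y m / ?mon y k) has_sum (series (Suc n) a y / ?mon y k)) (exponents (Suc n))"
      unfolding series_def by (intro has_sum_divide_const has_sum_infsum)
  next
    fix m y assume "y \<in> torus n (\<lambda>_. r)"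
    thus "norm (a m * ?mon y m / ?mon y k) \<le> norm (a m * ?mon (\<lambda>_. of_real r) m) * (1 / norm (?mon (\<lambda>i. of_real r) k))"
      by (simp add: norm_mult norm_divide norm_mon)
  next
    fix m
    show "continuous_on (torus n (\<lambda>_. r)) (\<lambda>y. a m * ?mon y m / ?mon y k)"
      by (intro continuous_on_mult continuous_on_divide continuous_on_const zmonom_continuous ballI mon0)
  qed
  moreover have "torus_integral n (\<lambda>_. r) (\<lambda>y. a m * ?mon y m / ?mon y k) = (if m = k then a k else 0)"
    if m: "m \<in> exponents (Suc n)" for m
  proof -
    have "torus_integral n (\<lambda>_. r) (\<lambda>y. a m * ?mon y m / ?mon y k)
        = a m * torus_integral n (\<lambda>_. r) (\<lambda>y. \<Prod>i = 1..n. y i ^ m i / y i ^ k i)"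
      unfolding torus_integral_cmult[OF pos, symmetric]
      by (simp add: zmonom_def prod_dividef atLeastLessThanSuc_atLeastAtMost)
    also have "\<dots> = a m * (\<Prod>i = 1..n. if m i = k i then 1 else 0)"
      using torus_integral_prod[OF pos, of "\<lambda>i w. w ^ m i / w ^ k i"] r
      by (simp add: circle_average_power)
    also have "(\<Prod>i = 1..n. if m i = k i then 1 else (0::complex)) = (if m = k then 1 else 0)"
    proof (cases "m = k")
      case False
      then obtain i where i: "m i \<noteq> k i" by auto
      have "i \<in> {1..n}"
      proof (rule ccontr)
        assume "i \<notin> {1..n}"
        hence "m i = 0" "k i = 0" using m k by (auto simp: exponents_def)
        thus False using i by simp
      qed
      thus ?thesis using i False by (auto intro!: prod_zero)
    qed simp
    finally show ?thesis by simp
  qed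
  ultimately have "((\<lambda>m. if m = k then a k else 0) has_sum
      torus_integral n (\<lambda>_. r) (\<lambda>y. series (Suc n) a y / ?mon y k)) (exponents (Suc n))"
    by (simp cong: has_sum_cong)
  moreover have "((\<lambda>m. if m = k then a k else 0) has_sum a k) (exponents (Suc n))"
    using has_sum_finite_neutralI[of "{k}" "exponents (Suc n)" "\<lambda>m. if m = k then a k else 0" "a k"] k by auto
  ultimately show ?thesis by (rule has_sum_unique)
qed

text \<open>
  The coefficients are recovered by integration over a small torus, on which no \<open>z i\<close> vanishes. This
  matters because ratios of the \<open>x i\<close> are never zero.
\<close>

lemma power_series_unique:
  assumes "a \<in> power_series (Suc n)" "b \<in> power_series (Suc n)" and e: "e > 0"
    and S: "\<And>z. (\<And>i. i \<in> {1..n} \<Longrightarrow> z i \<noteq> 0 \<and> cmod (z i) < e) \<Longrightarrow>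
      \<exists>S. ((\<lambda>m. a m * zmonom (Suc n) z m) has_sum S) (exponents (Suc n)) \<and>
          ((\<lambda>m. b m * zmonom (Suc n) z m) has_sum S) (exponents (Suc n))"
  shows "a = b"
proof
  fix k
  show "a k = b k"
  proof (cases "k \<in> exponents (Suc n)")
    case True
    define r where "r = e / 2"
    have r: "r > 0" "r < e" using e by (auto simp: r_def)
    have "(\<lambda>m. norm (a m * zmonom (Suc n) (\<lambda>_. of_real r) m)) summable_on exponents (Suc n)"
      "(\<lambda>m. norm (b m * zmonom (Suc n) (\<lambda>_. of_real r) m)) summable_on exponents (Suc n)"
      unfolding summable_on_iff_abs_summable_on_complex[symmetric]
      using S[of "\<lambda>_. of_real r"] r by (auto intro: has_sum_imp_summable)
    note coeff = this[THEN power_series_coefficient[OF r(1) _ True]]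
    have "series (Suc n) a y = series (Suc n) b y" if "y \<in> torus n (\<lambda>_. r)" for y
      using S[of y] that r unfolding series_def torus_def by (fastforce simp: infsumI)
    hence "torus_integral n (\<lambda>_. r) (\<lambda>y. series (Suc n) a y / zmonom (Suc n) y k)
        = torus_integral n (\<lambda>_. r) (\<lambda>y. series (Suc n) b y / zmonom (Suc n) y k)"
      using r by (intro torus_integral_cong) auto
    thus ?thesis using coeff by simp
  qed (use assms(1,2) in \<open>auto simp: power_series_def\<close>)
qed


text \<open>
  It suffices to have summability at points without zero coordinates: a polydisc is dominated
  by its corner with all coordinates equal to a positive radius.
\<close>

lemma hol_seriesI:
  assumes a: "a \<in> power_series (Suc n)"
    and S: "\<And>z. (\<And>i. i \<in> {1..n} \<Longrightarrow> z i \<noteq> 0 \<and> cmod (z i) < r) \<Longrightarrow>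
      (\<lambda>m. a m * zmonom (Suc n) z m) summable_on exponents (Suc n)"
    and r: "r > 0"
  shows "a \<in> hol_series (Suc n) r"
  unfolding hol_series_def
proof (intro CollectI conjI allI impI a)
  fix r' z assume r': "r' < r" and z: "\<forall>i\<in>{1..<Suc n}. cmod (z i) \<le> r'"
  \<comment> \<open>\<open>r'\<close> itself need not be positive\<close>
  define c where "c = max r' (r / 2)"
  have c: "0 < c" "c < r" using r r' by (auto simp: c_def)
  have "(\<lambda>m. a m * zmonom (Suc n) (\<lambda>_. of_real c) m) summable_on exponents (Suc n)"
    by (rule S) (use c in auto)
  hence "(\<lambda>m. norm (a m * zmonom (Suc n) (\<lambda>_. of_real c) m)) summable_on exponents (Suc n)"
    unfolding summable_on_iff_abs_summable_on_complex .
  thus "(\<lambda>m. norm (a m * zmonom (Suc n) z m)) summable_on exponents (Suc n)"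
  proof (rule Infinite_Sum.abs_summable_on_comparison_test')
    fix m
    show "norm (a m * zmonom (Suc n) z m) \<le> norm (a m * zmonom (Suc n) (\<lambda>_. of_real c) m)"
      unfolding norm_mult using z c
      by (intro mult_left_mono norm_zmonom_mono) (force simp: c_def)+
  qed
qed

lemma common_radius:
  fixes r :: "nat \<Rightarrow> real"
  assumes "\<And>i. i \<in> {1..n} \<Longrightarrow> r i > 0" "0 < e"
  obtains d where "0 < d" "d \<le> e" "\<And>i. i \<in> {1..n} \<Longrightarrow> d \<le> r i"
proof (rule that[of "Min (insert e (r ` {1..n}))"])
  show "0 < Min (insert e (r ` {1..n}))" using assms by (subst Min_gr_iff) auto
  show "Min (insert e (r ` {1..n})) \<le> e" by (rule Min_le) auto
  show "Min (insert e (r ` {1..n})) \<le> r i" if "i \<in> {1..n}" for i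
    by (rule Min_le) (use that in auto)
qed

text \<open>
  By uniqueness of the coefficients, local expansions whose sums agree near the origin are given by
  a single power series.
\<close>

lemma power_series_glue:
  assumes P: "P \<noteq> {}"
    and local: "\<And>p. p \<in> P \<Longrightarrow> \<exists>r a. a \<in> power_series (Suc n) \<and> (\<forall>i\<in>{1..n}. cmod (\<zeta> p i) < r i) \<and>
      (\<forall>z. (\<forall>i\<in>{1..n}. cmod (z i) < r i) \<longrightarrow> ((\<lambda>m. a m * zmonom (Suc n) z m) has_sum G p z) (exponents (Suc n)))"
    and agree: "\<And>p p'. p \<in> P \<Longrightarrow> p' \<in> P \<Longrightarrow> \<exists>e>0. \<forall>z. (\<forall>i\<in>{1..n}. cmod (z i) < e) \<longrightarrow> G p z = G p' z"
  obtains a where "a \<in> power_series (Suc n)"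
    "\<And>p. p \<in> P \<Longrightarrow> ((\<lambda>m. a m * zmonom (Suc n) (\<zeta> p) m) has_sum G p (\<zeta> p)) (exponents (Suc n))"
proof -
  obtain p0 where p0: "p0 \<in> P" using P by blast
  obtain r0 a0 where a0: "a0 \<in> power_series (Suc n)" "\<forall>i\<in>{1..n}. cmod (\<zeta> p0 i) < r0 i"
    "\<And>z. (\<forall>i\<in>{1..n}. cmod (z i) < r0 i) \<Longrightarrow> ((\<lambda>m. a0 m * zmonom (Suc n) z m) has_sum G p0 z) (exponents (Suc n))"
    using local[OF p0] by metis
  have pos0: "r0 i > 0" if "i \<in> {1..n}" for i
    using a0(2) that by (meson norm_ge_zero order_le_less_trans)
  show ?thesis
  proof (rule that[OF a0(1)])
    fix p assume p: "p \<in> P"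
    obtain r a where a: "a \<in> power_series (Suc n)" "\<forall>i\<in>{1..n}. cmod (\<zeta> p i) < r i"
      "\<And>z. (\<forall>i\<in>{1..n}. cmod (z i) < r i) \<Longrightarrow> ((\<lambda>m. a m * zmonom (Suc n) z m) has_sum G p z) (exponents (Suc n))"
      using local[OF p] by metis
    have pos: "r i > 0" if "i \<in> {1..n}" for i
      using a(2) that by (meson norm_ge_zero order_le_less_trans)
    obtain e where e: "e > 0" "\<And>z. (\<forall>i\<in>{1..n}. cmod (z i) < e) \<Longrightarrow> G p z = G p0 z"
      using agree[OF p p0] by metis
    obtain d0 where d0: "0 < d0" "d0 \<le> e" "\<And>i. i \<in> {1..n} \<Longrightarrow> d0 \<le> r0 i"
      using common_radius[of n r0 e] pos0 e(1) by metis
    obtain d where d: "0 < d" "d \<le> d0" "\<And>i. i \<in> {1..n} \<Longrightarrow> d \<le> r i"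
      using common_radius[of n r d0] pos d0(1) by metis
    have "a = a0"
    proof (rule power_series_unique[OF a(1) a0(1) d(1)])
      fix z assume "\<And>i. i \<in> {1..n} \<Longrightarrow> z i \<noteq> 0 \<and> cmod (z i) < d"
      hence z: "\<forall>i\<in>{1..n}. cmod (z i) < d" by blast
      have "\<forall>i\<in>{1..n}. cmod (z i) < r i" "\<forall>i\<in>{1..n}. cmod (z i) < r0 i" "\<forall>i\<in>{1..n}. cmod (z i) < e"
        using z d d0 by (meson order_less_le_trans)+
      thus "\<exists>S. ((\<lambda>m. a m * zmonom (Suc n) z m) has_sum S) (exponents (Suc n)) \<and>
          ((\<lambda>m. a0 m * zmonom (Suc n) z m) has_sum S) (exponents (Suc n))"
        using a(3) a0(3) e(2) by metis
    qed
    thus "((\<lambda>m. a0 m * zmonom (Suc n) (\<zeta> p) m) has_sum G p (\<zeta> p)) (exponents (Suc n))"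
      using a(2,3) by metis
  qed
qed

text \<open>
  Points with prescribed ratios exist, so statements about all \<open>x\<close> in a ratio domain are statements about
  all small \<open>z\<close> without zero coordinates.
\<close>

lemma ratios_surj:
  assumes "\<And>i. i \<in> {1..n} \<Longrightarrow> z i \<noteq> 0"
  obtains x where "\<And>i. i \<in> {1..Suc n} \<Longrightarrow> x i \<noteq> 0" "\<And>i. i \<in> {1..n} \<Longrightarrow> ratios x i = z i"
proof (rule that[of "\<lambda>i. \<Prod>k = 1..<i. z k"])
  fix i assume "i \<in> {1..Suc n}"
  thus "(\<Prod>k = 1..<i. z k) \<noteq> 0" using assms by auto
next
  fix i assume i: "i \<in> {1..n}"
  have "(\<Prod>k = 1..<i. z k) \<noteq> 0" using assms i by auto
  thus "ratios (\<lambda>i. \<Prod>k = 1..<i. z k) i = z i"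
    using i by (simp add: ratios_def)
qed


section \<open>The kernel of the integral operator\<close>

locale kernel_parameters =
  fixes q t s0 :: complex and s :: "nat \<Rightarrow> complex" and n :: nat
  assumes q_less_1: "cmod q < 1" and t_nonzero: "t \<noteq> 0" and inverse_t_less_q: "cmod (inverse t) < cmod q"
    and s0_nonzero: "s0 \<noteq> 0" and s_nonzero: "\<And>i. i \<in> {1..Suc n} \<Longrightarrow> s i \<noteq> 0"
begin

lemma q_nonzero: "q \<noteq> 0"
  using inverse_t_less_q by auto

lemma cmod_q_pos: "cmod q > 0"
  using q_nonzero by simp

lemma cmod_t_pos: "cmod t > 0"
  using t_nonzero by simp

lemma one_less_qt: "1 < cmod q * cmod t"
  using inverse_t_less_q cmod_t_pos by (simp add: norm_inverse norm_divide field_simps)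

lemma one_less_t: "1 < cmod t"
proof -
  have "cmod q * cmod t \<le> 1 * cmod t" using q_less_1 by (intro mult_right_mono) auto
  thus ?thesis using one_less_qt by simp
qed

text \<open>
  \<open>reduced_kernel\<close> is the integrand without \<open>f\<close>, together with the product in front of the integral,
  in the variables \<open>z k = x (k + 1) / x k\<close> and \<open>w i = y i / x i\<close>, after cancellation of the factors of
  the theta functions that may vanish on the contour. In \<open>pair_factor u a b\<close> the arguments stand for
  \<open>x j / x i\<close>, \<open>y i / x i\<close> and \<open>y j / x j\<close> with \<open>i < j\<close>; all occurrences of \<open>u\<close> are such that the
  expression makes sense for \<open>u = 0\<close>, which is where the expansion in the \<open>z k\<close> takes place.
\<close>

definition diagonal_factor :: "nat \<Rightarrow> complex \<Rightarrow> complex" where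
  "diagonal_factor i w = qtheta q (q * s0 * w / s i) / (qpoch q (q * w / t) * qpoch q (1 / w))"

definition pair_factor :: "complex \<Rightarrow> complex \<Rightarrow> complex \<Rightarrow> complex" where
  "pair_factor u a b = qpoch q (q * u / t) / qpoch q (t * u) * (qpoch q (q * (u * b)) / qpoch q (q * (u * b) / t))
     * (qpoch q (t * (u / a)) / qpoch q (u / a)) * (1 - u * b / a)"

definition ratio :: "(nat \<Rightarrow> complex) \<Rightarrow> nat \<Rightarrow> nat \<Rightarrow> complex" where
  "ratio z i j = (\<Prod>k = i..<j. z k)"

definition reduced_kernel :: "(nat \<Rightarrow> complex) \<Rightarrow> (nat \<Rightarrow> complex) \<Rightarrow> complex" where
  "reduced_kernel z w = (\<Prod>i = 1..Suc n. diagonal_factor i (w i))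
     * (\<Prod>i = 1..Suc n. \<Prod>j = i+1..Suc n. pair_factor (ratio z i j) (w i) (w j))"

lemma ratio_ratios:
  assumes "\<And>i. i \<in> {1..Suc n} \<Longrightarrow> x i \<noteq> 0" "1 \<le> i" "i \<le> j" "j \<le> Suc n"
  shows "ratio (ratios x) i j = x j / x i"
  using assms(3,4)
proof (induction j rule: dec_induct)
  case base
  thus ?case using assms(1)[of i] assms(2) by (simp add: ratio_def)
next
  case (step j)
  hence "x j \<noteq> 0" using assms(1)[of j] assms(2) by simp
  have "ratio (ratios x) i (Suc j) = ratio (ratios x) i j * ratios x j"
    using step by (simp add: ratio_def)
  also have "\<dots> = x j / x i * (x (Suc j) / x j)" using step by (simp add: ratios_def)
  finally show ?case using \<open>x j \<noteq> 0\<close> by simp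
qed

lemma ratio_less:
  assumes "\<And>k. k \<in> {1..n} \<Longrightarrow> cmod (z k) < r" "r \<le> 1" "1 \<le> i" "i < j" "j \<le> Suc n"
  shows "cmod (ratio z i j) < r"
proof -
  have "{i..<j} = insert i {Suc i..<j}" using assms by auto
  hence "ratio z i j = z i * (\<Prod>k = Suc i..<j. z k)" by (simp add: ratio_def)
  moreover
  have "cmod (\<Prod>k = Suc i..<j. z k) \<le> 1"
    unfolding prod_norm[symmetric]
  proof (rule prod_le_1)
    fix k assume "k \<in> {Suc i..<j}"
    hence "cmod (z k) < r" using assms by auto
    thus "0 \<le> cmod (z k) \<and> cmod (z k) \<le> 1" using assms(2) by simp
  qed
  hence "cmod (z i) * cmod (\<Prod>k = Suc i..<j. z k) \<le> cmod (z i) * 1"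
    by (intro mult_left_mono) auto
  moreover have "cmod (z i) < r" using assms by auto
  ultimately show ?thesis by (simp add: norm_mult)
qed

lemma ratio_cong: "(\<And>k. k \<in> {1..n} \<Longrightarrow> z k = z' k) \<Longrightarrow> 1 \<le> i \<Longrightarrow> j \<le> Suc n \<Longrightarrow> ratio z i j = ratio z' i j"
  unfolding ratio_def by (intro prod.cong) auto

lemma reduced_kernel_cong:
  assumes "\<And>k. k \<in> {1..n} \<Longrightarrow> z k = z' k" "\<And>i. i \<in> {1..Suc n} \<Longrightarrow> w i = w' i"
  shows "reduced_kernel z w = reduced_kernel z' w'"
  unfolding reduced_kernel_def
proof (intro arg_cong2[where f = "(*)"] prod.cong refl)
  fix i j assume "i \<in> {1..Suc n}" "j \<in> {i+1..Suc n}"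
  thus "pair_factor (ratio z i j) (w i) (w j) = pair_factor (ratio z' i j) (w' i) (w' j)"
    using assms(2)[of i] assms(2)[of j] ratio_cong[of z z' i j] assms(1) by auto
qed (use assms in auto)

lemma mhol_at_diagonal_factor:
  assumes W: "mhol_at W v" "1 < cmod (W v)" "cmod (W v) < cmod (t / q)" and i: "i \<in> {1..Suc n}"
  shows "mhol_at (\<lambda>v. diagonal_factor i (W v)) v"
proof -
  have "W v \<noteq> 0" using W(2) by auto
  moreover have "qpoch q (q * W v / t) \<noteq> 0"
    using W(3) cmod_q_pos cmod_t_pos
    by (intro qpoch_nonzero q_less_1) (simp add: norm_mult norm_divide field_simps)
  moreover have "qpoch q (1 / W v) \<noteq> 0"
    using W(2) by (intro qpoch_nonzero q_less_1) (simp add: norm_divide divide_less_eq)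
  ultimately show ?thesis
    unfolding diagonal_factor_def qtheta_def
    using i s_nonzero[OF i] s0_nonzero q_nonzero t_nonzero W(1) q_less_1
    by (intro mhol_at_divide mhol_at_mult mhol_at_qpoch mhol_at_const) auto
qed

text \<open>
  Each \<open>qpoch q\<close> in a denominator is taken at a point of the open unit disc, where it has no zeros.
\<close>

lemma mhol_at_pair_factor:
  assumes U: "mhol_at U v" "cmod (U v) < cmod (inverse t)"
    and A: "mhol_at A v" "1 < cmod (A v)" and B: "mhol_at B v" "cmod (B v) < cmod (t / q)"
  shows "mhol_at (\<lambda>v. pair_factor (U v) (A v) (B v)) v"
proof -
  have tU: "cmod (t * U v) < 1" using U(2) cmod_t_pos by (simp add: norm_mult norm_inverse norm_divide field_simps)
  have "1 / cmod t < 1" using one_less_t by (simp add: divide_less_eq)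
  hence U1: "cmod (U v) < 1" using U(2) by (simp add: norm_inverse norm_divide field_simps)
  have "A v \<noteq> 0" using A(2) by auto
  moreover have "qpoch q (t * U v) \<noteq> 0" by (intro qpoch_nonzero q_less_1 tU)
  moreover have "qpoch q (U v / A v) \<noteq> 0"
    using A(2) U1 by (intro qpoch_nonzero q_less_1) (simp add: norm_divide divide_less_eq)
  moreover have "qpoch q (q * (U v * B v) / t) \<noteq> 0"
  proof (intro qpoch_nonzero q_less_1)
    have "cmod (q * (U v * B v) / t) = cmod (U v) * cmod (q * B v / t)"
      by (simp add: norm_mult norm_divide)
    also have "cmod (q * B v / t) < 1"
      using B(2) cmod_q_pos cmod_t_pos by (simp add: norm_mult norm_divide field_simps)
    hence "cmod (U v) * cmod (q * B v / t) \<le> cmod (U v) * 1" by (intro mult_left_mono) auto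
    finally show "cmod (q * (U v * B v) / t) < 1" using U1 by simp
  qed
  ultimately show ?thesis
    unfolding pair_factor_def using U(1) A(1) B(1) q_less_1 t_nonzero
    by (intro mhol_at_mult mhol_at_divide mhol_at_diff mhol_at_qpoch mhol_at_const) auto
qed

lemma mhol_at_ratio:
  assumes "\<And>k. k \<in> {1..n} \<Longrightarrow> mhol_at (Z k) v" "1 \<le> i" "j \<le> Suc n"
  shows "mhol_at (\<lambda>v. ratio (\<lambda>k. Z k v) i j) v"
  unfolding ratio_def by (intro mhol_at_prod assms(1)) (use assms(2,3) in auto)

lemma inverse_t_le_1: "cmod (inverse t) \<le> 1"
  using inverse_t_less_q q_less_1 by linarith

lemma mhol_at_reduced_kernel:
  assumes Z: "\<And>k. k \<in> {1..n} \<Longrightarrow> mhol_at (Z k) v" "\<And>k. k \<in> {1..n} \<Longrightarrow> cmod (Z k v) < cmod (inverse t)"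
    and W: "\<And>i. i \<in> {1..Suc n} \<Longrightarrow> mhol_at (W i) v" "\<And>i. i \<in> {1..Suc n} \<Longrightarrow> 1 < cmod (W i v)"
      "\<And>i. i \<in> {1..Suc n} \<Longrightarrow> cmod (W i v) < cmod (t / q)"
  shows "mhol_at (\<lambda>v. reduced_kernel (\<lambda>k. Z k v) (\<lambda>i. W i v)) v"
  unfolding reduced_kernel_def
  by (intro mhol_at_mult mhol_at_prod mhol_at_diagonal_factor mhol_at_pair_factor mhol_at_ratio W Z
        ratio_less[OF Z(2) inverse_t_le_1]) auto

lemma prod_pairs:
  fixes g :: "nat \<Rightarrow> nat \<Rightarrow> complex"
  shows "(\<Prod>i = 1..N. \<Prod>j = 1..N. g i j) = (\<Prod>i = 1..N. g i i) * (\<Prod>i = 1..N. \<Prod>j = i+1..N. g i j * g j i)"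
proof (induction N)
  case (Suc N)
  have "(\<Prod>i = 1..Suc N. \<Prod>j = i+1..Suc N. h i j) = (\<Prod>i = 1..N. \<Prod>j = i+1..N. h i j) * (\<Prod>i = 1..N. h i (Suc N))"
    for h :: "nat \<Rightarrow> nat \<Rightarrow> complex"
    by (simp add: prod.distrib)
  moreover have "(\<Prod>i = 1..Suc N. \<Prod>j = 1..Suc N. g i j) = (\<Prod>i = 1..N. \<Prod>j = 1..N. g i j)
     * (\<Prod>i = 1..N. g i (Suc N)) * (\<Prod>j = 1..N. g (Suc N) j) * g (Suc N) (Suc N)"
    by (simp add: prod.distrib mult_ac)
  ultimately show ?case using Suc by (simp add: prod.distrib mult_ac)
qed simp

text \<open>
  The cancellation: for \<open>i < j\<close>, \<open>qtheta q (t * x j / y i)\<close> contains the factor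
  \<open>qpoch q (q * y i / (t * x j))\<close> occurring in the denominator of \<open>kernel_Pi\<close>, and the numerators of
  \<open>kernel_Pi\<close> contain one half of each denominator theta function.
\<close>

lemma integrand_eq_reduced_kernel:
  assumes x: "\<And>i. i \<in> {1..Suc n} \<Longrightarrow> x i \<noteq> 0" and y: "\<And>i. i \<in> {1..Suc n} \<Longrightarrow> y i \<noteq> 0"
    and gen: "\<And>i j. i \<in> {1..Suc n} \<Longrightarrow> j \<in> {1..Suc n} \<Longrightarrow>
       qpoch q (q * y i / x j) \<noteq> 0 \<and> qpoch q (q * y i / (t * x j)) \<noteq> 0"
  shows "(\<Prod>i = 1..Suc n. \<Prod>j = i+1..Suc n. qpoch q (q * x j / (t * x i)) / qpoch q (t * x j / x i))
      * (kernel_Pi (Suc n) q t x y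
        * (\<Prod>i = 1..Suc n. qtheta q (q * s0 * y i / (s i * x i)) / qtheta q (q * y i / x i))
        * (\<Prod>i = 1..Suc n. \<Prod>j = i+1..Suc n. qtheta q (t * x j / y i) / qtheta q (x j / y i))
        * (\<Prod>i = 1..Suc n. \<Prod>j = i+1..Suc n. 1 - y j / y i))
    = reduced_kernel (ratios x) (\<lambda>i. y i / x i)" (is "?B * (?P * ?D * ?T * ?V) = ?R")
proof -
  let ?g = "\<lambda>i j. qpoch q (q * y j / x i) / qpoch q (q * y j / (t * x i))"
  have "?P = (\<Prod>i = 1..Suc n. ?g i i) * (\<Prod>i = 1..Suc n. \<Prod>j = i+1..Suc n. ?g i j * ?g j i)"
    unfolding kernel_Pi_def by (rule prod_pairs)
  hence "?B * (?P * ?D * ?T * ?V) = ((\<Prod>i = 1..Suc n. ?g i i) * ?D)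
     * (?B * (\<Prod>i = 1..Suc n. \<Prod>j = i+1..Suc n. ?g i j * ?g j i) * ?T * ?V)"
    by (simp only: mult_ac)
  also have "\<dots> = (\<Prod>i = 1..Suc n. ?g i i * (qtheta q (q * s0 * y i / (s i * x i)) / qtheta q (q * y i / x i)))
     * (\<Prod>i = 1..Suc n. \<Prod>j = i+1..Suc n. qpoch q (q * x j / (t * x i)) / qpoch q (t * x j / x i) * (?g i j * ?g j i)
          * (qtheta q (t * x j / y i) / qtheta q (x j / y i)) * (1 - y j / y i))"
    by (simp only: prod.distrib)
  also have "\<dots> = ?R"
    unfolding reduced_kernel_def
  proof (intro arg_cong2[where f = "(*)"] prod.cong refl)
    fix i assume i: "i \<in> {1..Suc n}"
    have e1: "qtheta q (q * y i / x i) = qpoch q (q * y i / x i) * qpoch q (x i / y i)"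
      using x[OF i] q_nonzero by (simp add: qtheta_def)
    have e2: "q * s0 * (y i / x i) / s i = q * s0 * y i / (s i * x i)"
      "q * (y i / x i) / t = q * y i / (t * x i)" "1 / (y i / x i) = x i / y i"
      by (simp_all add: mult.commute)
    show "?g i i * (qtheta q (q * s0 * y i / (s i * x i)) / qtheta q (q * y i / x i)) = diagonal_factor i (y i / x i)"
      using gen[OF i i] unfolding diagonal_factor_def e1 e2 by simp
  next
    fix i j assume i: "i \<in> {1..Suc n}" and j: "j \<in> {i+1..Suc n}"
    hence j': "j \<in> {1..Suc n}" by simp
    note nz = x[OF i] x[OF j'] y[OF i] y[OF j'] t_nonzero q_nonzero
    have u: "ratio (ratios x) i j = x j / x i" using i j by (intro ratio_ratios x) auto
    have e1: "qtheta q (t * x j / y i) = qpoch q (t * x j / y i) * qpoch q (q * y i / (t * x j))"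
      using nz by (simp add: qtheta_def)
    have e2: "qtheta q (x j / y i) = qpoch q (x j / y i) * qpoch q (q * y i / x j)"
      using nz by (simp add: qtheta_def)
    have e3: "q * (x j / x i) / t = q * x j / (t * x i)" "t * (x j / x i) = t * x j / x i"
      "q * (x j / x i * (y j / x j)) = q * y j / x i" "q * y j / x i / t = q * y j / (t * x i)"
      "x j / x i / (y i / x i) = x j / y i" "t * (x j / x i / (y i / x i)) = t * x j / y i"
      "x j / x i * (y j / x j) / (y i / x i) = y j / y i"
      using nz by (simp_all add: field_simps)
    have nz2: "qpoch q (q * y i / x j) \<noteq> 0" "qpoch q (q * y i / (t * x j)) \<noteq> 0"
      using gen[OF i j'] by auto
    show "qpoch q (q * x j / (t * x i)) / qpoch q (t * x j / x i) * (?g i j * ?g j i)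
          * (qtheta q (t * x j / y i) / qtheta q (x j / y i)) * (1 - y j / y i)
       = pair_factor (ratio (ratios x) i j) (y i / x i) (y j / x j)"
      unfolding pair_factor_def u e3 e1 e2 using nz2 by (simp add: mult.assoc)
  qed
  finally show ?thesis .
qed

definition kernel :: "(nat \<Rightarrow> complex) \<Rightarrow> (nat \<Rightarrow> complex) \<Rightarrow> complex" where
  "kernel x y = reduced_kernel (ratios x) (\<lambda>i. y i / x i)"

text \<open>
  The original integrand can differ from the reduced one only where it contains a division by zero,
  and this happens for finitely many values of each \<open>y i\<close>.
\<close>

lemma integral_fun_eq_kernel:
  assumes x: "\<And>i. i \<in> {1..Suc n} \<Longrightarrow> x i \<noteq> 0" and \<rho>: "\<forall>i\<in>{1..Suc n}. \<rho> i > 0"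
  shows "integral_fun (Suc n) q t s0 s F \<rho> x
    = kernel_const (Suc n) q t s0 s * torus_integral (Suc n) \<rho> (\<lambda>y. kernel x y * F y)"
proof -
  let ?B = "\<Prod>i = 1..Suc n. \<Prod>j = i+1..Suc n. qpoch q (q * x j / (t * x i)) / qpoch q (t * x j / x i)"
  let ?K = "\<lambda>y. kernel_Pi (Suc n) q t x y
        * (\<Prod>i = 1..Suc n. qtheta q (q * s0 * y i / (s i * x i)) / qtheta q (q * y i / x i))
        * (\<Prod>i = 1..Suc n. \<Prod>j = i+1..Suc n. qtheta q (t * x j / y i) / qtheta q (x j / y i))
        * (\<Prod>i = 1..Suc n. \<Prod>j = i+1..Suc n. 1 - y j / y i)"
  define bad where "bad i = (\<Union>j\<in>{1..Suc n}. {u. cmod u = \<rho> i \<and> qpoch q ((q / x j) * u) = 0}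
     \<union> {u. cmod u = \<rho> i \<and> qpoch q ((q / (t * x j)) * u) = 0})" for i
  have "?B * torus_integral (Suc n) \<rho> (\<lambda>y. ?K y * F y) = torus_integral (Suc n) \<rho> (\<lambda>y. ?B * (?K y * F y))"
    by (rule torus_integral_cmult[OF \<rho>, symmetric])
  also have "\<dots> = torus_integral (Suc n) \<rho> (\<lambda>y. kernel x y * F y)"
  proof (rule torus_integral_cong_except_finite[OF \<rho>, where B = bad])
    fix i
    show "finite (bad i)"
      unfolding bad_def using x q_less_1 q_nonzero t_nonzero
      by (intro finite_UN_I finite_UnI finite_qpoch_zeros_on_circle) auto
  next
    fix y assume y: "y \<in> torus (Suc n) \<rho>" and nb: "\<forall>i\<in>{1..Suc n}. y i \<notin> bad i"
    have "?B * ?K y = kernel x y"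
      unfolding kernel_def
    proof (rule integrand_eq_reduced_kernel[OF x])
      show "y i \<noteq> 0" if "i \<in> {1..Suc n}" for i using torus_nonzero[OF \<rho> y that] .
      fix i j assume i: "i \<in> {1..Suc n}" and j: "j \<in> {1..Suc n}"
      have "cmod (y i) = \<rho> i" using y i by (simp add: torus_def)
      hence "qpoch q ((q / x j) * y i) \<noteq> 0" "qpoch q ((q / (t * x j)) * y i) \<noteq> 0"
        using nb i j unfolding bad_def by blast+
      thus "qpoch q (q * y i / x j) \<noteq> 0 \<and> qpoch q (q * y i / (t * x j)) \<noteq> 0" by simp
    qed auto
    thus "?B * (?K y * F y) = kernel x y * F y" by (simp only: mult.assoc[symmetric])
  qed
  finally show ?thesis unfolding integral_fun_def by (simp only: mult.assoc)
qed


section \<open>The integral operator on power series\<close>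

text \<open>The integral in the variables \<open>w i = y i / x i\<close>, on the torus of radii \<open>R i = \<rho> i / |x i|\<close>.\<close>

definition ratio_integral :: "(nat \<Rightarrow> real) \<Rightarrow> ((nat \<Rightarrow> nat) \<Rightarrow> complex) \<Rightarrow> (nat \<Rightarrow> complex) \<Rightarrow> complex" where
  "ratio_integral R f z = torus_integral (Suc n) R
     (\<lambda>w. reduced_kernel z w * series (Suc n) f (\<lambda>k. z k * (w (Suc k) / w k)))"

lemma mhol_at_integrand:
  fixes v0 :: "'i::countable \<Rightarrow> complex"
  assumes f: "f \<in> hol_series (Suc n) r" "r > 0" and D: "open D" "v0 \<in> D"
    and Z: "\<And>k v. k \<in> {1..n} \<Longrightarrow> v \<in> D \<Longrightarrow> mhol_at (Z k) v"
      "\<And>k. k \<in> {1..n} \<Longrightarrow> cmod (Z k v0) < cmod (inverse t)"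
    and W: "\<And>i v. i \<in> {1..Suc n} \<Longrightarrow> v \<in> D \<Longrightarrow> mhol_at (W i) v"
      "\<And>i v. i \<in> {1..Suc n} \<Longrightarrow> v \<in> D \<Longrightarrow> W i v \<noteq> 0"
      "\<And>i. i \<in> {1..Suc n} \<Longrightarrow> 1 < cmod (W i v0)" 
      "\<And>i. i \<in> {1..Suc n} \<Longrightarrow> cmod (W i v0) < cmod (t / q)"
    and ZW: "\<And>k. k \<in> {1..n} \<Longrightarrow> cmod (Z k v0 * (W (Suc k) v0 / W k v0)) < r"
  shows "mhol_at (\<lambda>v. reduced_kernel (\<lambda>k. Z k v) (\<lambda>i. W i v)
     * series (Suc n) f (\<lambda>k. Z k v * (W (Suc k) v / W k v))) v0"
proof (rule mhol_at_mult)
  show "mhol_at (\<lambda>v. reduced_kernel (\<lambda>k. Z k v) (\<lambda>i. W i v)) v0"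
    by (rule mhol_at_reduced_kernel) (use D Z W in blast)+
  show "mhol_at (\<lambda>v. series (Suc n) f (\<lambda>k. Z k v * (W (Suc k) v / W k v))) v0"
  proof (rule mhol_at_series[OF f D])
    fix k v assume k: "k \<in> {1..<Suc n}" and v: "v \<in> D"
    hence k': "k \<in> {1..n}" "k \<in> {1..Suc n}" "Suc k \<in> {1..Suc n}" by auto
    show "mhol_at (\<lambda>v. Z k v * (W (Suc k) v / W k v)) v"
      by (rule mhol_at_mult[OF Z(1)[OF k'(1) v] mhol_at_divide[OF W(1)[OF k'(3) v] W(1)[OF k'(2) v] W(2)[OF k'(2) v]]])
  next
    fix k assume "k \<in> {1..<Suc n}"
    thus "cmod (Z k v0 * (W (Suc k) v0 / W k v0)) < r" by (intro ZW) auto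
  qed
qed

lemma open_coordinates_nonzero:
  assumes "finite I"
  shows "open {v :: 'i::countable \<Rightarrow> complex. \<forall>i\<in>I. v (c i) \<noteq> 0}"
proof -
  have "open {v :: 'i \<Rightarrow> complex. v j \<noteq> 0}" for j
    by (rule open_Collect_neq) (auto intro: continuous_on_subset[OF continuous_on_product_coordinates])
  hence "open (\<Inter>i\<in>I. {v :: 'i \<Rightarrow> complex. v (c i) \<noteq> 0})"
    using assms by (intro open_INT) auto
  also have "(\<Inter>i\<in>I. {v :: 'i \<Rightarrow> complex. v (c i) \<noteq> 0}) = {v. \<forall>i\<in>I. v (c i) \<noteq> 0}" by auto
  finally show ?thesis .
qed

lemma continuous_on_case_sum:
  "continuous_on A (\<lambda>p. case_sum (fst p) (snd p) :: 'a + 'b \<Rightarrow> complex)"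
proof (rule continuous_on_coordinatewise_then_product)
  fix i :: "'a + 'b"
  have "continuous_on A (\<lambda>p. fst p j)" "continuous_on A (\<lambda>p. snd p j')" for j j'
    by (rule continuous_on_product_then_coordinatewise, intro continuous_on_fst continuous_on_snd continuous_on_id)+
  thus "continuous_on A (\<lambda>p. case_sum (fst p) (snd p) i)" by (cases i) auto
qed

text \<open>
  A neighbourhood of \<open>z0\<close> on which the integrand is holomorphic in \<open>z\<close> for all \<open>w\<close> on the torus is a
  polydisc with a different radius for each \<open>z k\<close>, as the argument of \<open>f\<close> is \<open>z k * w (k + 1) / w k\<close>.
  For the purpose of joint continuity, \<open>z\<close> and \<open>w\<close> are treated as one point indexed by a sum
  type.
\<close>

lemma ratio_integral_local_series:
  assumes f: "f \<in> hol_series (Suc n) c" and c: "c > 0"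
    and R: "\<And>i. i \<in> {1..Suc n} \<Longrightarrow> 1 < R i" "\<And>i. i \<in> {1..Suc n} \<Longrightarrow> R i < cmod (t / q)"
    and z0: "\<And>k. k \<in> {1..n} \<Longrightarrow> cmod (z0 k) < cmod (inverse t)"
      "\<And>k. k \<in> {1..n} \<Longrightarrow> cmod (z0 k) * (R (Suc k) / R k) < c"
  shows "\<exists>r a. a \<in> power_series (Suc n) \<and> (\<forall>i\<in>{1..n}. cmod (z0 i) < r i) \<and>
      (\<forall>z. (\<forall>i\<in>{1..n}. cmod (z i) < r i) \<longrightarrow>
        ((\<lambda>m. a m * zmonom (Suc n) z m) has_sum ratio_integral R f z) (exponents (Suc n)))"
proof -
  have Rpos: "R i > 0" if "i \<in> {1..Suc n}" for i using R(1)[OF that] by simp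
  have "\<exists>r. cmod (z0 k) < r \<and> r < cmod (inverse t) \<and> r * (R (Suc k) / R k) < c" if k: "k \<in> {1..n}" for k
  proof -
    have "R k > 0" "R (Suc k) > 0" using Rpos k by auto
    hence "cmod (z0 k) < min (cmod (inverse t)) (c / (R (Suc k) / R k))"
      using z0[OF k] by (simp add: field_simps)
    then obtain r where "cmod (z0 k) < r" "r < min (cmod (inverse t)) (c / (R (Suc k) / R k))"
      using dense by blast
    thus ?thesis using \<open>R k > 0\<close> \<open>R (Suc k) > 0\<close> by (intro exI[of _ r]) (simp add: field_simps)
  qed
  then obtain r where r: "\<And>k. k \<in> {1..n} \<Longrightarrow> cmod (z0 k) < r k"
      "\<And>k. k \<in> {1..n} \<Longrightarrow> r k < cmod (inverse t)" "\<And>k. k \<in> {1..n} \<Longrightarrow> r k * (R (Suc k) / R k) < c"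
    by metis
  define D where "D = {v :: nat + nat \<Rightarrow> complex. \<forall>i\<in>{1..Suc n}. v (Inr i) \<noteq> 0}"
  define F where "F v = reduced_kernel (\<lambda>k. v (Inl k)) (\<lambda>i. v (Inr i))
     * series (Suc n) f (\<lambda>k. v (Inl k) * (v (Inr (Suc k)) / v (Inr k)))" for v
  have F: "mhol_at F (case_sum z w)"
    if z: "\<forall>j\<in>{1..n}. cmod (z j) \<le> r j" and w: "w \<in> torus (Suc n) R" for z w
    unfolding F_def
  proof (rule mhol_at_integrand[OF f c, of D])
    show "open D" unfolding D_def by (rule open_coordinates_nonzero) simp
    have wR: "cmod (w i) = R i" if "i \<in> {1..Suc n}" for i using w that by (simp add: torus_def)
    show "case_sum z w \<in> D" using wR Rpos unfolding D_def by fastforce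
    fix i assume i: "i \<in> {1..Suc n}"
    show "1 < cmod (case_sum z w (Inr i))" "cmod (case_sum z w (Inr i)) < cmod (t / q)"
      using R[OF i] wR[OF i] by simp_all
  next
    fix k assume k: "k \<in> {1..n}"
    have wR: "cmod (w k) = R k" "cmod (w (Suc k)) = R (Suc k)" using w k by (auto simp: torus_def)
    have "R k > 0" "R (Suc k) > 0" using Rpos k by auto
    show "cmod (case_sum z w (Inl k)) < cmod (inverse t)"
      using z k r(2)[OF k] by fastforce
    have "cmod (z k) * (R (Suc k) / R k) \<le> r k * (R (Suc k) / R k)"
      using z k \<open>R k > 0\<close> \<open>R (Suc k) > 0\<close> by (intro mult_right_mono) auto
    thus "cmod (case_sum z w (Inl k) * (case_sum z w (Inr (Suc k)) / case_sum z w (Inr k))) < c"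
      using r(3)[OF k] by (simp add: norm_mult norm_divide wR)
  qed (auto simp: D_def intro: mhol_at_coordinate)
  have "\<exists>a\<in>power_series (Suc n). \<forall>z. (\<forall>i\<in>{1..n}. cmod (z i) < r i) \<longrightarrow>
     ((\<lambda>m. a m * zmonom (Suc n) z m) has_sum torus_integral (Suc n) R (\<lambda>w. F (case_sum z w))) (exponents (Suc n))"
  proof (rule torus_integral_power_series)
    show "\<forall>i\<in>{1..n}. r i > 0" using r(1) by (meson norm_ge_zero order_le_less_trans)
    show "\<forall>i\<in>{1..Suc n}. R i > 0" using Rpos by blast
    have "continuous_on ((\<lambda>p. case_sum (fst p) (snd p)) ` (torus n r \<times> torus (Suc n) R)) F"
      by (rule mhol_at_imp_continuous_on) (auto simp: torus_def[of n] intro!: F)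
    hence "continuous_on (torus n r \<times> torus (Suc n) R) (\<lambda>p. F (case_sum (fst p) (snd p)))"
      by (rule continuous_on_compose2[OF _ continuous_on_case_sum]) auto
    thus "continuous_on (torus n r \<times> torus (Suc n) R) (\<lambda>(z, w). F (case_sum z w))"
      by (simp add: case_prod_unfold)
  next
    fix z w i assume "w \<in> torus (Suc n) R" "\<forall>j\<in>{1..n}. cmod (z j) \<le> r j"
    from mhol_at_slice[OF F[OF this(2,1)], of "Inl i"]
    have "(\<lambda>u. F ((case_sum z w)(Inl i := u))) field_differentiable (at (z i))" by simp
    moreover have "(case_sum z w)(Inl i := u) = case_sum (z(i := u)) w" for u
      by (auto simp: fun_eq_iff split: sum.split)
    ultimately show "(\<lambda>u. F (case_sum (z(i := u)) w)) field_differentiable (at (z i))" by simp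
  next
    fix z z' w :: "nat \<Rightarrow> complex" assume eq: "\<And>i. i \<in> {1..n} \<Longrightarrow> z i = z' i"
    have "reduced_kernel z w = reduced_kernel z' w" by (rule reduced_kernel_cong[OF eq]) auto
    moreover have "series (Suc n) f (\<lambda>k. z k * (w (Suc k) / w k)) = series (Suc n) f (\<lambda>k. z' k * (w (Suc k) / w k))"
      by (rule series_cong) (simp add: eq)
    ultimately show "F (case_sum z w) = F (case_sum z' w)" by (simp add: F_def)
  qed
  moreover have "torus_integral (Suc n) R (\<lambda>w. F (case_sum z w)) = ratio_integral R f z" for z
    by (simp only: F_def ratio_integral_def sum.case)
  ultimately show ?thesis using r(1) by (simp only: Bex_def) blast
qed

text \<open>
  For small \<open>z\<close> the integrand is holomorphic in \<open>w\<close> on the product of the annuli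
  \<open>1 < |w i| < |t / q|\<close>, so the radii do not matter.
\<close>

lemma ratio_integral_radii_eq:
  assumes f: "f \<in> hol_series (Suc n) c" and c: "c > 0"
    and R: "\<And>i. i \<in> {1..Suc n} \<Longrightarrow> 1 < R i \<and> R i < cmod (t / q)"
    and R': "\<And>i. i \<in> {1..Suc n} \<Longrightarrow> 1 < R' i \<and> R' i < cmod (t / q)"
    and z: "\<And>k. k \<in> {1..n} \<Longrightarrow> cmod (z k) < cmod (inverse t)"
      "\<And>k. k \<in> {1..n} \<Longrightarrow> cmod (z k) < c * cmod (q / t)"
  shows "ratio_integral R f z = ratio_integral R' f z"
  unfolding ratio_integral_def
proof (rule torus_integral_radii_eq[where a = "\<lambda>_. 1" and b = "\<lambda>_. cmod (t / q)"])
  fix w :: "nat \<Rightarrow> complex" assume w: "\<And>i. i \<in> {1..Suc n} \<Longrightarrow> 1 < cmod (w i) \<and> cmod (w i) < cmod (t / q)"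
  show "mhol_at (\<lambda>w. reduced_kernel z w * series (Suc n) f (\<lambda>k. z k * (w (Suc k) / w k))) w"
  proof (rule mhol_at_integrand[OF f c, of "{v. \<forall>i\<in>{1..Suc n}. v i \<noteq> 0}"])
    show "open {v :: nat \<Rightarrow> complex. \<forall>i\<in>{1..Suc n}. v i \<noteq> 0}"
      by (rule open_coordinates_nonzero) simp
    show "w \<in> {v. \<forall>i\<in>{1..Suc n}. v i \<noteq> 0}" using w by fastforce
    fix k assume k: "k \<in> {1..n}"
    hence wk: "1 < cmod (w k)" "cmod (w (Suc k)) < cmod (t / q)" using w[of k] w[of "Suc k"] by auto
    have "cmod (w (Suc k)) / cmod (w k) \<le> cmod (t / q) / 1"
      using wk by (intro frac_le) auto
    hence "cmod (z k) * (cmod (w (Suc k)) / cmod (w k)) \<le> cmod (z k) * cmod (t / q)"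
      by (intro mult_left_mono) auto
    also have "\<dots> < c"
      using z(2)[OF k] cmod_q_pos cmod_t_pos by (simp add: norm_divide field_simps)
    finally show "cmod (z k * (w (Suc k) / w k)) < c" by (simp add: norm_mult norm_divide)
  qed (use w z in \<open>auto intro: mhol_at_coordinate mhol_at_const\<close>)
qed (use R R' in auto)

text \<open>
  Any number between \<open>1 / |q|\<close> and \<open>|t|\<close> would serve. With the same ratio \<open>|y i / x i|\<close> for all \<open>i\<close>, the
  contour is admissible as soon as the ratios of the \<open>x i\<close> are smaller than \<open>|q / t|\<close>.
\<close>

definition contour_ratio :: real where
  "contour_ratio = (inverse (cmod q) + cmod t) / 2"

lemma contour_ratio: "inverse (cmod q) < contour_ratio" "contour_ratio < cmod t"
proof -
  have "inverse (cmod q) < cmod t" using one_less_qt cmod_q_pos by (simp add: field_simps)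
  thus "inverse (cmod q) < contour_ratio" "contour_ratio < cmod t" by (simp_all add: contour_ratio_def)
qed

lemma contour_ratio': "1 < contour_ratio" "contour_ratio < cmod (t / q)" "contour_ratio > 0"
proof -
  have "1 < inverse (cmod q)" using q_less_1 cmod_q_pos by (simp add: one_less_inverse)
  thus "1 < contour_ratio" "contour_ratio > 0" using contour_ratio by linarith+
  have "cmod t * cmod q \<le> cmod t * 1" using q_less_1 by (intro mult_left_mono) auto
  hence "cmod t \<le> cmod (t / q)" using cmod_q_pos by (simp add: norm_divide field_simps)
  thus "contour_ratio < cmod (t / q)" using contour_ratio by linarith
qed

definition contour :: "(nat \<Rightarrow> complex) \<Rightarrow> nat \<Rightarrow> real" where
  "contour u i = cmod (u i) * contour_ratio"

lemma torus_integral_kernel_eq_ratio_integral: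
  assumes f: "f \<in> hol_series (Suc n) c" "c > 0" and x: "\<And>i. i \<in> {1..Suc n} \<Longrightarrow> x i \<noteq> 0"
    and R: "\<And>i. i \<in> {1..Suc n} \<Longrightarrow> 1 < R i \<and> R i < cmod (t / q)"
    and z: "\<And>k. k \<in> {1..n} \<Longrightarrow> cmod (ratios x k) < cmod (inverse t)"
      "\<And>k. k \<in> {1..n} \<Longrightarrow> cmod (ratios x k) * (R (Suc k) / R k) < c"
  shows "torus_integral (Suc n) (\<lambda>i. cmod (x i) * R i) (\<lambda>y. kernel x y * series_fun (Suc n) f y)
    = ratio_integral R f (ratios x)"
proof -
  have pos: "\<forall>i\<in>{1..Suc n}. R i > 0" using R by fastforce
  define G where "G y = kernel x y * series (Suc n) f (\<lambda>k. ratios x k * ((y (Suc k) / x (Suc k)) / (y k / x k)))" for y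
  have "torus_integral (Suc n) (\<lambda>i. cmod (x i) * R i) (\<lambda>y. kernel x y * series_fun (Suc n) f y)
    = torus_integral (Suc n) (\<lambda>i. cmod (x i) * R i) G"
  proof (rule torus_integral_cong)
    fix y
    have "series (Suc n) f (ratios y) = series (Suc n) f (\<lambda>k. ratios x k * ((y (Suc k) / x (Suc k)) / (y k / x k)))"
    proof (rule series_cong)
      fix k assume "k \<in> {1..<Suc n}"
      hence "x k \<noteq> 0" "x (Suc k) \<noteq> 0" using x by auto
      thus "ratios y k = ratios x k * ((y (Suc k) / x (Suc k)) / (y k / x k))"
        by (simp add: ratios_def)
    qed
    thus "kernel x y * series_fun (Suc n) f y = G y" by (simp add: G_def series_fun_eq)
  qed (use pos x in auto)
  also have "\<dots> = torus_integral (Suc n) R (\<lambda>w. G (\<lambda>i. x i * w i))"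
  proof (rule torus_integral_scale[OF pos])
    show "continuous_on (torus (Suc n) (\<lambda>i. cmod (x i) * R i)) G"
      unfolding G_def kernel_def
    proof (rule mhol_at_imp_continuous_on, rule mhol_at_integrand[OF f, of "{v. \<forall>i\<in>{1..Suc n}. v i \<noteq> 0}"])
      fix y assume y: "y \<in> torus (Suc n) (\<lambda>i. cmod (x i) * R i)"
      have yR: "cmod (y i / x i) = R i" if "i \<in> {1..Suc n}" for i
        using y that x[OF that] by (simp add: torus_def norm_divide)
      show "open {v :: nat \<Rightarrow> complex. \<forall>i\<in>{1..Suc n}. v i \<noteq> 0}"
        by (rule open_coordinates_nonzero) simp
      show "y \<in> {v. \<forall>i\<in>{1..Suc n}. v i \<noteq> 0}" using yR pos by fastforce
      show "1 < cmod (y i / x i)" "cmod (y i / x i) < cmod (t / q)" if "i \<in> {1..Suc n}" for i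
        using yR[OF that] R[OF that] by simp_all
      show "cmod (ratios x k * ((y (Suc k) / x (Suc k)) / (y k / x k))) < c" if k: "k \<in> {1..n}" for k
      proof -
        have "k \<in> {1..Suc n}" "Suc k \<in> {1..Suc n}" using k by auto
        thus ?thesis unfolding norm_mult norm_divide[of "y (Suc k) / x (Suc k)"] using yR z(2)[OF k] by metis
      qed
      show "cmod (ratios x k) < cmod (inverse t)" if "k \<in> {1..n}" for k using z(1)[OF that] .
      show "mhol_at (\<lambda>v. v i / x i) v" if "i \<in> {1..Suc n}" for i and v :: "nat \<Rightarrow> complex"
        by (intro mhol_at_divide mhol_at_coordinate mhol_at_const x that)
    qed (auto intro: mhol_at_const simp: x)
  qed (use x in auto)
  also have "\<dots> = ratio_integral R f (ratios x)"
    unfolding ratio_integral_def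
  proof (rule torus_integral_cong[OF pos])
    fix w
    have "kernel x (\<lambda>i. x i * w i) = reduced_kernel (ratios x) w"
      unfolding kernel_def by (rule reduced_kernel_cong) (use x in auto)
    moreover have "series (Suc n) f (\<lambda>k. ratios x k * ((x (Suc k) * w (Suc k) / x (Suc k)) / (x k * w k / x k)))
        = series (Suc n) f (\<lambda>k. ratios x k * (w (Suc k) / w k))"
      by (rule series_cong) (use x in auto)
    ultimately show "G (\<lambda>i. x i * w i) = reduced_kernel (ratios x) w * series (Suc n) f (\<lambda>k. ratios x k * (w (Suc k) / w k))"
      by (simp only: G_def)
  qed
  finally show ?thesis .
qed

lemma cmod_q_div_t: "0 < cmod (q / t)" "cmod (q / t) < cmod (inverse t)" "cmod (q / t) < 1"
proof -
  show "0 < cmod (q / t)" using cmod_q_pos cmod_t_pos by (simp add: norm_divide)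
  show lt: "cmod (q / t) < cmod (inverse t)"
    using q_less_1 cmod_t_pos by (simp add: norm_divide norm_inverse field_simps)
  show "cmod (q / t) < 1" using lt inverse_t_le_1 by linarith
qed

text \<open>
  Existence holds for a larger class of series than in the theorem: on an admissible contour
  \<open>|y (k + 1) / y k| < |q / t|\<close>, so convergence of \<open>f\<close> for ratios below \<open>|q / t|\<close> is enough. This is used
  for the image of \<open>f\<close> under the Macdonald operator. An admissible contour gives radii \<open>R\<close> for \<open>w\<close> and
  a local expansion at \<open>ratios x\<close>; the set \<open>P\<close> in the proof collects all such pairs.
\<close>

lemma integral_graph_properties:
  assumes f: "f \<in> hol_series (Suc n) (cmod (q / t))"
  obtains g where "integral_graph (Suc n) q t s0 s f g"
    "\<And>g'. integral_graph (Suc n) q t s0 s f g' \<Longrightarrow> g' = g"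
    "g \<in> hol_series (Suc n) (cmod (q / t))"
    "\<And>x. x \<in> ratio_domain (Suc n) (cmod (q / t)) \<Longrightarrow> ((\<lambda>m. g m * zmonom (Suc n) (ratios x) m) has_sum
       kernel_const (Suc n) q t s0 s * torus_integral (Suc n) (contour x)
         (\<lambda>y. kernel x y * series_fun (Suc n) f y)) (exponents (Suc n))"
proof -
  define C where "C = kernel_const (Suc n) q t s0 s"
  let ?c = "cmod (q / t)"
  define P where "P = {(R, z). (\<forall>i\<in>{1..Suc n}. 1 < R i \<and> R i < cmod (t / q)) \<and>
     (\<forall>k\<in>{1..n}. cmod (z k) < cmod (inverse t) \<and> cmod (z k) * (R (Suc k) / R k) < ?c)}"
  have P0: "((\<lambda>_. contour_ratio), z) \<in> P" if "\<And>k. k \<in> {1..n} \<Longrightarrow> cmod (z k) < ?c" for z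
    using that contour_ratio' cmod_q_div_t by (force simp: P_def)
  obtain a where a: "a \<in> power_series (Suc n)"
    "\<And>p. p \<in> P \<Longrightarrow> ((\<lambda>m. a m * zmonom (Suc n) (snd p) m) has_sum ratio_integral (fst p) f (snd p)) (exponents (Suc n))"
  proof (rule power_series_glue[where P = P and \<zeta> = snd and G = "\<lambda>p. ratio_integral (fst p) f" and n = n])
    show "P \<noteq> {}" using P0[of "\<lambda>_. 0"] cmod_q_div_t by auto
  next
    fix p assume "p \<in> P"
    thus "\<exists>r a. a \<in> power_series (Suc n) \<and> (\<forall>i\<in>{1..n}. cmod (snd p i) < r i) \<and>
        (\<forall>z. (\<forall>i\<in>{1..n}. cmod (z i) < r i) \<longrightarrow>
          ((\<lambda>m. a m * zmonom (Suc n) z m) has_sum ratio_integral (fst p) f z) (exponents (Suc n)))"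
      using cmod_q_div_t unfolding P_def by (intro ratio_integral_local_series[OF f]) auto
  next
    fix p p' assume p: "p \<in> P" "p' \<in> P"
    define e where "e = min (cmod (inverse t)) (?c * ?c)"
    have "ratio_integral (fst p) f z = ratio_integral (fst p') f z" if "\<forall>i\<in>{1..n}. cmod (z i) < e" for z
      using p that cmod_q_div_t unfolding P_def e_def by (intro ratio_integral_radii_eq[OF f]) auto
    moreover have "e > 0" using cmod_q_div_t t_nonzero q_nonzero unfolding e_def by simp
    ultimately show "\<exists>e>0. \<forall>z. (\<forall>i\<in>{1..n}. cmod (z i) < e) \<longrightarrow> ratio_integral (fst p) f z = ratio_integral (fst p') f z"
      by blast
  qed blast
  define g where "g m = C * a m" for m
  have g_ps: "g \<in> power_series (Suc n)" using a(1) by (simp add: g_def power_series_def)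
  have g_sum: "((\<lambda>m. g m * zmonom (Suc n) z m) has_sum C * ratio_integral R f z) (exponents (Suc n))"
    if "(R, z) \<in> P" for R z
    using has_sum_cmult_right[OF a(2)[OF that], of C] by (simp add: g_def mult.assoc)
  have adm: "integral_fun (Suc n) q t s0 s (series_fun (Suc n) f) \<rho> x
       = C * ratio_integral (\<lambda>i. \<rho> i / cmod (x i)) f (ratios x)"
    and adm_P: "((\<lambda>i. \<rho> i / cmod (x i)), ratios x) \<in> P"
    if x: "x \<in> ratio_domain (Suc n) (cmod (inverse t))" and \<rho>: "admissible_contour (Suc n) q t x \<rho>" for x \<rho>
  proof -
    have x0: "x i \<noteq> 0" if "i \<in> {1..Suc n}" for i using x that by (simp add: ratio_domain_def)
    have pos: "\<rho> i > 0" if "i \<in> {1..Suc n}" for i using \<rho> that by (simp add: admissible_contour_def)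
    have R: "1 < \<rho> i / cmod (x i) \<and> \<rho> i / cmod (x i) < cmod (t / q)" if i: "i \<in> {1..Suc n}" for i
    proof -
      have "cmod (inverse t) < cmod (x i) / \<rho> i" "cmod (x i) / \<rho> i < cmod q"
        using \<rho> i by (auto simp: admissible_contour_def)
      hence "\<rho> i < cmod t * cmod (x i)" "cmod (x i) < cmod q * \<rho> i"
        using pos[OF i] cmod_t_pos by (simp_all add: norm_inverse norm_divide field_simps)
      moreover have "cmod q * \<rho> i < 1 * \<rho> i" using pos[OF i] q_less_1 by (intro mult_strict_right_mono) auto
      moreover have "cmod q * \<rho> i < cmod t * cmod (x i)" using calculation by linarith
      ultimately show ?thesis
        using x0[OF i] cmod_q_pos by (simp add: norm_divide field_simps)
    qed
    have z1: "cmod (ratios x k) < cmod (inverse t)" if "k \<in> {1..n}" for k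
      using x that by (auto simp: ratio_domain_def ratios_def)
    have z2: "cmod (ratios x k) * (\<rho> (Suc k) / cmod (x (Suc k)) / (\<rho> k / cmod (x k))) < ?c" if k: "k \<in> {1..n}" for k
    proof -
      have nz: "x k \<noteq> 0" "x (Suc k) \<noteq> 0" "\<rho> k > 0" "\<rho> (Suc k) > 0" using x0 pos k by auto
      have "\<rho> (k + 1) / (cmod q * \<rho> k) < cmod (inverse t)"
        using \<rho> k by (auto simp: admissible_contour_def)
      hence "\<rho> (Suc k) / \<rho> k < ?c"
        using nz cmod_q_pos cmod_t_pos by (simp add: norm_inverse norm_divide field_simps)
      moreover have "cmod (ratios x k) * (\<rho> (Suc k) / cmod (x (Suc k)) / (\<rho> k / cmod (x k))) = \<rho> (Suc k) / \<rho> k"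
        using nz by (simp add: ratios_def norm_divide)
      ultimately show ?thesis by simp
    qed
    show "((\<lambda>i. \<rho> i / cmod (x i)), ratios x) \<in> P"
      using R z1 z2 unfolding P_def by blast
    have "integral_fun (Suc n) q t s0 s (series_fun (Suc n) f) \<rho> x
       = C * torus_integral (Suc n) \<rho> (\<lambda>y. kernel x y * series_fun (Suc n) f y)"
      unfolding C_def using pos by (intro integral_fun_eq_kernel x0) auto
    also have "torus_integral (Suc n) \<rho> (\<lambda>y. kernel x y * series_fun (Suc n) f y)
       = torus_integral (Suc n) (\<lambda>i. cmod (x i) * (\<rho> i / cmod (x i))) (\<lambda>y. kernel x y * series_fun (Suc n) f y)"
      by (rule torus_integral_radii_cong) (use x0 in auto)
    also have "\<dots> = ratio_integral (\<lambda>i. \<rho> i / cmod (x i)) f (ratios x)"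
      by (intro torus_integral_kernel_eq_ratio_integral[OF f cmod_q_div_t(1)] x0 R z1 z2)
    finally show "integral_fun (Suc n) q t s0 s (series_fun (Suc n) f) \<rho> x
       = C * ratio_integral (\<lambda>i. \<rho> i / cmod (x i)) f (ratios x)" .
  qed
  have graph: "integral_graph (Suc n) q t s0 s f g"
    unfolding integral_graph_def
    using g_ps g_sum adm adm_P by auto
  have small: "x \<in> ratio_domain (Suc n) (cmod (inverse t))"
    "admissible_contour (Suc n) q t x (\<lambda>i. cmod (x i) * contour_ratio)"
    if x: "x \<in> ratio_domain (Suc n) ?c" for x
  proof -
    show "x \<in> ratio_domain (Suc n) (cmod (inverse t))"
      using x cmod_q_div_t(2) by (force simp: ratio_domain_def)
    have x0: "x i \<noteq> 0" if "i \<in> {1..Suc n}" for i using x that by (simp add: ratio_domain_def)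
    show "admissible_contour (Suc n) q t x (\<lambda>i. cmod (x i) * contour_ratio)"
      unfolding admissible_contour_def
    proof (intro conjI ballI)
      fix i assume i: "i \<in> {1..Suc n}"
      show "0 < cmod (x i) * contour_ratio" using x0[OF i] contour_ratio'(3) by simp
      show "cmod (inverse t) < cmod (x i) / (cmod (x i) * contour_ratio)"
        using x0[OF i] contour_ratio contour_ratio'(3) cmod_t_pos by (simp add: norm_inverse norm_divide field_simps)
      show "cmod (x i) / (cmod (x i) * contour_ratio) < cmod q"
        using x0[OF i] contour_ratio contour_ratio'(3) cmod_q_pos by (simp add: field_simps)
    next
      fix k assume k: "k \<in> {1..<Suc n}"
      have "cmod (x (k + 1)) / cmod (x k) < cmod q / cmod t" "x k \<noteq> 0"
        using x k by (auto simp: ratio_domain_def norm_divide)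
      thus "cmod (x (k + 1)) * contour_ratio / (cmod q * (cmod (x k) * contour_ratio)) < cmod (inverse t)"
        using contour_ratio'(3) cmod_q_pos cmod_t_pos by (simp add: norm_inverse norm_divide field_simps)
    qed
  qed
  show ?thesis
  proof (rule that[OF graph])
    fix g' assume g': "integral_graph (Suc n) q t s0 s f g'"
    show "g' = g"
    proof (rule power_series_unique[OF _ g_ps cmod_q_div_t(1)])
      show "g' \<in> power_series (Suc n)" using g' by (simp add: integral_graph_def)
      fix z assume z: "\<And>i. i \<in> {1..n} \<Longrightarrow> z i \<noteq> 0 \<and> cmod (z i) < ?c"
      obtain x where x: "\<And>i. i \<in> {1..Suc n} \<Longrightarrow> x i \<noteq> 0" "\<And>i. i \<in> {1..n} \<Longrightarrow> ratios x i = z i"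
        using ratios_surj[of n z] z by metis
      have "x \<in> ratio_domain (Suc n) ?c"
        using x z unfolding ratio_domain_def ratios_def by auto
      note sm = small[OF this]
      have "zmonom (Suc n) z m = zmonom (Suc n) (ratios x) m" for m
        by (rule zmonom_cong) (simp add: x)
      thus "\<exists>S. ((\<lambda>m. g' m * zmonom (Suc n) z m) has_sum S) (exponents (Suc n)) \<and>
          ((\<lambda>m. g m * zmonom (Suc n) z m) has_sum S) (exponents (Suc n))"
        using g' graph sm unfolding integral_graph_def by (simp only:) blast
    qed
  next
    show "g \<in> hol_series (Suc n) ?c"
    proof (rule hol_seriesI[OF g_ps])
      fix z assume "\<And>i. i \<in> {1..n} \<Longrightarrow> z i \<noteq> 0 \<and> cmod (z i) < ?c"
      hence "((\<lambda>_. contour_ratio), z) \<in> P" by (intro P0) auto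
      thus "(\<lambda>m. g m * zmonom (Suc n) z m) summable_on exponents (Suc n)"
        using g_sum has_sum_imp_summable by blast
    qed (use cmod_q_div_t in auto)
  next
    fix x assume x: "x \<in> ratio_domain (Suc n) ?c"
    have x0: "x i \<noteq> 0" if "i \<in> {1..Suc n}" for i using x that by (simp add: ratio_domain_def)
    have "((\<lambda>m. g m * zmonom (Suc n) (ratios x) m) has_sum
       integral_fun (Suc n) q t s0 s (series_fun (Suc n) f) (\<lambda>i. cmod (x i) * contour_ratio) x) (exponents (Suc n))"
      using graph small[OF x] unfolding integral_graph_def by blast
    moreover have "integral_fun (Suc n) q t s0 s (series_fun (Suc n) f) (\<lambda>i. cmod (x i) * contour_ratio) x
        = kernel_const (Suc n) q t s0 s * torus_integral (Suc n) (\<lambda>i. cmod (x i) * contour_ratio)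
         (\<lambda>y. kernel x y * series_fun (Suc n) f y)"
      using x0 contour_ratio'(3) by (intro integral_fun_eq_kernel x0) auto
    ultimately show "((\<lambda>m. g m * zmonom (Suc n) (ratios x) m) has_sum
       kernel_const (Suc n) q t s0 s * torus_integral (Suc n) (contour x)
         (\<lambda>y. kernel x y * series_fun (Suc n) f y)) (exponents (Suc n))"
      by (simp add: contour_def[abs_def])
  qed
qed


section \<open>The Macdonald operator on power series\<close>

text \<open>\<open>U i j\<close> stands for \<open>x j / x i\<close>.\<close>

definition macdonald_coeff :: "(nat \<Rightarrow> nat \<Rightarrow> complex) \<Rightarrow> nat \<Rightarrow> complex" where
  "macdonald_coeff U k = (\<Prod>l = 1..<k. (1 - q / t * U l k) / (1 - U l k))
     * (\<Prod>l = k+1..Suc n. (1 - U k l / (q / t)) / (1 - U k l))"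

lemma macdonald_coeff_cong:
  assumes "\<And>i j. 1 \<le> i \<Longrightarrow> i < j \<Longrightarrow> j \<le> Suc n \<Longrightarrow> U i j = U' i j" "k \<in> {1..Suc n}"
  shows "macdonald_coeff U k = macdonald_coeff U' k"
  unfolding macdonald_coeff_def using assms by (intro arg_cong2[where f = "(*)"] prod.cong refl) auto

lemma mhol_at_macdonald_coeff:
  assumes "\<And>i j. 1 \<le> i \<Longrightarrow> i < j \<Longrightarrow> j \<le> Suc n \<Longrightarrow> mhol_at (U i j) v"
    and "\<And>i j. 1 \<le> i \<Longrightarrow> i < j \<Longrightarrow> j \<le> Suc n \<Longrightarrow> U i j v \<noteq> 1" and "k \<in> {1..Suc n}"
  shows "mhol_at (\<lambda>v. macdonald_coeff (\<lambda>i j. U i j v) k) v"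
proof -
  have "mhol_at (U l k) v" "1 - U l k v \<noteq> 0" if "l \<in> {1..<k}" for l
    using assms(1)[of l k] assms(2)[of l k] assms(3) that by auto
  moreover have "mhol_at (U k l) v" "1 - U k l v \<noteq> 0" if "l \<in> {k+1..Suc n}" for l
    using assms(1)[of k l] assms(2)[of k l] assms(3) that by auto
  ultimately show ?thesis
    unfolding macdonald_coeff_def using q_nonzero t_nonzero
    by (intro mhol_at_mult mhol_at_prod mhol_at_divide mhol_at_diff mhol_at_const) auto
qed

definition q_shift :: "nat \<Rightarrow> (nat \<Rightarrow> complex) \<Rightarrow> nat \<Rightarrow> complex" where
  "q_shift k x = x(k := q * x k)"

text \<open>
  The effect of \<open>q_shift k\<close> on the ratios: \<open>x k\<close> is the denominator of the ratio with index \<open>k\<close> and the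
  numerator of the one before.
\<close>

definition ratio_shift :: "nat \<Rightarrow> (nat \<Rightarrow> complex) \<Rightarrow> nat \<Rightarrow> complex" where
  "ratio_shift k z = (\<lambda>i. (if i = k then 1 / q else if Suc i = k then q else 1) * z i)"

lemma ratios_q_shift: "x i \<noteq> 0 \<Longrightarrow> ratios (q_shift k x) i = ratio_shift k (ratios x) i"
  using q_nonzero by (auto simp: ratios_def ratio_shift_def q_shift_def)

lemma macdonald_fun_eq:
  "macdonald_fun (Suc n) q (q / t) s F x
    = (\<Sum>k = 1..Suc n. s k * (macdonald_coeff (\<lambda>i j. x j / x i) k * F (q_shift k x)))"
  unfolding macdonald_fun_def macdonald_coeff_def q_shift_def
  by (intro sum.cong refl) (simp add: mult_ac)

definition ratio_macdonald :: "((nat \<Rightarrow> nat) \<Rightarrow> complex) \<Rightarrow> (nat \<Rightarrow> complex) \<Rightarrow> complex" where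
  "ratio_macdonald f z = (\<Sum>k = 1..Suc n. s k * (macdonald_coeff (ratio z) k * series (Suc n) f (ratio_shift k z)))"

lemma macdonald_fun_eq_ratio_macdonald:
  assumes x: "\<And>i. i \<in> {1..Suc n} \<Longrightarrow> x i \<noteq> 0"
  shows "macdonald_fun (Suc n) q (q / t) s (series_fun (Suc n) f) x = ratio_macdonald f (ratios x)"
  unfolding macdonald_fun_eq ratio_macdonald_def
proof (intro sum.cong refl arg_cong2[where f = "(*)"])
  fix k assume k: "k \<in> {1..Suc n}"
  show "macdonald_coeff (\<lambda>i j. x j / x i) k = macdonald_coeff (ratio (ratios x)) k"
    by (intro macdonald_coeff_cong k ratio_ratios[OF x, symmetric]) auto
  show "series_fun (Suc n) f (q_shift k x) = series (Suc n) f (ratio_shift k (ratios x))"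
    unfolding series_fun_eq by (intro series_cong ratios_q_shift x) auto
qed

lemma cmod_ratio_shift_le: "cmod (ratio_shift k z i) \<le> cmod (z i) / cmod q"
proof -
  have "cmod (if i = k then 1 / q else if Suc i = k then q else 1) \<le> 1 / cmod q"
    using q_less_1 cmod_q_pos mult_le_one[of "cmod q" "cmod q"]
    by (auto simp: norm_divide field_simps less_imp_le)
  hence "cmod (if i = k then 1 / q else if Suc i = k then q else 1) * cmod (z i) \<le> 1 / cmod q * cmod (z i)"
    by (intro mult_right_mono) auto
  thus ?thesis by (simp add: ratio_shift_def norm_mult)
qed

lemma mhol_at_ratio_macdonald:
  assumes f: "f \<in> hol_series (Suc n) r" and r: "0 < r" "r \<le> 1"
    and z: "\<And>i. i \<in> {1..n} \<Longrightarrow> cmod (z i) < cmod q * r"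
  shows "mhol_at (ratio_macdonald f) z"
proof -
  have "cmod q * r \<le> 1 * 1" using r q_less_1 by (intro mult_mono) auto
  hence "cmod (ratio z i j) < 1" if "1 \<le> i" "i < j" "j \<le> Suc n" for i j
    using ratio_less[of z "cmod q * r" i j] z that by auto
  hence ne1: "ratio z i j \<noteq> 1" if "1 \<le> i" "i < j" "j \<le> Suc n" for i j using that by force
  have "mhol_at (\<lambda>z. macdonald_coeff (\<lambda>i j. ratio z i j) k) z" if "k \<in> {1..Suc n}" for k
    by (intro mhol_at_macdonald_coeff mhol_at_ratio[where Z = "\<lambda>k z. z k"] mhol_at_coordinate ne1 that)
  moreover have "mhol_at (\<lambda>z. series (Suc n) f (\<lambda>i. ratio_shift k z i)) z" for k
  proof (rule mhol_at_series[OF f r(1) open_UNIV UNIV_I])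
    fix i assume i: "i \<in> {1..<Suc n}"
    show "mhol_at (\<lambda>z. ratio_shift k z i) z" for z
      unfolding ratio_shift_def by (intro mhol_at_mult mhol_at_const mhol_at_coordinate)
    have "cmod (z i) / cmod q < r"
      using z[of i] i cmod_q_pos by (simp add: divide_less_eq mult.commute)
    thus "cmod (ratio_shift k z i) < r" using cmod_ratio_shift_le[of k z i] by linarith
  qed
  ultimately show ?thesis
    unfolding ratio_macdonald_def[abs_def]
    by (intro mhol_at_sum mhol_at_mult mhol_at_const) auto
qed

lemma ratio_macdonald_cong:
  assumes "\<And>i. i \<in> {1..n} \<Longrightarrow> z i = z' i"
  shows "ratio_macdonald f z = ratio_macdonald f z'"
  unfolding ratio_macdonald_def
proof (intro sum.cong refl arg_cong2[where f = "(*)"])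
  fix k assume k: "k \<in> {1..Suc n}"
  show "macdonald_coeff (ratio z) k = macdonald_coeff (ratio z') k"
    by (intro macdonald_coeff_cong k ratio_cong assms) auto
  show "series (Suc n) f (ratio_shift k z) = series (Suc n) f (ratio_shift k z')"
    by (rule series_cong) (simp add: ratio_shift_def assms)
qed

text \<open>
  A ratio is divided by \<open>q\<close> by one of the shifts, which is why the radius of convergence may drop from
  \<open>r\<close> to \<open>|q| r\<close>. The coefficients are holomorphic there, since \<open>x j / x i\<close> cannot be \<open>1\<close>.
\<close>

lemma macdonald_graph_properties:
  assumes f: "f \<in> hol_series (Suc n) r" and r: "0 < r" "r \<le> 1"
  obtains g where "macdonald_graph (Suc n) q (q / t) s f g"
    "\<And>g'. macdonald_graph (Suc n) q (q / t) s f g' \<Longrightarrow> g' = g"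
    "g \<in> hol_series (Suc n) (cmod q * r)"
    "\<And>x. x \<in> ratio_domain (Suc n) (cmod q * r) \<Longrightarrow>
       series_fun (Suc n) g x = macdonald_fun (Suc n) q (q / t) s (series_fun (Suc n) f) x"
proof -
  define c where "c = cmod q * r"
  have c: "c > 0" using r cmod_q_pos by (simp add: c_def)
  define P where "P = {z :: nat \<Rightarrow> complex. \<forall>i\<in>{1..n}. cmod (z i) < c}"
  obtain g where g: "g \<in> power_series (Suc n)"
    "\<And>z. z \<in> P \<Longrightarrow> ((\<lambda>m. g m * zmonom (Suc n) z m) has_sum ratio_macdonald f z) (exponents (Suc n))"
  proof (rule power_series_glue[where P = P and \<zeta> = "\<lambda>z. z" and G = "\<lambda>_. ratio_macdonald f" and n = n])
    have "(\<lambda>_. 0) \<in> P" using c by (simp add: P_def)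
    thus "P \<noteq> {}" by blast
  next
    fix z assume "z \<in> P"
    hence "\<And>i. i \<in> {1..n} \<Longrightarrow> cmod (z i) < c" by (simp add: P_def)
    then obtain c' where c': "0 < c'" "c' < c" "\<And>i. i \<in> {1..n} \<Longrightarrow> cmod (z i) < c'"
      using Max_cmod_less[of "{1..n}" z c] c by blast
    have "\<exists>a\<in>power_series (Suc n). \<forall>z. (\<forall>i\<in>{1..n}. cmod (z i) < c') \<longrightarrow>
       ((\<lambda>m. a m * zmonom (Suc n) z m) has_sum ratio_macdonald f z) (exponents (Suc n))"
    proof (rule holomorphic_has_power_series)
      fix z assume "\<forall>j\<in>{1..n}. cmod (z j) \<le> c'"
      thus "mhol_at (ratio_macdonald f) z"
        using c'(2) unfolding c_def by (intro mhol_at_ratio_macdonald[OF f r]) fastforce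
    qed (use c' ratio_macdonald_cong in blast)+
    thus "\<exists>r a. a \<in> power_series (Suc n) \<and> (\<forall>i\<in>{1..n}. cmod (z i) < r i) \<and>
        (\<forall>z. (\<forall>i\<in>{1..n}. cmod (z i) < r i) \<longrightarrow>
          ((\<lambda>m. a m * zmonom (Suc n) z m) has_sum ratio_macdonald f z) (exponents (Suc n)))"
      using c'(3) by (intro exI[of _ "\<lambda>_. c'"]) auto
  next
    show "\<exists>e>0. \<forall>z. (\<forall>i\<in>{1..n}. cmod (z i) < e) \<longrightarrow> ratio_macdonald f z = ratio_macdonald f z"
      by (rule exI[of _ 1]) simp
  qed blast
  have sum: "((\<lambda>m. g m * zmonom (Suc n) (ratios x) m) has_sum
      macdonald_fun (Suc n) q (q / t) s (series_fun (Suc n) f) x) (exponents (Suc n))"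
    if x: "x \<in> ratio_domain (Suc n) c" for x
  proof -
    have "x i \<noteq> 0" if "i \<in> {1..Suc n}" for i using x that by (simp add: ratio_domain_def)
    moreover have "ratios x \<in> P" using x by (auto simp: P_def ratio_domain_def ratios_def)
    ultimately show ?thesis using g(2) macdonald_fun_eq_ratio_macdonald by metis
  qed
  show ?thesis
  proof (rule that)
    show "macdonald_graph (Suc n) q (q / t) s f g"
      unfolding macdonald_graph_def using g(1) c sum by blast
  next
    fix g' assume "macdonald_graph (Suc n) q (q / t) s f g'"
    then obtain e where e: "e > 0" "g' \<in> power_series (Suc n)" "\<And>x. x \<in> ratio_domain (Suc n) e \<Longrightarrow>
       ((\<lambda>m. g' m * zmonom (Suc n) (ratios x) m) has_sum
          macdonald_fun (Suc n) q (q / t) s (series_fun (Suc n) f) x) (exponents (Suc n))"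
      unfolding macdonald_graph_def by blast
    show "g' = g"
    proof (rule power_series_unique[OF e(2) g(1)])
      show "min e c > 0" using e c by simp
      fix z assume z: "\<And>i. i \<in> {1..n} \<Longrightarrow> z i \<noteq> 0 \<and> cmod (z i) < min e c"
      obtain x where x: "\<And>i. i \<in> {1..Suc n} \<Longrightarrow> x i \<noteq> 0" "\<And>i. i \<in> {1..n} \<Longrightarrow> ratios x i = z i"
        using ratios_surj[of n z] z by metis
      have "x \<in> ratio_domain (Suc n) e" "x \<in> ratio_domain (Suc n) c"
        using x z unfolding ratio_domain_def ratios_def by auto
      note sums = e(3)[OF this(1)] sum[OF this(2)]
      have "zmonom (Suc n) z m = zmonom (Suc n) (ratios x) m" for m
        by (rule zmonom_cong) (simp add: x)
      thus "\<exists>S. ((\<lambda>m. g' m * zmonom (Suc n) z m) has_sum S) (exponents (Suc n)) \<and>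
          ((\<lambda>m. g m * zmonom (Suc n) z m) has_sum S) (exponents (Suc n))"
        using sums by (simp only:) blast
    qed
  next
    show "g \<in> hol_series (Suc n) (cmod q * r)"
    proof (rule hol_seriesI[OF g(1)])
      fix z assume "\<And>i. i \<in> {1..n} \<Longrightarrow> z i \<noteq> 0 \<and> cmod (z i) < cmod q * r"
      hence "z \<in> P" by (simp add: P_def c_def)
      thus "(\<lambda>m. g m * zmonom (Suc n) z m) summable_on exponents (Suc n)"
        using g(2) has_sum_imp_summable by blast
    qed (use c in \<open>simp add: c_def\<close>)
  next
    fix x assume "x \<in> ratio_domain (Suc n) (cmod q * r)"
    from sum[OF this[folded c_def]]
    show "series_fun (Suc n) g x = macdonald_fun (Suc n) q (q / t) s (series_fun (Suc n) f) x"
      unfolding series_fun_def by (rule infsumI)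
  qed
qed

end


section \<open>The kernel identity\<close>

text \<open>
  The monic polynomial with the roots \<open>r c\<close> has degree less than the number of nodes, so it is equal to
  its Lagrange interpolation; the leading coefficients are compared.
\<close>

lemma lagrange_leading_coefficient:
  fixes S :: "complex set"
  assumes S: "finite S" and J: "finite J" "card S = Suc (card J)"
  shows "(\<Sum>a\<in>S. (\<Prod>c\<in>J. a - r c) / (\<Prod>b\<in>S - {a}. a - b)) = 1"
proof -
  define P where "P = (\<Prod>c\<in>J. [:- r c, 1:])"
  define B where "B a = (\<Prod>b\<in>S - {a}. [:- b, 1:])" for a
  define L where "L = (\<Sum>a\<in>S. smult (poly P a / (\<Prod>b\<in>S - {a}. a - b)) (B a))"
  have P: "degree P = card J" "coeff P (card J) = 1"
  proof -
    show d: "degree P = card J" unfolding P_def by (subst degree_prod_eq_sum_degree) auto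
    have "lead_coeff P = 1" unfolding P_def by (simp add: lead_coeff_prod)
    thus "coeff P (card J) = 1" by (simp add: d)
  qed
  have B: "degree (B a) = card J" "coeff (B a) (card J) = 1" if "a \<in> S" for a
  proof -
    have "card (S - {a}) = card J" using that S J by simp
    thus d: "degree (B a) = card J" unfolding B_def by (subst degree_prod_eq_sum_degree) auto
    have "lead_coeff (B a) = 1" unfolding B_def by (simp add: lead_coeff_prod)
    thus "coeff (B a) (card J) = 1" by (simp add: d)
  qed
  have "degree L \<le> card J"
    unfolding L_def using B by (intro degree_sum_le S order.trans[OF degree_smult_le]) auto
  moreover have "poly P u = poly L u" if u: "u \<in> S" for u
  proof -
    have "poly (B a) u = 0" if "a \<in> S" "a \<noteq> u" for a
      unfolding B_def poly_prod using that u S by (intro prod_zero) auto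
    hence "poly L u = (\<Sum>a\<in>S. if a = u then poly P u / (\<Prod>b\<in>S - {u}. u - b) * poly (B u) u else 0)"
      unfolding L_def poly_sum by (intro sum.cong) auto
    also have "\<dots> = poly P u / (\<Prod>b\<in>S - {u}. u - b) * poly (B u) u" using S u by simp
    also have "poly (B u) u = (\<Prod>b\<in>S - {u}. u - b)" by (simp add: B_def poly_prod)
    also have "poly P u / (\<Prod>b\<in>S - {u}. u - b) * (\<Prod>b\<in>S - {u}. u - b) = poly P u"
      using S by simp
    finally show ?thesis by simp
  qed
  ultimately have "P = L" using P(1) J(2) by (intro poly_eqI_degree[of S]) auto
  hence "1 = coeff L (card J)" using P(2) by simp
  also have "\<dots> = (\<Sum>a\<in>S. poly P a / (\<Prod>b\<in>S - {a}. a - b))"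
    unfolding L_def coeff_sum using B by (intro sum.cong) auto
  finally show ?thesis by (simp add: P_def poly_prod)
qed

text \<open>
  The residues of \<open>\<Prod>i. (u - x i / t) / (u - x i) * (u - y i) / (u - y i / t)\<close> times \<open>1 / u\<close> add up to
  zero: the residues at \<open>0\<close> and \<open>\<infinity>\<close> cancel, those at \<open>x k\<close> give the left-hand side, and those at
  \<open>y k / t\<close> the right-hand side. In the proof, the sum of the residues at the finite poles is the
  interpolation formula above with these poles as nodes.
\<close>

lemma residue_identity:
  fixes x y :: "nat \<Rightarrow> complex"
  assumes I: "finite I" and t: "t \<noteq> 0" "t \<noteq> 1"
    and x: "inj_on x I" "\<And>i. i \<in> I \<Longrightarrow> x i \<noteq> 0" and y: "inj_on y I" "\<And>i. i \<in> I \<Longrightarrow> y i \<noteq> 0"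
    and xy: "\<And>i j. i \<in> I \<Longrightarrow> j \<in> I \<Longrightarrow> x i \<noteq> y j / t"
  shows "(\<Sum>k\<in>I. (\<Prod>l\<in>I - {k}. (x k - x l / t) / (x k - x l)) * (\<Prod>j\<in>I. (x k - y j) / (x k - y j / t)))
    = (\<Sum>k\<in>I. (\<Prod>l\<in>I - {k}. (y l - y k / t) / (y l - y k)) * (\<Prod>i\<in>I. (x i - y k) / (x i - y k / t)))"
    (is "(\<Sum>k\<in>I. ?E k) = (\<Sum>k\<in>I. ?E' k)")
proof -
  define p where "p = (\<lambda>i. y i / t)"
  define S where "S = insert 0 (x ` I \<union> p ` I)"
  define r where "r = case_sum (\<lambda>i. x i / t) y"
  define h where "h u = (\<Prod>c\<in>I <+> I. u - r c) / (\<Prod>b\<in>S - {u}. u - b)" for u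
  have p: "inj_on p I" using y(1) t by (auto simp: p_def inj_on_def)
  have disj: "x ` I \<inter> p ` I = {}" using xy by (auto simp: p_def)
  have zero: "0 \<notin> x ` I \<union> p ` I" using x(2) y(2) t by (auto simp: p_def)
  have num: "(\<Prod>c\<in>I <+> I. u - r c) = (\<Prod>i\<in>I. u - x i / t) * (\<Prod>j\<in>I. u - y j)" for u
    using I by (simp add: prod.Plus r_def)
  have "card S = Suc (card (I <+> I))"
    unfolding S_def using I zero disj x(1) p
    by (simp add: card_Un_disjoint card_image card_Plus)
  hence "1 = (\<Sum>u\<in>S. h u)"
    unfolding h_def using I by (intro lagrange_leading_coefficient[symmetric]) (auto simp: S_def)
  also have "(\<Sum>u\<in>S. h u) = h 0 + ((\<Sum>k\<in>I. h (x k)) + (\<Sum>k\<in>I. h (p k)))"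
    unfolding S_def using I zero disj x(1) p by (simp add: sum.union_disjoint sum.reindex)
  finally have total: "h 0 + ((\<Sum>k\<in>I. h (x k)) + (\<Sum>k\<in>I. h (p k))) = 1" by simp
  have h0: "h 0 = 1"
  proof -
    have "S - {0} = x ` I \<union> p ` I" using zero by (auto simp: S_def)
    hence den: "(\<Prod>b\<in>S - {0}. 0 - b) = (\<Prod>i\<in>I. - x i) * (\<Prod>i\<in>I. - p i)"
      using I disj x(1) p by (simp add: prod.union_disjoint prod.reindex)
    have "(\<Prod>i\<in>I. - x i) * (\<Prod>i\<in>I. - p i) = (\<Prod>i\<in>I. 0 - x i / t) * (\<Prod>j\<in>I. 0 - y j)"
      by (simp add: p_def prod.distrib[symmetric] mult_ac)
    moreover have "(\<Prod>i\<in>I. - x i) * (\<Prod>i\<in>I. - p i) \<noteq> 0"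
      using I x(2) y(2) t by (simp add: p_def)
    ultimately show ?thesis unfolding h_def num den by simp
  qed
  have frac: "a * A * B / (b * (C * D)) = a / b * ((A / C) * (B / D))" for a A B b C D :: complex
    by simp
  have hx: "h (x k) = (1 - 1 / t) * ?E k" if k: "k \<in> I" for k
  proof -
    have "S - {x k} = insert 0 (x ` (I - {k}) \<union> p ` I)"
      using k x zero disj by (auto simp: S_def inj_on_def)
    moreover have "0 \<notin> x ` (I - {k}) \<union> p ` I" "x ` (I - {k}) \<inter> p ` I = {}" "inj_on x (I - {k})"
      using zero disj x(1) by (auto intro: inj_on_subset)
    ultimately have den: "(\<Prod>b\<in>S - {x k}. x k - b) = x k * ((\<Prod>l\<in>I - {k}. x k - x l) * (\<Prod>j\<in>I. x k - y j / t))"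
      using I p by (simp add: prod.union_disjoint prod.reindex) (simp add: p_def)
    have "(\<Prod>i\<in>I. x k - x i / t) = (x k - x k / t) * (\<Prod>l\<in>I - {k}. x k - x l / t)"
      using I k by (simp add: prod.remove)
    hence "h (x k) = (x k - x k / t) * (\<Prod>l\<in>I - {k}. x k - x l / t) * (\<Prod>j\<in>I. x k - y j)
        / (x k * ((\<Prod>l\<in>I - {k}. x k - x l) * (\<Prod>j\<in>I. x k - y j / t)))"
      unfolding h_def num den by (simp only:)
    also have "\<dots> = (x k - x k / t) / x k * ?E k"
      unfolding prod_dividef by (rule frac)
    also have "(x k - x k / t) / x k = 1 - 1 / t" using x(2)[OF k] by (simp add: field_simps)
    finally show ?thesis .
  qed
  have hp: "h (p k) = - (1 - 1 / t) * ?E' k" if k: "k \<in> I" for k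
  proof -
    have "S - {p k} = insert 0 (x ` I \<union> p ` (I - {k}))"
    proof -
      have "p ` I - {p k} = p ` (I - {k})" using inj_on_image_set_diff[OF p, of I "{k}"] k by simp
      moreover have "p k \<noteq> 0" "p k \<notin> x ` I" using k zero disj by auto
      ultimately show ?thesis unfolding S_def by blast
    qed
    moreover have "0 \<notin> x ` I \<union> p ` (I - {k})" "x ` I \<inter> p ` (I - {k}) = {}" "inj_on p (I - {k})"
      using zero disj p by (auto intro: inj_on_subset)
    ultimately have den: "(\<Prod>b\<in>S - {p k}. p k - b) = p k * ((\<Prod>i\<in>I. p k - x i) * (\<Prod>l\<in>I - {k}. p k - p l))"
      using I x(1) by (simp add: prod.union_disjoint prod.reindex)
    have n: "(\<Prod>i\<in>I. p k - x i / t) = (1 / t) ^ card I * (\<Prod>i\<in>I. y k - x i)"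
      by (simp add: p_def prod_constant[symmetric] prod.distrib[symmetric] diff_divide_distrib del: prod_constant)
    have "(\<Prod>j\<in>I. p k - y j) = (p k - y k) * (\<Prod>l\<in>I - {k}. p k - y l)"
      using I k by (simp add: prod.remove)
    moreover have "(\<Prod>l\<in>I - {k}. p k - p l) = (1 / t) ^ card (I - {k}) * (\<Prod>l\<in>I - {k}. y k - y l)"
      by (simp add: p_def prod_constant[symmetric] prod.distrib[symmetric] diff_divide_distrib del: prod_constant)
    moreover have "(1 / t) ^ card I = (1 / t) ^ card (I - {k}) * (1 / t)"
      using I k by (simp add: card_Suc_Diff1[symmetric, of I k] del: card_Diff_insert card_Suc_Diff1)
    ultimately have "h (p k) = ((1 / t) ^ card (I - {k}) * (1 / t) * (p k - y k) * ((\<Prod>i\<in>I. y k - x i) * (\<Prod>l\<in>I - {k}. p k - y l)))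
        / ((1 / t) ^ card (I - {k}) * p k * ((\<Prod>i\<in>I. p k - x i) * (\<Prod>l\<in>I - {k}. y k - y l)))"
      unfolding h_def num den n by (simp only: mult_ac)
    also have "\<dots> = ((1 / t) ^ card (I - {k}) * (1 / t) * (p k - y k) / ((1 / t) ^ card (I - {k}) * p k))
       * ((\<Prod>i\<in>I. (y k - x i) / (p k - x i)) * (\<Prod>l\<in>I - {k}. (p k - y l) / (y k - y l)))"
      unfolding prod_dividef mult.assoc[of _ "\<Prod>i\<in>I. y k - x i", symmetric] by (rule frac)
    also have "(1 / t) ^ card (I - {k}) * (1 / t) * (p k - y k) / ((1 / t) ^ card (I - {k}) * p k) = - (1 - 1 / t)"
      using t y(2)[OF k] by (simp add: p_def field_simps)
    finally have hpk: "h (p k) = - (1 - 1 / t)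
       * ((\<Prod>i\<in>I. (y k - x i) / (p k - x i)) * (\<Prod>l\<in>I - {k}. (p k - y l) / (y k - y l)))" .
    have e1: "(y k - x i) / (p k - x i) = (x i - y k) / (x i - y k / t)" for i
      using minus_divide_divide[of "x i - y k" "x i - y k / t"] by (simp add: p_def)
    have e2: "(p k - y l) / (y k - y l) = (y l - y k / t) / (y l - y k)" for l
      using minus_divide_divide[of "y l - y k / t" "y l - y k"] by (simp add: p_def)
    show ?thesis unfolding hpk by (simp only: e1 e2 mult.commute)
  qed
  have "(\<Sum>k\<in>I. h (x k)) = (1 - 1 / t) * (\<Sum>k\<in>I. ?E k)"
    unfolding sum_distrib_left by (rule sum.cong[OF refl hx])
  moreover have "(\<Sum>k\<in>I. h (p k)) = - (1 - 1 / t) * (\<Sum>k\<in>I. ?E' k)"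
    unfolding sum_distrib_left by (rule sum.cong[OF refl hp])
  ultimately have "(1 - 1 / t) * (\<Sum>k\<in>I. ?E k) + - (1 - 1 / t) * (\<Sum>k\<in>I. ?E' k) = 0"
    using total h0 by simp
  hence "(1 - 1 / t) * ((\<Sum>k\<in>I. ?E k) - (\<Sum>k\<in>I. ?E' k)) = 0" by (simp add: algebra_simps)
  moreover have "1 - 1 / t \<noteq> 0" using t by (simp add: field_simps)
  ultimately show ?thesis using t by simp
qed

text \<open>
  Only the pairs that contain \<open>k\<close> are affected by a shift of the variables with index \<open>k\<close>.
\<close>

lemma prod_pairs_update:
  fixes g :: "nat \<Rightarrow> nat \<Rightarrow> complex"
  assumes k: "k \<in> {1..N}"
    and g': "\<And>i j. 1 \<le> i \<Longrightarrow> i < j \<Longrightarrow> j \<le> N \<Longrightarrow>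
      g' i j = g i j * (if j = k then \<alpha> i else 1) * (if i = k then \<beta> j else 1)"
  shows "(\<Prod>i = 1..N. \<Prod>j = i+1..N. g' i j)
    = (\<Prod>i = 1..N. \<Prod>j = i+1..N. g i j) * ((\<Prod>l = 1..<k. \<alpha> l) * (\<Prod>l = k+1..N. \<beta> l))"
proof -
  have "(\<Prod>i = 1..N. \<Prod>j = i+1..N. g' i j)
    = (\<Prod>i = 1..N. \<Prod>j = i+1..N. g i j * (if j = k then \<alpha> i else 1) * (if i = k then \<beta> j else 1))"
    by (intro prod.cong refl g') auto
  also have "\<dots> = (\<Prod>i = 1..N. \<Prod>j = i+1..N. g i j) * (\<Prod>i = 1..N. \<Prod>j = i+1..N. if j = k then \<alpha> i else 1)
     * (\<Prod>i = 1..N. \<Prod>j = i+1..N. if i = k then \<beta> j else 1)"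
    by (simp only: prod.distrib)
  also have "(\<Prod>i = 1..N. \<Prod>j = i+1..N. if i = k then \<beta> j else 1) = (\<Prod>i = 1..N. if i = k then \<Prod>j = i+1..N. \<beta> j else 1)"
    by (intro prod.cong) auto
  also have "\<dots> = (\<Prod>l = k+1..N. \<beta> l)" using k by simp
  also have "(\<Prod>i = 1..N. \<Prod>j = i+1..N. if j = k then \<alpha> i else 1) = (\<Prod>i = 1..N. if i < k then \<alpha> i else 1)"
    using k by (intro prod.cong) auto
  also have "\<dots> = (\<Prod>l\<in>{i\<in>{1..N}. i < k}. \<alpha> l)" by (rule prod.inter_filter[symmetric]) simp
  also have "{i\<in>{1..N}. i < k} = {1..<k}" using k by auto
  finally show ?thesis by (simp only: mult.assoc)
qed

context kernel_parameters
begin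

text \<open>
  The parameter \<open>s i\<close> enters the kernel only here, and the quasi-periodicity of the theta function
  produces the factor \<open>s0 / s i\<close> that cancels the \<open>s i\<close> of the Macdonald operator.
\<close>

lemma diagonal_factor_shift:
  assumes w: "w \<noteq> 0" "w \<noteq> 1" and i: "i \<in> {1..Suc n}"
  shows "diagonal_factor i (w / q) = diagonal_factor i w * (s0 / s i * ((1 - w) / (1 - w / t)))"
proof -
  have "s0 * w / s i \<noteq> 0" using w s0_nonzero s_nonzero[OF i] by simp
  from qtheta_step[OF q_less_1 this q_nonzero]
  have e1: "qtheta q (q * s0 * (w / q) / s i) = - (s0 * w / s i) * qtheta q (q * s0 * w / s i)"
    using q_nonzero by (simp add: mult_ac)
  have e2: "qpoch q (q * (w / q) / t) = (1 - w / t) * qpoch q (q * w / t)"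
    using q_nonzero qpoch_step[OF q_less_1, of "w / t"] by simp
  have "qpoch q (1 / w) = (1 - 1 / w) * qpoch q (1 / (w / q))"
    using qpoch_step[OF q_less_1, of "1 / w"] by simp
  moreover have "1 - 1 / w \<noteq> 0" using w by simp
  ultimately have e3: "qpoch q (1 / (w / q)) = qpoch q (1 / w) / (1 - 1 / w)" by simp
  have e4: "- (s0 * w / s i) * (1 - 1 / w) = s0 / s i * (1 - w)"
    using w s_nonzero[OF i] by (simp add: field_simps)
  have "diagonal_factor i (w / q) = qtheta q (q * s0 * w / s i) / (qpoch q (q * w / t) * qpoch q (1 / w))
     * ((- (s0 * w / s i) * (1 - 1 / w)) / (1 - w / t))"
    unfolding diagonal_factor_def e1 e2 e3 by (simp add: mult_ac)
  also have "\<dots> = diagonal_factor i w * (s0 / s i * ((1 - w) / (1 - w / t)))"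
    unfolding e4 diagonal_factor_def by simp
  finally show ?thesis .
qed

lemma qpoch_div_q: "qpoch q (u / q) = (1 - u / q) * qpoch q u"
  using qpoch_step[OF q_less_1, of "u / q"] q_nonzero by simp

lemma qpoch_mult_q: "u \<noteq> 1 \<Longrightarrow> qpoch q (q * u) = qpoch q u / (1 - u)"
  using qpoch_step[OF q_less_1, of u] by simp

text \<open>
  The next four lemmas are for the substitutions \<open>x j \<mapsto> q * x j\<close>, \<open>x i \<mapsto> q * x i\<close>, \<open>y j \<mapsto> y j / q\<close>
  and \<open>y i \<mapsto> y i / q\<close>, where \<open>i < j\<close>. Each of them multiplies some arguments of \<open>qpoch q\<close> by \<open>q\<close> or
  \<open>1 / q\<close>, and thus removes or adds one factor of the infinite products.
\<close>

lemma pair_factor_shift_x_right: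
  assumes "t * u \<noteq> 1" "q * u / t \<noteq> 1" "u / a \<noteq> 1" "t * (u / a) \<noteq> 1"
  shows "pair_factor (q * u) a (b / q) = pair_factor u a b
    * ((1 - t * u) / (1 - q * u / t) * ((1 - u / a) / (1 - t * (u / a))))"
proof -
  have e1: "qpoch q (q * (q * u) / t) = qpoch q (q * u / t) / (1 - q * u / t)"
    using qpoch_mult_q[OF assms(2)] by simp
  have e2: "qpoch q (t * (q * u)) = qpoch q (t * u) / (1 - t * u)"
    using qpoch_mult_q[OF assms(1)] by (simp add: mult_ac)
  have e3: "qpoch q (q * u / a) = qpoch q (u / a) / (1 - u / a)"
    using qpoch_mult_q[OF assms(3)] by simp
  have e4: "qpoch q (t * (q * u / a)) = qpoch q (t * (u / a)) / (1 - t * (u / a))"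
    using qpoch_mult_q[OF assms(4)] by (simp add: mult_ac)
  have e5: "q * u * (b / q) = u * b" using q_nonzero by simp
  show ?thesis unfolding pair_factor_def e5 e1 e2 e3 e4 by (simp add: mult_ac)
qed

lemma pair_factor_shift_x_left:
  "pair_factor (u / q) (a / q) b = pair_factor u a b
    * ((1 - u / t) / (1 - t * u / q) * ((1 - u * b) / (1 - u * b / t)))"
proof -
  have e1: "qpoch q (q * (u / q) / t) = (1 - u / t) * qpoch q (q * u / t)"
    using qpoch_step[OF q_less_1, of "u / t"] q_nonzero by simp
  have e2: "qpoch q (t * (u / q)) = (1 - t * u / q) * qpoch q (t * u)"
    using qpoch_div_q[of "t * u"] by simp
  have e3: "qpoch q (q * (u / q * b)) = (1 - u * b) * qpoch q (q * (u * b))"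
    using qpoch_step[OF q_less_1, of "u * b"] q_nonzero by simp
  have e4: "qpoch q (q * (u / q * b) / t) = (1 - u * b / t) * qpoch q (q * (u * b) / t)"
    using qpoch_step[OF q_less_1, of "u * b / t"] q_nonzero by simp
  have e5: "u / q / (a / q) = u / a" "u / q * b / (a / q) = u * b / a" using q_nonzero by simp_all
  show ?thesis unfolding pair_factor_def e5 e1 e2 e3 e4 by (simp add: mult_ac)
qed

lemma pair_factor_shift_y_right:
  assumes "u * b / a \<noteq> 1"
  shows "pair_factor u a (b / q) = pair_factor u a b
    * ((1 - u * b / a / q) / (1 - u * b / a) * ((1 - u * b) / (1 - u * b / t)))"
proof -
  have e3: "qpoch q (q * (u * (b / q))) = (1 - u * b) * qpoch q (q * (u * b))"
    using qpoch_step[OF q_less_1, of "u * b"] q_nonzero by simp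
  have e4: "qpoch q (q * (u * (b / q)) / t) = (1 - u * b / t) * qpoch q (q * (u * b) / t)"
    using qpoch_step[OF q_less_1, of "u * b / t"] q_nonzero by simp
  have e5: "1 - u * (b / q) / a = (1 - u * b / a) * ((1 - u * b / a / q) / (1 - u * b / a))"
    using assms by (simp add: mult_ac)
  show ?thesis unfolding pair_factor_def e3 e4 e5 by (simp add: mult_ac)
qed

lemma pair_factor_shift_y_left:
  assumes "u * b / a \<noteq> 1" "u / a \<noteq> 1" "t * (u / a) \<noteq> 1"
  shows "pair_factor u (a / q) b = pair_factor u a b
    * ((1 - q * (u * b / a)) / (1 - u * b / a) * ((1 - u / a) / (1 - t * (u / a))))"
proof -
  have e0: "u / (a / q) = q * (u / a)" "t * (q * (u / a)) = q * (t * (u / a))" by simp_all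
  have e3: "qpoch q (q * (u / a)) = qpoch q (u / a) / (1 - u / a)"
    using qpoch_mult_q[OF assms(2)] by simp
  have e4: "qpoch q (q * (t * (u / a))) = qpoch q (t * (u / a)) / (1 - t * (u / a))"
    using qpoch_mult_q[OF assms(3)] by simp
  have e5: "1 - u * b / (a / q) = (1 - u * b / a) * ((1 - q * (u * b / a)) / (1 - u * b / a))"
    using assms(1) by (simp add: mult_ac)
  show ?thesis unfolding pair_factor_def e0 e3 e4 e5 by (simp add: mult_ac)
qed

lemma kernel_eq_pairs:
  assumes x: "\<And>i. i \<in> {1..Suc n} \<Longrightarrow> x i \<noteq> 0"
  shows "kernel x y = (\<Prod>i = 1..Suc n. diagonal_factor i (y i / x i))
     * (\<Prod>i = 1..Suc n. \<Prod>j = i+1..Suc n. pair_factor (x j / x i) (y i / x i) (y j / x j))"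
  unfolding kernel_def reduced_kernel_def
  by (intro arg_cong2[where f = "(*)"] prod.cong refl) (subst ratio_ratios[OF x], auto)

lemma prod_diagonal_update:
  fixes g :: "nat \<Rightarrow> complex"
  assumes "k \<in> {1..N}" "\<And>i. i \<in> {1..N} \<Longrightarrow> g' i = (if i = k then g i * c else g i)"
  shows "(\<Prod>i = 1..N. g' i) = (\<Prod>i = 1..N. g i) * c"
proof -
  have "(\<Prod>i = 1..N. g' i) = (\<Prod>i = 1..N. g i * (if i = k then c else 1))"
    using assms(2) by (intro prod.cong) auto
  thus ?thesis using assms(1) by (simp add: prod.distrib)
qed

lemma prod_remove_split:
  fixes e :: "nat \<Rightarrow> complex"
  assumes "k \<in> {1..N}"
  shows "(\<Prod>l = 1..<k. e l) * (\<Prod>l = k+1..N. e l) = (\<Prod>l\<in>{1..N} - {k}. e l)"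
proof -
  have "{1..N} - {k} = {1..<k} \<union> {k+1..N}" using assms by auto
  hence "(\<Prod>l\<in>{1..N} - {k}. e l) = (\<Prod>l\<in>{1..<k} \<union> {k+1..N}. e l)" by (rule arg_cong)
  also have "\<dots> = (\<Prod>l = 1..<k. e l) * (\<Prod>l = k+1..N. e l)"
    by (rule prod.union_disjoint) auto
  finally show ?thesis by (rule sym)
qed

text \<open>
  The points at which the functional equations of the kernel are used: the moduli keep all
  denominators away from zero.
\<close>

definition regular_points :: "(nat \<Rightarrow> complex) \<Rightarrow> (nat \<Rightarrow> complex) \<Rightarrow> bool" where
  "regular_points x y \<longleftrightarrow> (\<forall>i\<in>{1..Suc n}. x i \<noteq> 0 \<and> cmod (x i) < cmod (y i) \<and> cmod (y i) < cmod (t * x i))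
     \<and> (\<forall>i j. 1 \<le> i \<longrightarrow> i < j \<longrightarrow> j \<le> Suc n \<longrightarrow> cmod (t * x j) < cmod (q * x i))"

lemma regular_points_single:
  assumes "regular_points x y" "i \<in> {1..Suc n}"
  shows "x i \<noteq> 0" "y i \<noteq> 0" "y i \<noteq> x i" "x i \<noteq> y i / t"
proof -
  have a: "x i \<noteq> 0" "cmod (x i) < cmod (y i)" "cmod (y i) < cmod (t * x i)"
    using assms unfolding regular_points_def by auto
  show "x i \<noteq> 0" "y i \<noteq> 0" "y i \<noteq> x i" using a by auto
  show "x i \<noteq> y i / t" using a(3) t_nonzero by (auto simp: norm_mult norm_divide)
qed

lemma regular_points_pair:
  assumes xy: "regular_points x y" and ij: "1 \<le> i" "i < j" "j \<le> Suc n"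
  shows "x j \<noteq> x i" "t * x j \<noteq> x i" "q * x j \<noteq> t * x i" "t * x j \<noteq> q * x i" "x j \<noteq> y i" "t * x j \<noteq> y i"
    "y j \<noteq> y i" "y j \<noteq> q * y i" "q * y j \<noteq> y i" "x i \<noteq> y j / t" "x j \<noteq> y i / t"
proof -
  have a: "x i \<noteq> 0" "cmod (x i) < cmod (y i)" "cmod (y i) < cmod (t * x i)"
    "cmod (x j) < cmod (y j)" "cmod (y j) < cmod (t * x j)" "cmod (t * x j) < cmod (q * x i)"
    using xy ij unfolding regular_points_def by auto
  have m: "cmod (q * u) \<le> cmod u" "cmod u \<le> cmod (t * u)" for u
    using q_less_1 one_less_t mult_right_mono[of "cmod q" 1 "cmod u"] mult_right_mono[of 1 "cmod t" "cmod u"]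
    by (auto simp: norm_mult)
  have qy: "cmod (q * x i) < cmod (q * y i)" using a(2) cmod_q_pos by (simp add: norm_mult)
  have yt: "cmod (y j / t) < cmod (x j)" using a(5) cmod_t_pos by (simp add: norm_mult norm_divide field_simps)
  have xt: "cmod (x j) < cmod (y i / t)" 
  proof -
    have "cmod (t * x j) < cmod (y i)" using a m(1)[of "x i"] by linarith
    thus ?thesis using cmod_t_pos by (simp add: norm_mult norm_divide field_simps)
  qed
  note bounds = a qy yt xt m[of "x i"] m[of "x j"] m[of "y i"] m[of "y j"]
  have l: "u \<noteq> v" if "cmod u < cmod v" for u v :: complex using that by auto
  show "x j \<noteq> x i" by (rule l) (use bounds in linarith)
  show "t * x j \<noteq> x i" by (rule l) (use bounds in linarith)
  show "q * x j \<noteq> t * x i" by (rule l) (use bounds in linarith)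
  show "t * x j \<noteq> q * x i" by (rule l) (use bounds in linarith)
  show "x j \<noteq> y i" by (rule l) (use bounds in linarith)
  show "t * x j \<noteq> y i" by (rule l) (use bounds in linarith)
  show "y j \<noteq> y i" by (rule l) (use bounds in linarith)
  show "y j \<noteq> q * y i" by (rule l) (use bounds in linarith)
  show "q * y j \<noteq> y i" by (rule l) (use bounds in linarith)
  show "x i \<noteq> y j / t" by (rule l[symmetric]) (use bounds in linarith)
  show "x j \<noteq> y i / t" by (rule l) (use bounds in linarith)
qed

lemma cancel_numerator: "a \<noteq> 0 \<Longrightarrow> a / b * (c / a * d) = c / b * d" for a b c d :: complex
  by simp

lemma cancel_denominator: "b \<noteq> 0 \<Longrightarrow> a / b * (b / c * d) = a / c * d" for a b c d :: complex
  by simp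

text \<open>
  The numerators of the Macdonald coefficient cancel against denominators that come from the product
  in front of the integral. The powers of \<open>t\<close> from the two kinds of pair factors with \<open>l < k\<close>
  compensate each other, so that pairs with \<open>l < k\<close> and with \<open>l > k\<close> contribute the same expression
  \<open>e l\<close>.
\<close>

lemma kernel_shift_x:
  assumes xy: "regular_points x y" and k: "k \<in> {1..Suc n}"
  shows "s k * (macdonald_coeff (\<lambda>i j. x j / x i) k * kernel (q_shift k x) y)
    = s0 * kernel x y * ((\<Prod>l\<in>{1..Suc n} - {k}. (x k - x l / t) / (x k - x l))
        * (\<Prod>j = 1..Suc n. (x k - y j) / (x k - y j / t)))"
proof -
  note x0 = regular_points_single(1)[OF xy]
  note y0 = regular_points_single(2)[OF xy]
  define \<alpha> where "\<alpha> l = (1 - t * (x k / x l)) / (1 - q * (x k / x l) / t)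
     * ((1 - x k / x l / (y l / x l)) / (1 - t * (x k / x l / (y l / x l))))" for l
  define \<beta> where "\<beta> l = (1 - x l / x k / t) / (1 - t * (x l / x k) / q)
     * ((1 - x l / x k * (y l / x l)) / (1 - x l / x k * (y l / x l) / t))" for l
  define c where "c = s0 / s k * ((1 - y k / x k) / (1 - y k / x k / t))"
  define e where "e l = (x k - x l / t) / (x k - x l) * ((x k - y l) / (x k - y l / t))" for l
  have qx0: "q_shift k x i \<noteq> 0" if "i \<in> {1..Suc n}" for i
    using x0[OF that] x0[OF k] q_nonzero by (simp add: q_shift_def)
  have diag: "(\<Prod>i = 1..Suc n. diagonal_factor i (y i / q_shift k x i)) = (\<Prod>i = 1..Suc n. diagonal_factor i (y i / x i)) * c"
  proof (rule prod_diagonal_update[OF k])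
    fix i assume i: "i \<in> {1..Suc n}"
    have "y k / x k \<noteq> 0" "y k / x k \<noteq> 1" using regular_points_single[OF xy k] by auto
    from diagonal_factor_shift[OF this k]
    show "diagonal_factor i (y i / q_shift k x i)
        = (if i = k then diagonal_factor i (y i / x i) * c else diagonal_factor i (y i / x i))"
      by (simp add: q_shift_def c_def mult.commute[of q])
  qed
  have pairs: "(\<Prod>i = 1..Suc n. \<Prod>j = i+1..Suc n. pair_factor (q_shift k x j / q_shift k x i) (y i / q_shift k x i) (y j / q_shift k x j))
      = (\<Prod>i = 1..Suc n. \<Prod>j = i+1..Suc n. pair_factor (x j / x i) (y i / x i) (y j / x j))
        * ((\<Prod>l = 1..<k. \<alpha> l) * (\<Prod>l = k+1..Suc n. \<beta> l))"
  proof (rule prod_pairs_update[OF k])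
    fix i j assume ij: "1 \<le> i" "i < j" "j \<le> Suc n"
    note ne = regular_points_pair[OF xy ij]
    have nz: "x i \<noteq> 0" "x j \<noteq> 0" "y i \<noteq> 0" "y j \<noteq> 0" using x0 y0 ij by auto
    consider "j = k" | "i = k" | "i \<noteq> k" "j \<noteq> k" by blast
    thus "pair_factor (q_shift k x j / q_shift k x i) (y i / q_shift k x i) (y j / q_shift k x j)
        = pair_factor (x j / x i) (y i / x i) (y j / x j) * (if j = k then \<alpha> i else 1) * (if i = k then \<beta> j else 1)"
    proof cases
      case 1
      have "pair_factor (q * (x k / x i)) (y i / x i) (y k / x k / q) = pair_factor (x k / x i) (y i / x i) (y k / x k) * \<alpha> i"
        unfolding \<alpha>_def
        by (rule pair_factor_shift_x_right) (use 1 ne nz t_nonzero in \<open>auto simp: field_simps\<close>)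
      moreover have "i \<noteq> k" using 1 ij by simp
      ultimately show ?thesis using 1 by (simp add: q_shift_def mult.commute[of q])
    next
      case 2
      have "pair_factor (x j / x k / q) (y k / x k / q) (y j / x j) = pair_factor (x j / x k) (y k / x k) (y j / x j) * \<beta> j"
        unfolding \<beta>_def by (rule pair_factor_shift_x_left)
      moreover have "j \<noteq> k" using 2 ij by simp
      ultimately show ?thesis using 2 by (simp add: q_shift_def mult.commute[of q])
    qed (simp add: q_shift_def)
  qed
  have left: "(1 - q / t * (x k / x l)) / (1 - x k / x l) * \<alpha> l = e l" if l: "l \<in> {1..<k}" for l
  proof -
    have lk: "1 \<le> l" "l < k" "k \<le> Suc n" using l k by auto
    note ne = regular_points_pair[OF xy lk]
    have nz: "x l \<noteq> 0" "x k \<noteq> 0" "y l \<noteq> 0" using x0 y0 lk by auto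
    have 1: "1 - q * (x k / x l) / t \<noteq> 0" using ne nz t_nonzero by (auto simp: field_simps)
    have 2: "(1 - t * (x k / x l)) / (1 - x k / x l) = t * ((x k - x l / t) / (x k - x l))"
      using nz ne t_nonzero by (simp add: divide_simps) (simp add: algebra_simps)
    have 3: "(1 - x k / x l / (y l / x l)) / (1 - t * (x k / x l / (y l / x l))) = 1 / t * ((x k - y l) / (x k - y l / t))"
      using nz ne t_nonzero by (simp add: divide_simps) (simp add: algebra_simps)
    have 0: "q / t * (x k / x l) = q * (x k / x l) / t" by simp
    show ?thesis
      unfolding \<alpha>_def 0 cancel_numerator[OF 1] 2 3 e_def using t_nonzero by simp
  qed
  have right: "(1 - x l / x k / (q / t)) / (1 - x l / x k) * \<beta> l = e l" if l: "l \<in> {k+1..Suc n}" for l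
  proof -
    have kl: "1 \<le> k" "k < l" "l \<le> Suc n" using l k by auto
    note ne = regular_points_pair[OF xy kl]
    have nz: "x l \<noteq> 0" "x k \<noteq> 0" "y l \<noteq> 0" using x0 y0 kl by auto
    have 1: "1 - t * (x l / x k) / q \<noteq> 0" using ne nz q_nonzero by (auto simp: field_simps)
    have 2: "(1 - x l / x k / t) / (1 - x l / x k) = (x k - x l / t) / (x k - x l)"
      using nz ne t_nonzero by (simp add: divide_simps)
    have 3: "(1 - x l / x k * (y l / x l)) / (1 - x l / x k * (y l / x l) / t) = (x k - y l) / (x k - y l / t)"
      using nz ne t_nonzero by (simp add: divide_simps)
    have 4: "x l / x k / (q / t) = t * (x l / x k) / q" by simp
    show ?thesis
      unfolding \<beta>_def 4 cancel_numerator[OF 1] 2 3 e_def ..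
  qed
  have "macdonald_coeff (\<lambda>i j. x j / x i) k * ((\<Prod>l = 1..<k. \<alpha> l) * (\<Prod>l = k+1..Suc n. \<beta> l))
     = (\<Prod>l = 1..<k. (1 - q / t * (x k / x l)) / (1 - x k / x l) * \<alpha> l)
       * (\<Prod>l = k+1..Suc n. (1 - x l / x k / (q / t)) / (1 - x l / x k) * \<beta> l)"
    unfolding macdonald_coeff_def prod.distrib by (simp only: mult_ac)
  also have "\<dots> = (\<Prod>l = 1..<k. e l) * (\<Prod>l = k+1..Suc n. e l)"
    by (intro arg_cong2[where f = "(*)"] prod.cong refl left right)
  also have "\<dots> = (\<Prod>l\<in>{1..Suc n} - {k}. e l)" by (rule prod_remove_split[OF k])
  finally have coeff: "macdonald_coeff (\<lambda>i j. x j / x i) k * ((\<Prod>l = 1..<k. \<alpha> l) * (\<Prod>l = k+1..Suc n. \<beta> l))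
     = (\<Prod>l\<in>{1..Suc n} - {k}. e l)" .
  have c: "s k * c = s0 * ((x k - y k) / (x k - y k / t))"
    unfolding c_def using x0[OF k] s_nonzero[OF k] t_nonzero regular_points_single[OF xy k] by (simp add: divide_simps)
  have kx: "kernel x y = (\<Prod>i = 1..Suc n. diagonal_factor i (y i / x i))
     * (\<Prod>i = 1..Suc n. \<Prod>j = i+1..Suc n. pair_factor (x j / x i) (y i / x i) (y j / x j))"
    by (rule kernel_eq_pairs) (rule x0)
  have kq: "kernel (q_shift k x) y = (\<Prod>i = 1..Suc n. diagonal_factor i (y i / q_shift k x i))
     * (\<Prod>i = 1..Suc n. \<Prod>j = i+1..Suc n. pair_factor (q_shift k x j / q_shift k x i) (y i / q_shift k x i) (y j / q_shift k x j))"
    by (rule kernel_eq_pairs) (rule qx0)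
  have "s k * (macdonald_coeff (\<lambda>i j. x j / x i) k * kernel (q_shift k x) y)
     = kernel x y * (s k * c) * (macdonald_coeff (\<lambda>i j. x j / x i) k * ((\<Prod>l = 1..<k. \<alpha> l) * (\<Prod>l = k+1..Suc n. \<beta> l)))"
    unfolding kq kx diag pairs by (simp only: mult_ac)
  also have "\<dots> = s0 * kernel x y * ((\<Prod>l\<in>{1..Suc n} - {k}. (x k - x l / t) / (x k - x l))
      * ((x k - y k) / (x k - y k / t) * (\<Prod>l\<in>{1..Suc n} - {k}. (x k - y l) / (x k - y l / t))))"
    unfolding coeff c e_def prod.distrib by (simp only: mult_ac)
  also have "(x k - y k) / (x k - y k / t) * (\<Prod>l\<in>{1..Suc n} - {k}. (x k - y l) / (x k - y l / t))
     = (\<Prod>j = 1..Suc n. (x k - y j) / (x k - y j / t))"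
    by (rule prod.remove[symmetric]) (use k in auto)
  finally show ?thesis .
qed

definition q_unshift :: "nat \<Rightarrow> (nat \<Rightarrow> complex) \<Rightarrow> nat \<Rightarrow> complex" where
  "q_unshift k y = y(k := y k / q)"

text \<open>
  The factors \<open>1 - y j / y i\<close> of the integrand replace the denominators of the Macdonald
  coefficient at the shifted point by those at \<open>y\<close>. Again all indices \<open>l \<noteq> k\<close> contribute the same
  expression \<open>e l\<close>.
\<close>

lemma kernel_shift_y:
  assumes xy: "regular_points x y" and k: "k \<in> {1..Suc n}"
  shows "s k * (macdonald_coeff (\<lambda>i j. q_unshift k y j / q_unshift k y i) k * kernel x (q_unshift k y))
    = s0 * kernel x y * ((\<Prod>l\<in>{1..Suc n} - {k}. (y l - y k / t) / (y l - y k))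
        * (\<Prod>i = 1..Suc n. (x i - y k) / (x i - y k / t)))"
proof -
  note x0 = regular_points_single(1)[OF xy]
  note y0 = regular_points_single(2)[OF xy]
  let ?U = "\<lambda>i j. q_unshift k y j / q_unshift k y i"
  define \<alpha> where "\<alpha> l = (1 - y k / y l / q) / (1 - y k / y l) * ((1 - y k / x l) / (1 - y k / x l / t))" for l
  define \<beta> where "\<beta> l = (1 - q * (y l / y k)) / (1 - y l / y k) * ((1 - x l / y k) / (1 - t * (x l / y k)))" for l
  define c where "c = s0 / s k * ((1 - y k / x k) / (1 - y k / x k / t))"
  define e where "e l = (y l - y k / t) / (y l - y k) * ((x l - y k) / (x l - y k / t))" for l
  have diag: "(\<Prod>i = 1..Suc n. diagonal_factor i (q_unshift k y i / x i)) = (\<Prod>i = 1..Suc n. diagonal_factor i (y i / x i)) * c"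
  proof (rule prod_diagonal_update[OF k])
    fix i assume i: "i \<in> {1..Suc n}"
    have "y k / x k \<noteq> 0" "y k / x k \<noteq> 1" using regular_points_single[OF xy k] by auto
    from diagonal_factor_shift[OF this k]
    show "diagonal_factor i (q_unshift k y i / x i)
        = (if i = k then diagonal_factor i (y i / x i) * c else diagonal_factor i (y i / x i))"
      by (simp add: q_unshift_def c_def mult.commute)
  qed
  have pairs: "(\<Prod>i = 1..Suc n. \<Prod>j = i+1..Suc n. pair_factor (x j / x i) (q_unshift k y i / x i) (q_unshift k y j / x j))
      = (\<Prod>i = 1..Suc n. \<Prod>j = i+1..Suc n. pair_factor (x j / x i) (y i / x i) (y j / x j))
        * ((\<Prod>l = 1..<k. \<alpha> l) * (\<Prod>l = k+1..Suc n. \<beta> l))"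
  proof (rule prod_pairs_update[OF k])
    fix i j assume ij: "1 \<le> i" "i < j" "j \<le> Suc n"
    note ne = regular_points_pair[OF xy ij]
    have nz: "x i \<noteq> 0" "x j \<noteq> 0" "y i \<noteq> 0" "y j \<noteq> 0" using x0 y0 ij by auto
    have e: "x j / x i * (y j / x j) = y j / x i" "x j / x i / (y i / x i) = x j / y i"
      "x j / x i * (y j / x j) / (y i / x i) = y j / y i" "y j / x i / (y i / x i) = y j / y i"
      using nz by simp_all
    consider "j = k" | "i = k" | "i \<noteq> k" "j \<noteq> k" by blast
    thus "pair_factor (x j / x i) (q_unshift k y i / x i) (q_unshift k y j / x j)
        = pair_factor (x j / x i) (y i / x i) (y j / x j) * (if j = k then \<alpha> i else 1) * (if i = k then \<beta> j else 1)"
    proof cases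
      case 1
      have "x j / x i * (y j / x j) / (y i / x i) \<noteq> 1" unfolding e using ne nz by simp
      have "pair_factor (x j / x i) (y i / x i) (y j / x j / q) = pair_factor (x j / x i) (y i / x i) (y j / x j) * \<alpha> i"
        using pair_factor_shift_y_right[OF \<open>x j / x i * (y j / x j) / (y i / x i) \<noteq> 1\<close>]
        unfolding e \<alpha>_def 1[symmetric] .
      moreover have "i \<noteq> k" using 1 ij by simp
      ultimately show ?thesis using 1 by (simp add: q_unshift_def mult.commute)
    next
      case 2
      have "x j / x i * (y j / x j) / (y i / x i) \<noteq> 1" "x j / x i / (y i / x i) \<noteq> 1" "t * (x j / x i / (y i / x i)) \<noteq> 1"
        unfolding e using ne nz by (auto simp: field_simps)
      note shift = pair_factor_shift_y_left[OF this]
      have "pair_factor (x j / x i) (y i / x i / q) (y j / x j) = pair_factor (x j / x i) (y i / x i) (y j / x j) * \<beta> j"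
        using shift unfolding e \<beta>_def 2[symmetric] .
      moreover have "j \<noteq> k" using 2 ij by simp
      ultimately show ?thesis using 2 by (simp add: q_unshift_def mult.commute)
    qed (simp add: q_unshift_def)
  qed
  have left: "(1 - q / t * ?U l k) / (1 - ?U l k) * \<alpha> l = e l" if l: "l \<in> {1..<k}" for l
  proof -
    have lk: "1 \<le> l" "l < k" "k \<le> Suc n" using l k by auto
    note ne = regular_points_pair[OF xy lk]
    have nz: "x l \<noteq> 0" "y k \<noteq> 0" "y l \<noteq> 0" using x0 y0 lk by auto
    have U: "?U l k = y k / y l / q" using lk by (simp add: q_unshift_def mult.commute)
    have 1: "1 - y k / y l / q \<noteq> 0" using ne nz q_nonzero by (auto simp: field_simps)
    have 2: "(1 - q / t * (y k / y l / q)) / (1 - y k / y l) = (y l - y k / t) / (y l - y k)"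
      using nz ne t_nonzero q_nonzero by (simp add: divide_simps)
    have 3: "(1 - y k / x l) / (1 - y k / x l / t) = (x l - y k) / (x l - y k / t)"
      using nz ne t_nonzero by (simp add: divide_simps)
    show ?thesis
      unfolding \<alpha>_def U cancel_denominator[OF 1] 2 3 e_def ..
  qed
  have right: "(1 - ?U k l / (q / t)) / (1 - ?U k l) * \<beta> l = e l" if l: "l \<in> {k+1..Suc n}" for l
  proof -
    have kl: "1 \<le> k" "k < l" "l \<le> Suc n" using l k by auto
    note ne = regular_points_pair[OF xy kl]
    have nz: "x l \<noteq> 0" "y k \<noteq> 0" "y l \<noteq> 0" using x0 y0 kl by auto
    have U: "?U k l = q * (y l / y k)" using kl by (simp add: q_unshift_def)
    have 1: "1 - q * (y l / y k) \<noteq> 0" using ne nz q_nonzero by (auto simp: field_simps)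
    have 2: "(1 - q * (y l / y k) / (q / t)) / (1 - y l / y k) = t * ((y l - y k / t) / (y l - y k))"
      using nz ne t_nonzero q_nonzero by (simp add: divide_simps) (simp add: algebra_simps)
    have 3: "(1 - x l / y k) / (1 - t * (x l / y k)) = 1 / t * ((x l - y k) / (x l - y k / t))"
      using nz ne t_nonzero by (simp add: divide_simps) (simp add: algebra_simps)
    show ?thesis
      unfolding \<beta>_def U cancel_denominator[OF 1] 2 3 e_def using t_nonzero by simp
  qed
  have "macdonald_coeff ?U k * ((\<Prod>l = 1..<k. \<alpha> l) * (\<Prod>l = k+1..Suc n. \<beta> l))
     = (\<Prod>l = 1..<k. (1 - q / t * ?U l k) / (1 - ?U l k) * \<alpha> l)
       * (\<Prod>l = k+1..Suc n. (1 - ?U k l / (q / t)) / (1 - ?U k l) * \<beta> l)"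
    unfolding macdonald_coeff_def prod.distrib by (simp only: mult_ac)
  also have "\<dots> = (\<Prod>l = 1..<k. e l) * (\<Prod>l = k+1..Suc n. e l)"
    by (intro arg_cong2[where f = "(*)"] prod.cong refl left right)
  also have "\<dots> = (\<Prod>l\<in>{1..Suc n} - {k}. e l)" by (rule prod_remove_split[OF k])
  finally have coeff: "macdonald_coeff ?U k * ((\<Prod>l = 1..<k. \<alpha> l) * (\<Prod>l = k+1..Suc n. \<beta> l))
     = (\<Prod>l\<in>{1..Suc n} - {k}. e l)" .
  have c: "s k * c = s0 * ((x k - y k) / (x k - y k / t))"
    unfolding c_def using x0[OF k] s_nonzero[OF k] t_nonzero regular_points_single[OF xy k] by (simp add: divide_simps)
  have kx: "kernel x y = (\<Prod>i = 1..Suc n. diagonal_factor i (y i / x i))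
     * (\<Prod>i = 1..Suc n. \<Prod>j = i+1..Suc n. pair_factor (x j / x i) (y i / x i) (y j / x j))"
    by (rule kernel_eq_pairs) (rule x0)
  have kq: "kernel x (q_unshift k y) = (\<Prod>i = 1..Suc n. diagonal_factor i (q_unshift k y i / x i))
     * (\<Prod>i = 1..Suc n. \<Prod>j = i+1..Suc n. pair_factor (x j / x i) (q_unshift k y i / x i) (q_unshift k y j / x j))"
    by (rule kernel_eq_pairs) (rule x0)
  have "s k * (macdonald_coeff ?U k * kernel x (q_unshift k y))
     = kernel x y * (s k * c) * (macdonald_coeff ?U k * ((\<Prod>l = 1..<k. \<alpha> l) * (\<Prod>l = k+1..Suc n. \<beta> l)))"
    unfolding kx kq diag pairs by (simp only: mult_ac)
  also have "\<dots> = s0 * kernel x y * ((\<Prod>l\<in>{1..Suc n} - {k}. (y l - y k / t) / (y l - y k))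
      * ((x k - y k) / (x k - y k / t) * (\<Prod>l\<in>{1..Suc n} - {k}. (x l - y k) / (x l - y k / t))))"
    unfolding coeff c e_def prod.distrib by (simp only: mult_ac)
  also have "(x k - y k) / (x k - y k / t) * (\<Prod>l\<in>{1..Suc n} - {k}. (x l - y k) / (x l - y k / t))
     = (\<Prod>i = 1..Suc n. (x i - y k) / (x i - y k / t))"
    by (rule prod.remove[symmetric]) (use k in auto)
  finally show ?thesis .
qed

text \<open>
  The operator acting on \<open>x\<close> and the transposed operator acting on \<open>y\<close> agree on the kernel. Both sides
  are \<open>s0 * kernel x y\<close> times a sum of rational functions, and these sums are equal by
  \<open>residue_identity\<close>.
\<close>

lemma kernel_intertwines:
  assumes xy: "regular_points x y"
  shows "(\<Sum>k = 1..Suc n. s k * (macdonald_coeff (\<lambda>i j. x j / x i) k * kernel (q_shift k x) y))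
    = (\<Sum>k = 1..Suc n. s k * (macdonald_coeff (\<lambda>i j. q_unshift k y j / q_unshift k y i) k * kernel x (q_unshift k y)))"
proof -
  let ?I = "{1..Suc n}"
  have "x i \<noteq> x j \<and> y i \<noteq> y j" if "i \<in> ?I" "j \<in> ?I" "i \<noteq> j" for i j
    using that regular_points_pair(1,7)[OF xy, of i j] regular_points_pair(1,7)[OF xy, of j i]
    by (cases "i < j") auto
  hence inj: "inj_on x ?I" "inj_on y ?I" unfolding inj_on_def by blast+
  have ne: "x i \<noteq> y j / t" if "i \<in> ?I" "j \<in> ?I" for i j
    using that regular_points_pair(10)[OF xy, of i j] regular_points_pair(11)[OF xy, of j i]
      regular_points_single(4)[OF xy, of i]
    by (cases i j rule: linorder_cases) auto
  have t1: "t \<noteq> 1" using one_less_t by auto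
  have "(\<Sum>k\<in>?I. s0 * kernel x y * ((\<Prod>l\<in>?I - {k}. (x k - x l / t) / (x k - x l)) * (\<Prod>j\<in>?I. (x k - y j) / (x k - y j / t))))
    = (\<Sum>k\<in>?I. s0 * kernel x y * ((\<Prod>l\<in>?I - {k}. (y l - y k / t) / (y l - y k)) * (\<Prod>i\<in>?I. (x i - y k) / (x i - y k / t))))"
    unfolding sum_distrib_left[symmetric]
    using residue_identity[of ?I t x y] inj ne t1 t_nonzero regular_points_single[OF xy] by simp
  thus ?thesis using kernel_shift_x[OF xy] kernel_shift_y[OF xy] by simp
qed


section \<open>Commutation\<close>

lemma mhol_at_kernel_scaled:
  assumes z: "\<And>k. k \<in> {1..n} \<Longrightarrow> cmod (z k) < cmod (inverse t)"
    and x: "\<And>i. i \<in> {1..Suc n} \<Longrightarrow> x i \<noteq> 0"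
    and y: "\<And>i. i \<in> {1..Suc n} \<Longrightarrow> cmod (x i) < cmod (y i) \<and> cmod (y i) < cmod (t / q) * cmod (x i)"
  shows "mhol_at (\<lambda>y. reduced_kernel z (\<lambda>i. y i / x i)) y"
proof (rule mhol_at_reduced_kernel)
  fix i assume i: "i \<in> {1..Suc n}"
  have "cmod (x i) > 0" using x[OF i] by simp
  thus "1 < cmod (y i / x i)" "cmod (y i / x i) < cmod (t / q)"
    using y[OF i] by (simp_all add: norm_divide[of "y i"] less_divide_eq divide_less_eq)
  show "mhol_at (\<lambda>y. y i / x i) y"
    by (intro mhol_at_divide mhol_at_coordinate mhol_at_const x i)
qed (auto intro: mhol_at_const z)

lemma mhol_at_series_fun:
  assumes f: "f \<in> hol_series (Suc n) r" "r > 0"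
    and y: "\<And>i. i \<in> {1..Suc n} \<Longrightarrow> y i \<noteq> 0" "\<And>k. k \<in> {1..n} \<Longrightarrow> cmod (y (Suc k) / y k) < r"
  shows "mhol_at (series_fun (Suc n) f) y"
proof -
  have "mhol_at (\<lambda>y. series (Suc n) f (\<lambda>k. y (Suc k) / y k)) y"
  proof (rule mhol_at_series[OF f])
    show "open {v :: nat \<Rightarrow> complex. \<forall>i\<in>{1..Suc n}. v i \<noteq> 0}" by (rule open_coordinates_nonzero) simp
    show "y \<in> {v. \<forall>i\<in>{1..Suc n}. v i \<noteq> 0}" using y by blast
    fix k v assume "k \<in> {1..<Suc n}" "v \<in> {v :: nat \<Rightarrow> complex. \<forall>i\<in>{1..Suc n}. v i \<noteq> 0}"
    thus "mhol_at (\<lambda>y. y (Suc k) / y k) v" by (intro mhol_at_divide mhol_at_coordinate) auto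
  qed (use y in auto)
  thus ?thesis by (simp add: series_fun_eq[abs_def] ratios_def)
qed

text \<open>
  The bound for the ratios of the \<open>x i\<close> under which all contours can be moved. The variables \<open>y\<close> occur
  with \<open>|q x i| < |y i| < |t / q| |x i|\<close>, so their ratios may exceed those of the \<open>x i\<close> by the factor
  \<open>|t / q\<^sup>2|\<close>. The constant is chosen such that they are still smaller than \<open>|q / t|\<close>, which leaves
  room for one more division by \<open>q\<close>.
\<close>

definition separation :: real where
  "separation = cmod q ^ 3 / cmod t ^ 2"

lemma separation: "0 < separation" "separation < 1" "separation < cmod (q / t)" 
  "separation / cmod q < cmod (q / t)" "separation * cmod t < cmod (q / t)"
  "cmod (t / q) / cmod q * separation = cmod (q / t)"
proof -
  let ?Q = "cmod q" and ?T = "cmod t"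
  note pos = cmod_q_pos cmod_t_pos
  show "0 < separation" using pos by (simp add: separation_def)
  show "cmod (t / q) / cmod q * separation = cmod (q / t)"
    using pos by (simp add: separation_def norm_divide power2_eq_square power3_eq_cube)
  have "?Q * ?Q < 1" using q_less_1 pos mult_strict_mono[of ?Q 1 ?Q 1] by simp
  hence 1: "?Q * ?Q / ?T < 1" "?Q * ?Q < 1"
    using one_less_t by (simp_all add: divide_less_eq)
  have "separation / cmod q = cmod (q / t) * (?Q / ?T)"
    using pos by (simp add: separation_def norm_divide power2_eq_square power3_eq_cube)
  also have "\<dots> < cmod (q / t) * 1"
    using cmod_q_div_t by (intro mult_strict_left_mono) (simp_all add: norm_divide)
  finally show 2: "separation / cmod q < cmod (q / t)" by simp
  have "separation * ?T = cmod (q / t) * (?Q * ?Q)"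
    using pos by (simp add: separation_def norm_divide power2_eq_square power3_eq_cube)
  also have "\<dots> < cmod (q / t) * 1" using 1 cmod_q_div_t by (intro mult_strict_left_mono) auto
  finally show 3: "separation * ?T < cmod (q / t)" by simp
  have "separation * 1 < separation * ?T" using one_less_t \<open>0 < separation\<close> by (intro mult_strict_left_mono) auto
  thus 4: "separation < cmod (q / t)" using 3 by simp
  show "separation < 1" using 4 cmod_q_div_t by linarith
qed

lemma separated_ratio:
  assumes "x \<in> ratio_domain (Suc n) separation" "1 \<le> i" "i < j" "j \<le> Suc n"
  shows "cmod (x j) < separation * cmod (x i)"
proof -
  have x0: "x i \<noteq> 0" if "i \<in> {1..Suc n}" for i using assms(1) that by (simp add: ratio_domain_def)
  have r: "cmod (ratios x k) < separation" if "k \<in> {1..n}" for k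
    using assms(1) that by (auto simp: ratio_domain_def ratios_def)
  have "cmod (ratio (ratios x) i j) < separation"
    using assms(2-4) separation by (intro ratio_less r) auto
  moreover have "ratio (ratios x) i j = x j / x i" using assms(2-4) by (intro ratio_ratios x0) auto
  moreover have "cmod (x i) > 0" using x0[of i] assms(2-4) by simp
  ultimately show ?thesis by (simp add: norm_divide divide_less_eq)
qed

lemma separated_y_ratio:
  assumes x: "x \<in> ratio_domain (Suc n) separation" and ij: "1 \<le> i" "i < j" "j \<le> Suc n"
    and y: "cmod q * cmod (x i) < cmod (y i)" "cmod (y j) < cmod (t / q) * cmod (x j)"
  shows "cmod (y j / y i) < cmod (q / t)"
proof -
  have "cmod (y j) < cmod (t / q) * cmod (x j)" by (rule y)
  also have "\<dots> \<le> cmod (t / q) * (separation * cmod (x i))"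
    using separated_ratio[OF x ij] by (intro mult_left_mono) auto
  also have "\<dots> = (cmod (t / q) / cmod q * separation) * (cmod q * cmod (x i))"
    using cmod_q_pos by simp
  also have "\<dots> = cmod (q / t) * (cmod q * cmod (x i))" by (simp only: separation(6))
  also have "\<dots> \<le> cmod (q / t) * cmod (y i)"
    using y(1) by (intro mult_left_mono) auto
  finally have "cmod (y j) < cmod (q / t) * cmod (y i)" .
  moreover have "cmod (y i) > 0" using y(1) by (meson mult_nonneg_nonneg norm_ge_zero order_le_less_trans)
  ultimately show ?thesis by (simp add: norm_divide[of "y j"] divide_less_eq)
qed

definition annuli :: "(nat \<Rightarrow> complex) \<Rightarrow> nat \<Rightarrow> (nat \<Rightarrow> complex) set" where
  "annuli x k = {y. \<forall>i\<in>{1..Suc n}. cmod (q_shift k x i) < cmod (y i) \<and> cmod (y i) < cmod (t / q) * cmod (q_shift k x i)}"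

text \<open>
  The integrand of \<open>I (D f)\<close> after the substitution \<open>y k \<mapsto> y k / q\<close>, by which \<open>f\<close> is evaluated at \<open>y\<close>
  itself.
\<close>

definition shifted_y_integrand :: "((nat \<Rightarrow> nat) \<Rightarrow> complex) \<Rightarrow> (nat \<Rightarrow> complex) \<Rightarrow> nat \<Rightarrow> (nat \<Rightarrow> complex) \<Rightarrow> complex" where
  "shifted_y_integrand f x k y = kernel x (q_unshift k y)
     * (macdonald_coeff (\<lambda>i j. q_unshift k y j / q_unshift k y i) k * series_fun (Suc n) f y)"

text \<open>
  Both integrands are holomorphic for \<open>|x i| < |y i| < |t / q| |x i|\<close>, where for \<open>i = k\<close> the point
  \<open>x k\<close> is replaced by \<open>q x k\<close>. These annuli contain the circles of the contours for \<open>x\<close> and for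
  the shifted point, so the radius of \<open>y k\<close> may be changed by the factor \<open>|q|\<close>.
\<close>

context
  fixes f :: "(nat \<Rightarrow> nat) \<Rightarrow> complex" and x :: "nat \<Rightarrow> complex"
  assumes f: "f \<in> hol_series (Suc n) (cmod (inverse t))"
    and x: "x \<in> ratio_domain (Suc n) separation"
begin

lemma x_nonzero: "i \<in> {1..Suc n} \<Longrightarrow> x i \<noteq> 0"
  using x by (simp add: ratio_domain_def)

lemma x_shift_nonzero: "i \<in> {1..Suc n} \<Longrightarrow> q_shift k x i \<noteq> 0"
  using x_nonzero[of i] x_nonzero[of k] q_nonzero by (auto simp: q_shift_def)

lemma cmod_ratios_x: "i \<in> {1..n} \<Longrightarrow> cmod (ratios x i) < separation"
  using x by (auto simp: ratio_domain_def ratios_def)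

lemma x_shift_domain: "q_shift k x \<in> ratio_domain (Suc n) (cmod (q / t))"
  unfolding ratio_domain_def
proof (intro CollectI conjI ballI)
  fix i assume i: "i \<in> {1..<Suc n}"
  have "cmod (ratios (q_shift k x) i) = cmod (ratio_shift k (ratios x) i)"
    by (subst ratios_q_shift) (use x_nonzero i in auto)
  also have "\<dots> \<le> cmod (ratios x i) / cmod q" by (rule cmod_ratio_shift_le)
  also have "\<dots> < separation / cmod q"
    using cmod_ratios_x[of i] i cmod_q_pos by (intro divide_strict_right_mono) auto
  finally show "cmod (q_shift k x (i + 1) / q_shift k x i) < cmod (q / t)"
    using separation(4) by (simp add: ratios_def)
qed (rule x_shift_nonzero)

lemma annuli_wide:
  assumes "y \<in> annuli x k" "i \<in> {1..Suc n}"
  shows "cmod q * cmod (x i) < cmod (y i)" "cmod (y i) < cmod (t / q) * cmod (x i)"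
proof -
  have "cmod q * cmod (x i) \<le> 1 * cmod (x i)" using q_less_1 by (intro mult_right_mono) auto
  hence "cmod q * cmod (x i) \<le> cmod (q_shift k x i)" "cmod (q_shift k x i) \<le> cmod (x i)"
    by (auto simp: q_shift_def norm_mult)
  moreover from this(2) have "cmod (t / q) * cmod (q_shift k x i) \<le> cmod (t / q) * cmod (x i)"
    by (intro mult_left_mono) auto
  ultimately show "cmod q * cmod (x i) < cmod (y i)" "cmod (y i) < cmod (t / q) * cmod (x i)"
    using assms unfolding annuli_def by fastforce+
qed

lemma annuli_ratio:
  assumes "y \<in> annuli x k" "1 \<le> i" "i < j" "j \<le> Suc n"
  shows "cmod (y j / y i) < cmod (q / t)"
  using assms by (intro separated_y_ratio[OF x] annuli_wide[of _ k]) auto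

lemma annuli_nonzero:
  assumes "y \<in> annuli x k" "i \<in> {1..Suc n}"
  shows "y i \<noteq> 0"
proof -
  have "0 \<le> cmod q * cmod (x i)" by simp
  also have "\<dots> < cmod (y i)" by (rule annuli_wide[OF assms])
  finally show ?thesis by simp
qed

lemma mhol_at_series_fun_annuli: "y \<in> annuli x k \<Longrightarrow> mhol_at (series_fun (Suc n) f) y"
proof (rule mhol_at_series_fun[OF f])
  assume y: "y \<in> annuli x k"
  show "cmod (inverse t) > 0" using t_nonzero by simp
  show "y i \<noteq> 0" if "i \<in> {1..Suc n}" for i using annuli_nonzero[OF y that] .
  show "cmod (y (Suc i) / y i) < cmod (inverse t)" if "i \<in> {1..n}" for i
    using annuli_ratio[OF y, of i "Suc i"] cmod_q_div_t that by auto
qed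

lemma mhol_at_kernel_annuli:
  assumes "\<And>i. i \<in> {1..n} \<Longrightarrow> cmod (z i) < cmod (inverse t)" "y \<in> annuli x k"
  shows "mhol_at (\<lambda>y. reduced_kernel z (\<lambda>i. y i / q_shift k x i)) y"
  by (rule mhol_at_kernel_scaled[OF assms(1) x_shift_nonzero]) (use assms(2) in \<open>auto simp: annuli_def\<close>)

lemma mhol_at_shifted_x_integrand:
  assumes "y \<in> annuli x k"
  shows "mhol_at (\<lambda>y. kernel (q_shift k x) y * series_fun (Suc n) f y) y"
  unfolding kernel_def
proof (rule mhol_at_mult[OF mhol_at_kernel_annuli[OF _ assms] mhol_at_series_fun_annuli[OF assms]])
  fix i assume "i \<in> {1..n}"
  hence "cmod (ratios (q_shift k x) i) < cmod (q / t)"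
    using x_shift_domain[of k] by (auto simp: ratio_domain_def ratios_def)
  thus "cmod (ratios (q_shift k x) i) < cmod (inverse t)" using cmod_q_div_t by linarith
qed

lemma mhol_at_shifted_y_integrand:
  assumes y: "y \<in> annuli x k" and k: "k \<in> {1..Suc n}"
  shows "mhol_at (shifted_y_integrand f x k) y"
proof -
  have "q_unshift k y i / x i = y i / q_shift k x i" for y i
    by (simp add: q_unshift_def q_shift_def)
  hence K: "kernel x (q_unshift k y) = reduced_kernel (ratios x) (\<lambda>i. y i / q_shift k x i)" for y
    by (simp add: kernel_def)
  have "cmod (ratios x i) < cmod (inverse t)" if "i \<in> {1..n}" for i
    using cmod_ratios_x[OF that] separation(3) cmod_q_div_t by linarith
  from mhol_at_kernel_annuli[OF this y]
  have 1: "mhol_at (\<lambda>y. kernel x (q_unshift k y)) y" unfolding K .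
  have u: "q_unshift k y i = (if i = k then 1 / q else 1) * y i" for y i by (simp add: q_unshift_def)
  have "mhol_at (\<lambda>y. macdonald_coeff (\<lambda>i j. q_unshift k y j / q_unshift k y i) k) y"
  proof (rule mhol_at_macdonald_coeff[OF _ _ k])
    fix i j assume ij: "1 \<le> i" "i < j" "j \<le> Suc n"
    have "y i \<noteq> 0" using annuli_nonzero[OF y, of i] ij by simp
    thus "mhol_at (\<lambda>y. q_unshift k y j / q_unshift k y i) y"
      unfolding u using q_nonzero
      by (intro mhol_at_divide mhol_at_mult mhol_at_const mhol_at_coordinate) auto
    have "cmod (q_unshift k y j / q_unshift k y i)
        = cmod (if j = k then 1 / q else if i = k then q else 1) * cmod (y j / y i)"
      using ij unfolding u by (auto simp: norm_mult norm_divide)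
    also have "\<dots> \<le> 1 / cmod q * cmod (y j / y i)"
      using q_less_1 cmod_q_pos mult_le_one[of "cmod q" "cmod q"]
      by (intro mult_right_mono) (auto simp: norm_divide field_simps less_imp_le)
    also have "\<dots> < 1 / cmod q * cmod (q / t)"
      using annuli_ratio[OF y ij] cmod_q_pos by (intro mult_strict_left_mono) auto
    also have "\<dots> = cmod (inverse t)" using cmod_q_pos by (simp add: norm_divide norm_inverse field_simps)
    finally show "q_unshift k y j / q_unshift k y i \<noteq> 1" using inverse_t_le_1 by force
  qed
  from mhol_at_mult[OF 1 mhol_at_mult[OF this mhol_at_series_fun_annuli[OF y]]]
  show ?thesis unfolding shifted_y_integrand_def[abs_def] .
qed

lemma contour_pos: "\<forall>i\<in>{1..Suc n}. contour x i > 0"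
  using x_nonzero contour_ratio' by (simp add: contour_def)

lemma contour_in_annuli:
  assumes "i \<in> {1..Suc n}"
  shows "cmod (q_shift k x i) < contour x i" "contour x i < cmod (t / q) * cmod (q_shift k x i)"
    and "cmod (q_shift k x i) < contour (q_shift k x) i" "contour (q_shift k x) i < cmod (t / q) * cmod (q_shift k x i)"
proof -
  have "cmod (q_shift k x i) > 0" using x_shift_nonzero[OF assms] by simp
  thus "cmod (q_shift k x i) < contour (q_shift k x) i" "contour (q_shift k x) i < cmod (t / q) * cmod (q_shift k x i)"
    using contour_ratio'
      mult_strict_left_mono[of 1 contour_ratio "cmod (q_shift k x i)"]
      mult_strict_left_mono[of contour_ratio "cmod (t / q)" "cmod (q_shift k x i)"]
    by (auto simp: contour_def mult.commute)
  have xi: "cmod (x i) > 0" using x_nonzero[OF assms] by simp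
  have 1: "cmod q * cmod (x i) < 1 * cmod (x i)" using xi q_less_1 by (intro mult_strict_right_mono) auto
  have 2: "cmod (x i) * 1 < contour x i" "contour x i < cmod (x i) * cmod t" "contour x i < cmod (x i) * cmod (t / q)"
    unfolding contour_def using xi contour_ratio contour_ratio' by (intro mult_strict_left_mono; simp)+
  have 3: "cmod (t / q) * (cmod q * cmod (x i)) = cmod (x i) * cmod t"
    using cmod_q_pos by (simp add: norm_divide)
  show "cmod (q_shift k x i) < contour x i"
    using 1 2 by (cases "i = k") (auto simp: q_shift_def norm_mult)
  show "contour x i < cmod (t / q) * cmod (q_shift k x i)"
  proof (cases "i = k")
    case True
    hence "cmod (t / q) * cmod (q_shift k x i) = cmod (x i) * cmod t"
      using 3 by (simp only: q_shift_def fun_upd_same norm_mult)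
    thus ?thesis using 2(2) by (simp only:)
  next
    case False
    thus ?thesis using 2(3) by (simp add: q_shift_def mult.commute)
  qed
qed

lemma torus_contour_in_annuli:
  "y \<in> torus (Suc n) (contour x) \<Longrightarrow> y \<in> annuli x k"
  "y \<in> torus (Suc n) (contour (q_shift k x)) \<Longrightarrow> y \<in> annuli x k"
  using contour_in_annuli unfolding annuli_def torus_def by simp_all

lemma torus_integral_annuli:
  assumes "\<And>y. y \<in> annuli x k \<Longrightarrow> mhol_at F y"
  shows "torus_integral (Suc n) (contour (q_shift k x)) F = torus_integral (Suc n) (contour x) F"
  by (rule torus_integral_radii_eq[where a = "\<lambda>i. cmod (q_shift k x i)"
        and b = "\<lambda>i. cmod (t / q) * cmod (q_shift k x i)"])
     (use contour_in_annuli in \<open>auto intro!: assms simp: annuli_def\<close>)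

lemma q_unshift_q_shift: "q_unshift k (q_shift k y) = y"
  using q_nonzero by (auto simp: q_unshift_def q_shift_def fun_eq_iff)

lemma q_shift_torus:
  "y \<in> torus (Suc n) (contour x) \<Longrightarrow> q_shift k y \<in> torus (Suc n) (contour (q_shift k x))"
  by (auto simp: torus_def contour_def q_shift_def norm_mult)

lemma continuous_on_y_term:
  assumes k: "k \<in> {1..Suc n}"
  shows "continuous_on (torus (Suc n) (contour x)) (\<lambda>y. shifted_y_integrand f x k (q_shift k y))"
proof (rule continuous_on_compose2[where g = "shifted_y_integrand f x k" and t = "annuli x k" and f = "q_shift k"])
  show "continuous_on (annuli x k) (shifted_y_integrand f x k)"
    by (rule mhol_at_imp_continuous_on[OF mhol_at_shifted_y_integrand[OF _ k]])
  show "continuous_on (torus (Suc n) (contour x)) (q_shift k)"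
    unfolding q_shift_def[abs_def]
    by (intro continuous_on_fun_upd continuous_on_id continuous_on_mult continuous_on_const
          continuous_on_subset[OF continuous_on_product_coordinates] subset_UNIV)
  show "q_shift k ` torus (Suc n) (contour x) \<subseteq> annuli x k"
    using q_shift_torus torus_contour_in_annuli(2) by blast
qed

text \<open>
  The substitution \<open>y k \<mapsto> y k / q\<close> multiplies the radius of \<open>y k\<close> by \<open>|q|\<close>; the new torus belongs to the
  shifted point \<open>q_shift k x\<close>, and the annuli contain it together with the old one.
\<close>

lemma torus_integral_y_term:
  assumes k: "k \<in> {1..Suc n}"
  shows "torus_integral (Suc n) (contour x) (\<lambda>y. shifted_y_integrand f x k (q_shift k y))
    = torus_integral (Suc n) (contour x) (shifted_y_integrand f x k)"
proof -
  define c where "c i = (if i = k then q else 1)" for i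
  have shift: "q_shift k y = (\<lambda>i. c i * y i)" for y by (auto simp: q_shift_def c_def)
  have contour: "contour (q_shift k x) = (\<lambda>i. cmod (c i) * contour x i)"
    by (simp add: contour_def fun_eq_iff shift norm_mult mult.assoc)
  have "torus_integral (Suc n) (contour x) (\<lambda>y. shifted_y_integrand f x k (q_shift k y))
     = torus_integral (Suc n) (contour x) (\<lambda>y. shifted_y_integrand f x k (\<lambda>i. c i * y i))"
    by (simp only: shift)
  also have "\<dots> = torus_integral (Suc n) (\<lambda>i. cmod (c i) * contour x i) (shifted_y_integrand f x k)"
  proof (rule torus_integral_scale[OF contour_pos, symmetric])
    show "\<forall>i\<in>{1..Suc n}. c i \<noteq> 0" using q_nonzero by (simp add: c_def)
    show "continuous_on (torus (Suc n) (\<lambda>i. cmod (c i) * contour x i)) (shifted_y_integrand f x k)"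
      unfolding contour[symmetric]
      by (intro mhol_at_imp_continuous_on mhol_at_shifted_y_integrand f x k torus_contour_in_annuli)
  qed
  also have "\<dots> = torus_integral (Suc n) (contour (q_shift k x)) (shifted_y_integrand f x k)"
    by (simp only: contour)
  also have "\<dots> = torus_integral (Suc n) (contour x) (shifted_y_integrand f x k)"
    by (rule torus_integral_annuli[OF mhol_at_shifted_y_integrand[OF _ k]])
  finally show ?thesis .
qed

lemma regular_points_torus:
  assumes y: "y \<in> torus (Suc n) (contour x)"
  shows "regular_points x y"
  unfolding regular_points_def
proof (intro conjI ballI allI impI)
  fix i assume i: "i \<in> {1..Suc n}"
  have xi: "cmod (x i) > 0" using x_nonzero[OF i] by simp
  show "x i \<noteq> 0" by (rule x_nonzero[OF i])
  have yi: "cmod (y i) = cmod (x i) * contour_ratio" using y i by (simp add: torus_def contour_def)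
  show "cmod (x i) < cmod (y i)"
    using mult_strict_left_mono[OF contour_ratio'(1) xi] by (simp add: yi)
  show "cmod (y i) < cmod (t * x i)"
    using mult_strict_left_mono[OF contour_ratio(2) xi] by (simp add: yi norm_mult mult.commute)
next
  fix i j assume ij: "1 \<le> i" "i < j" "j \<le> Suc n"
  have "cmod t * cmod (x j) < cmod t * (separation * cmod (x i))"
    using separated_ratio[OF x ij] cmod_t_pos by (intro mult_strict_left_mono) auto
  also have "\<dots> = (separation * cmod t) * cmod (x i)" by simp
  also have "\<dots> \<le> cmod q * cmod (x i)"
  proof (intro mult_right_mono)
    have "cmod (q / t) \<le> cmod q / 1"
      unfolding norm_divide using one_less_t by (intro frac_le) auto
    thus "separation * cmod t \<le> cmod q" using separation(5) by linarith
  qed auto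
  finally show "cmod (t * x j) < cmod (q * x i)" by (simp add: norm_mult)
qed

text \<open>
  On the left the operator acts on the integral, on the right it acts under the integral sign.
  After the contours have been moved back to that of \<open>x\<close>, the integrands agree pointwise.
\<close>

lemma macdonald_integral_commute:
  "(\<Sum>k = 1..Suc n. s k * (macdonald_coeff (\<lambda>i j. x j / x i) k
      * torus_integral (Suc n) (contour (q_shift k x)) (\<lambda>y. kernel (q_shift k x) y * series_fun (Suc n) f y)))
   = torus_integral (Suc n) (contour x)
      (\<lambda>y. kernel x y * macdonald_fun (Suc n) q (q / t) s (series_fun (Suc n) f) y)"
proof -
  note pos = contour_pos
  let ?T = "torus_integral (Suc n) (contour x)"
  let ?c = "\<lambda>k. macdonald_coeff (\<lambda>i j. x j / x i) k"
  have contx: "continuous_on (torus (Suc n) (contour x)) (\<lambda>y. kernel (q_shift k x) y * series_fun (Suc n) f y)" for k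
    by (intro mhol_at_imp_continuous_on mhol_at_shifted_x_integrand torus_contour_in_annuli)
  have conty: "continuous_on (torus (Suc n) (contour x)) (shifted_y_integrand f x k)" if "k \<in> {1..Suc n}" for k
    by (intro mhol_at_imp_continuous_on mhol_at_shifted_y_integrand torus_contour_in_annuli that)
  have "(\<Sum>k = 1..Suc n. s k * (?c k * torus_integral (Suc n) (contour (q_shift k x))
          (\<lambda>y. kernel (q_shift k x) y * series_fun (Suc n) f y)))
      = (\<Sum>k = 1..Suc n. ?T (\<lambda>y. s k * (?c k * (kernel (q_shift k x) y * series_fun (Suc n) f y))))"
    by (simp only: torus_integral_cmult[OF pos] torus_integral_annuli[OF mhol_at_shifted_x_integrand])
  also have "\<dots> = ?T (\<lambda>y. \<Sum>k = 1..Suc n. s k * (?c k * (kernel (q_shift k x) y * series_fun (Suc n) f y)))"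
    by (intro torus_integral_sum[OF pos, symmetric] continuous_on_mult continuous_on_const contx)
  also have "\<dots> = ?T (\<lambda>y. \<Sum>k = 1..Suc n. s k * shifted_y_integrand f x k y)"
  proof (rule torus_integral_cong[OF pos])
    fix y assume "y \<in> torus (Suc n) (contour x)"
    hence reg: "regular_points x y" by (rule regular_points_torus)
    have "(\<Sum>k = 1..Suc n. s k * (?c k * (kernel (q_shift k x) y * series_fun (Suc n) f y)))
        = (\<Sum>k = 1..Suc n. s k * (?c k * kernel (q_shift k x) y)) * series_fun (Suc n) f y"
      unfolding sum_distrib_right by (simp only: mult.assoc)
    also have "\<dots> = (\<Sum>k = 1..Suc n. s k * shifted_y_integrand f x k y)"
      unfolding kernel_intertwines[OF reg] sum_distrib_right shifted_y_integrand_def by (simp only: mult_ac)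
    finally show "(\<Sum>k = 1..Suc n. s k * (?c k * (kernel (q_shift k x) y * series_fun (Suc n) f y)))
        = (\<Sum>k = 1..Suc n. s k * shifted_y_integrand f x k y)" .
  qed
  also have "\<dots> = (\<Sum>k = 1..Suc n. ?T (\<lambda>y. s k * shifted_y_integrand f x k y))"
    by (intro torus_integral_sum[OF pos] continuous_on_mult continuous_on_const conty)
  also have "\<dots> = (\<Sum>k = 1..Suc n. ?T (\<lambda>y. s k * shifted_y_integrand f x k (q_shift k y)))"
    unfolding torus_integral_cmult[OF pos] by (intro sum.cong refl) (simp only: torus_integral_y_term)
  also have "\<dots> = ?T (\<lambda>y. \<Sum>k = 1..Suc n. s k * shifted_y_integrand f x k (q_shift k y))"
    by (intro torus_integral_sum[OF pos, symmetric] continuous_on_mult continuous_on_const continuous_on_y_term)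
  also have "(\<lambda>y. \<Sum>k = 1..Suc n. s k * shifted_y_integrand f x k (q_shift k y))
      = (\<lambda>y. kernel x y * macdonald_fun (Suc n) q (q / t) s (series_fun (Suc n) f) y)"
    unfolding macdonald_fun_eq shifted_y_integrand_def q_unshift_q_shift sum_distrib_left by (simp only: mult_ac)
  finally show ?thesis .
qed

lemma torus_contour_ratio_domain:
  assumes y: "y \<in> torus (Suc n) (contour x)"
  shows "y \<in> ratio_domain (Suc n) (cmod (q / t))"
  unfolding ratio_domain_def
  using annuli_nonzero[OF torus_contour_in_annuli(1)[OF y]] annuli_ratio[OF torus_contour_in_annuli(1)[OF y]]
  by auto

end

text \<open>
  The series \<open>h\<close> of \<open>I (D f)\<close> represents \<open>D (I f)\<close> for small ratios, hence it is the series that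
  \<open>macdonald_op\<close> assigns to \<open>I f\<close>.
\<close>

lemma integral_macdonald_commute:
  assumes f: "f \<in> hol_series (Suc n) (cmod (inverse t))"
  shows "integral_defined (Suc n) q t s0 s f
    \<and> macdonald_defined (Suc n) q (q / t) s f
    \<and> macdonald_defined (Suc n) q (q / t) s (integral_op (Suc n) q t s0 s f)
    \<and> integral_defined (Suc n) q t s0 s (macdonald_op (Suc n) q (q / t) s f)
    \<and> macdonald_op (Suc n) q (q / t) s (integral_op (Suc n) q t s0 s f)
      = integral_op (Suc n) q t s0 s (macdonald_op (Suc n) q (q / t) s f)"
proof -
  let ?D = "macdonald_graph (Suc n) q (q / t) s" and ?I = "integral_graph (Suc n) q t s0 s"
  let ?C = "kernel_const (Suc n) q t s0 s"
  let ?J = "\<lambda>f x. ?C * torus_integral (Suc n) (contour x) (\<lambda>y. kernel x y * series_fun (Suc n) f y)"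
  have inverse_t_pos: "0 < cmod (inverse t)" using t_nonzero by simp
  have c_eq: "cmod q * cmod (inverse t) = cmod (q / t)" by (simp add: norm_divide norm_inverse divide_inverse norm_mult)
  have f': "f \<in> hol_series (Suc n) (cmod (q / t))"
    using f hol_series_mono[of "cmod (q / t)" "cmod (inverse t)"] cmod_q_div_t(2) by auto
  obtain g where g: "?I f g" "\<And>g'. ?I f g' \<Longrightarrow> g' = g" "g \<in> hol_series (Suc n) (cmod (q / t))"
    "\<And>x. x \<in> ratio_domain (Suc n) (cmod (q / t)) \<Longrightarrow>
       ((\<lambda>m. g m * zmonom (Suc n) (ratios x) m) has_sum ?J f x) (exponents (Suc n))"
    by (rule integral_graph_properties[OF f'], rule that)
  obtain d where d: "?D f d" "\<And>d'. ?D f d' \<Longrightarrow> d' = d" "d \<in> hol_series (Suc n) (cmod (q / t))"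
    "\<And>x. x \<in> ratio_domain (Suc n) (cmod (q / t)) \<Longrightarrow>
       series_fun (Suc n) d x = macdonald_fun (Suc n) q (q / t) s (series_fun (Suc n) f) x"
    using macdonald_graph_properties[OF f inverse_t_pos inverse_t_le_1] unfolding c_eq by metis
  obtain h where h: "?I d h" "\<And>h'. ?I d h' \<Longrightarrow> h' = h" "h \<in> hol_series (Suc n) (cmod (q / t))"
    "\<And>x. x \<in> ratio_domain (Suc n) (cmod (q / t)) \<Longrightarrow>
       ((\<lambda>m. h m * zmonom (Suc n) (ratios x) m) has_sum ?J d x) (exponents (Suc n))"
    by (rule integral_graph_properties[OF d(3)], rule that)
  obtain m where m: "?D g m" "\<And>m'. ?D g m' \<Longrightarrow> m' = m"
    using macdonald_graph_properties[OF g(3) cmod_q_div_t(1)] cmod_q_div_t(3) by (metis less_imp_le)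
  have "?D g h"
    unfolding macdonald_graph_def
  proof (intro conjI exI[of _ separation] ballI separation(1))
    show "h \<in> power_series (Suc n)" using h(1) by (simp add: integral_graph_def)
    fix x assume x: "x \<in> ratio_domain (Suc n) separation"
    have "x \<in> ratio_domain (Suc n) (cmod (q / t))"
      using x separation(3) by (force simp: ratio_domain_def)
    note sum = h(4)[OF this]
    have "series_fun (Suc n) g (q_shift k x) = ?J f (q_shift k x)" for k
      unfolding series_fun_def[of _ g] by (rule infsumI[OF g(4)[OF x_shift_domain[OF f x]]])
    hence "macdonald_fun (Suc n) q (q / t) s (series_fun (Suc n) g) x
       = ?C * (\<Sum>k = 1..Suc n. s k * (macdonald_coeff (\<lambda>i j. x j / x i) k
      * torus_integral (Suc n) (contour (q_shift k x)) (\<lambda>y. kernel (q_shift k x) y * series_fun (Suc n) f y)))"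
      unfolding macdonald_fun_eq sum_distrib_left by (simp only: mult_ac)
    also have "\<dots> = ?C * torus_integral (Suc n) (contour x)
      (\<lambda>y. kernel x y * macdonald_fun (Suc n) q (q / t) s (series_fun (Suc n) f) y)"
      by (simp only: macdonald_integral_commute[OF f x])
    also have "torus_integral (Suc n) (contour x)
        (\<lambda>y. kernel x y * macdonald_fun (Suc n) q (q / t) s (series_fun (Suc n) f) y)
      = torus_integral (Suc n) (contour x) (\<lambda>y. kernel x y * series_fun (Suc n) d y)"
      by (rule torus_integral_cong[OF contour_pos[OF f x]])
         (simp only: d(4)[OF torus_contour_ratio_domain[OF f x]])
    finally show "((\<lambda>m. h m * zmonom (Suc n) (ratios x) m) has_sum
        macdonald_fun (Suc n) q (q / t) s (series_fun (Suc n) g) x) (exponents (Suc n))"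
      using sum by (simp only:)
  qed
  hence hm: "h = m" by (rule m(2))
  have ops: "integral_op (Suc n) q t s0 s f = g" "macdonald_op (Suc n) q (q / t) s f = d"
    "integral_op (Suc n) q t s0 s d = h" "macdonald_op (Suc n) q (q / t) s g = m"
    unfolding integral_op_def macdonald_op_def using g d h m by (intro the_equality; blast)+
  have "\<exists>!g. ?I f g" "\<exists>!d. ?D f d" "\<exists>!h. ?I d h" "\<exists>!m. ?D g m"
    using g d h m by (metis)+
  thus ?thesis unfolding integral_defined_def macdonald_defined_def ops hm by simp
qed

end

theorem theorem4p10:
  fixes N :: nat and q t s0 :: complex and s :: "nat \<Rightarrow> complex"
    and f :: "(nat \<Rightarrow> nat) \<Rightarrow> complex"
  assumes "N \<ge> 2"
    and "cmod q < 1" and "t \<noteq> 0" and "cmod (inverse t) < cmod q"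
    and "s0 \<noteq> 0" and "\<forall>i\<in>{1..N}. s i \<noteq> 0"
    and generic: "\<forall>i\<in>{1..N}. qpoch q (q * s0 / s i) \<noteq> 0 \<and> qpoch q (q * s i / (t * s0)) \<noteq> 0"
    and "f \<in> hol_series N (cmod (inverse t))"
  shows "integral_defined N q t s0 s f
    \<and> macdonald_defined N q (q / t) s f
    \<and> macdonald_defined N q (q / t) s (integral_op N q t s0 s f)
    \<and> integral_defined N q t s0 s (macdonald_op N q (q / t) s f)
    \<and> macdonald_op N q (q / t) s (integral_op N q t s0 s f)
      = integral_op N q t s0 s (macdonald_op N q (q / t) s f)"
proof -
  obtain n where N: "N = Suc n" using assms(1) by (cases N) auto
  interpret kernel_parameters q t s0 s n
    by unfold_locales (use assms N in auto)
  show ?thesis using integral_macdonald_commute assms(8) unfolding N by blast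
qed

end
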